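(* Let $\theta\in\,]0,1]$. The vector space $\big(\mathcal{M}_{\mathrm{D}\otimes\mathrm{D},0}(\mathrm{K}),\|\cdot\|_{\theta}\big)$ satisfies the following properties. 1. All norms $\|\cdot\|_{\theta}$ are well-defined and equivalent; that is, for all $(\theta,\theta')\in\,]0,1]^2$ there exists a constant $C>0$ such that $$\forall f\in\mathcal{M}_{\mathrm{D}\otimes\mathrm{D},0}(\mathrm{K}):\quad \|f\|_{\theta}\le C\,\|f\|_{\theta'}.$$ 2. It is a Banach space. 3. Equipped with the norm $\|[\mathrm{D}\otimes\mathrm{D}]\{\cdot\}\|_{\mathcal{M}}$, it is the dual space of $[\mathrm{D}\otimes\mathrm{D}]\{\mathcal{C}_0(\mathbb{R}^2)\}/M_0$, where $$M_0=\big\{v\in[\mathrm{D}\otimes\mathrm{D}]\{\mathcal{C}_0(\mathbb{R}^2)\}:\ \forall f\in\mathcal{M}_{\mathrm{D}\otimes\mathrm{D},0}(\mathrm{K}),\ \langle f,v\rangle=0\big\}$$ and $[\mathrm{D}\otimes\mathrm{D}]\{\mathcal{C}_0(\mathbb{R}^2)\}$ is equipped with the norm $\|[\mathrm{D}\otimes\mathrm{D}]\{\phi\}\|=\|\phi\|_{\infty}$, $\phi\in\mathcal{C}_0(\mathbb{R}^2)$.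
   Context: $\mathrm{K}=[0,1]^2$ and $\mathrm{K}^c=\mathbb{R}^2\setminus\mathrm{K}$. Derivatives are in the sense of distributions: for $f\in\mathcal{D}'(\mathbb{R}^2)$, $[\mathrm{D}\otimes\mathrm{I}]\{f\}=\partial_{x_1}f$, $[\mathrm{I}\otimes\mathrm{D}]\{f\}=\partial_{x_2}f$, $[\mathrm{D}\otimes\mathrm{D}]\{f\}=\partial_{x_1}\partial_{x_2}f$. $\mathcal{M}(\mathrm{K})$ is the space of bounded (finite signed) Borel measures on $\mathbb{R}^2$ supported in $\mathrm{K}$, with total variation norm $\|\cdot\|_{\mathcal{M}}$. Define $$\mathcal{M}_{\mathrm{D}\otimes\mathrm{D},0}(\mathrm{K})=\{f\in\mathcal{D}'(\mathbb{R}^2):\ [\mathrm{D}\otimes\mathrm{D}]\{f\}\in\mathcal{M}(\mathrm{K})\ \text{and}\ \langle f,\phi\rangle=0\ \ \forall\phi\in\mathcal{C}_c^\infty(\mathrm{K}^c)\},$$ $$\|\nabla\{f\}\|_{\mathcal{M}^2}=\|[\mathrm{I}\otimes\mathrm{D}]\{f\}\|_{\mathcal{M}}+\|[\mathrm{D}\otimes\mathrm{I}]\{f\}\|_{\mathcal{M}},$$ $$\|f\|_\theta=\theta\,\|[\mathrm{D}\otimes\mathrm{D}]\{f\}\|_{\mathcal{M}}+(1-\theta)\,\|\nabla\{f\}\|_{\mathcal{M}^2}.$$ $\mathcal{C}_0(\mathbb{R}^2)$ is the space of continuous functions vanishing at infinity with the sup norm. $[\mathrm{D}\otimes\mathrm{D}]\{\mathcal{C}_0(\mathbb{R}^2)\}$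 is the space of distributions $[\mathrm{D}\otimes\mathrm{D}]\{\phi\}$, $\phi\in\mathcal{C}_0(\mathbb{R}^2)$, and the pairing is $\langle f,[\mathrm{D}\otimes\mathrm{D}]\{\phi\}\rangle=\int\phi\,\mathrm{d}\big([\mathrm{D}\otimes\mathrm{D}]\{f\}\big)$. Quotient spaces carry their quotient norms. *)

theory Defs
  imports "HOL-Analysis.Analysis"
begin

type_synonym plane = "real \<times> real"

definition pd :: "plane \<Rightarrow> (plane \<Rightarrow> real) \<Rightarrow> plane \<Rightarrow> real" where
  "pd b g = (\<lambda>x. frechet_derivative g (at x) b)"

definition pds :: "plane list \<Rightarrow> (plane \<Rightarrow> real) \<Rightarrow> plane \<Rightarrow> real" where
  "pds w g = foldr pd w g"

text \<open>Since differentiable functions are continuous, this says that all iterated partial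
  derivatives of all orders exist and are continuous.\<close>

definition smooth :: "(plane \<Rightarrow> real) \<Rightarrow> bool" where
  "smooth g \<longleftrightarrow> (\<forall>w\<in>lists Basis. \<forall>x. pds w g differentiable (at x))"

definition support :: "(plane \<Rightarrow> real) \<Rightarrow> plane set" where
  "support g = closure {x. g x \<noteq> 0}"

lemma pds_Nil [simp]: "pds [] g = g"
  by (simp add: pds_def)

lemma pds_Cons: "pds (b # w) g = pd b (pds w g)"
  by (simp add: pds_def)

lemma pds_pd: "pds w (pd b g) = pds (w @ [b]) g"
  by (simp add: pds_def)

lemma smoothD: "smooth g \<Longrightarrow> w \<in> lists Basis \<Longrightarrow> pds w g differentiable (at x)"
  unfolding smooth_def by blast

lemma pd_add:
  assumes "\<And>x. g differentiable (at x)" "\<And>x. h differentiable (at x)"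
  shows "pd b (\<lambda>x. g x + h x) = (\<lambda>x. pd b g x + pd b h x)"
proof
  fix x
  have "((\<lambda>x. g x + h x) has_derivative
      (\<lambda>v. frechet_derivative g (at x) v + frechet_derivative h (at x) v)) (at x)"
    using assms by (intro has_derivative_add) (auto simp: frechet_derivative_works[symmetric])
  from frechet_derivative_at[OF this] show "pd b (\<lambda>x. g x + h x) x = pd b g x + pd b h x"
    unfolding pd_def by metis
qed

lemma pd_scaleR:
  assumes "\<And>x. g differentiable (at x)"
  shows "pd b (\<lambda>x. c * g x) = (\<lambda>x. c * pd b g x)"
proof
  fix x
  have "((\<lambda>x. c * g x) has_derivative (\<lambda>v. c * frechet_derivative g (at x) v)) (at x)"
    using assms by (intro has_derivative_mult_right) (auto simp: frechet_derivative_works[symmetric])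
  from frechet_derivative_at[OF this] show "pd b (\<lambda>x. c * g x) x = c * pd b g x"
    unfolding pd_def by metis
qed

lemma pds_add:
  assumes "smooth g" "smooth h" "w \<in> lists Basis"
  shows "pds w (\<lambda>x. g x + h x) = (\<lambda>x. pds w g x + pds w h x)"
  using assms(3)
proof (induction w)
  case (Cons b w)
  then have w: "w \<in> lists Basis" by simp
  have "pds (b # w) (\<lambda>x. g x + h x) = pd b (\<lambda>x. pds w g x + pds w h x)"
    using Cons by (simp add: pds_Cons)
  also have "\<dots> = (\<lambda>x. pd b (pds w g) x + pd b (pds w h) x)"
    by (rule pd_add) (use smoothD[OF assms(1) w] smoothD[OF assms(2) w] in auto)
  finally show ?case by (simp add: pds_Cons)
qed simp

lemma pds_scaleR:
  assumes "smooth g" "w \<in> lists Basis"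
  shows "pds w (\<lambda>x. c * g x) = (\<lambda>x. c * pds w g x)"
  using assms(2)
proof (induction w)
  case (Cons b w)
  then have w: "w \<in> lists Basis" by simp
  have "pds (b # w) (\<lambda>x. c * g x) = pd b (\<lambda>x. c * pds w g x)"
    using Cons by (simp add: pds_Cons)
  also have "\<dots> = (\<lambda>x. c * pd b (pds w g) x)"
    by (rule pd_scaleR) (use smoothD[OF assms(1) w] in auto)
  finally show ?case by (simp add: pds_Cons)
qed simp

lemma smooth_add: "smooth g \<Longrightarrow> smooth h \<Longrightarrow> smooth (\<lambda>x. g x + h x)"
  unfolding smooth_def[of "\<lambda>x. g x + h x"] by (auto simp: pds_add smoothD)

lemma smooth_scaleR: "smooth g \<Longrightarrow> smooth (\<lambda>x. c * g x)"
  unfolding smooth_def[of "\<lambda>x. c * g x"] by (auto simp: pds_scaleR smoothD)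

lemma smooth_pd: "smooth g \<Longrightarrow> b \<in> Basis \<Longrightarrow> smooth (pd b g)"
  unfolding smooth_def[of "pd b g"] by (auto simp: pds_pd intro!: smoothD)

lemma pds_zero: "pds w (\<lambda>x. 0) = (\<lambda>x. 0)"
proof (induction w)
  case (Cons b w)
  have "pds (b # w) (\<lambda>x. 0) = pd b (\<lambda>x. 0)"
    unfolding pds_Cons Cons.IH ..
  then show ?case unfolding pd_def frechet_derivative_const .
qed simp

lemma smooth_zero: "smooth (\<lambda>x. 0)"
  unfolding smooth_def pds_zero by simp

lemma support_add: "support (\<lambda>x. g x + h x) \<subseteq> support g \<union> support h"
  unfolding support_def closure_Un[symmetric] by (intro closure_mono) auto

lemma support_scaleR: "support (\<lambda>x. c * g x) \<subseteq> support g"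
  unfolding support_def by (intro closure_mono) auto

lemma eq_0_outside_support: "x \<notin> support g \<Longrightarrow> g x = 0"
  using closure_subset[of "{x. g x \<noteq> 0}"] unfolding support_def by blast

lemma closed_support [simp]: "closed (support g)"
  unfolding support_def by (rule closed_closure)

lemma support_pd: "support (pd b g) \<subseteq> support g"
proof -
  have *: "pd b g x = 0" if x: "x \<notin> support g" for x
  proof -
    have "open (- support g)"
      using closed_support by (simp only: open_Compl)
    then have "(g has_derivative (\<lambda>_. 0)) (at x)"
      by (rule has_derivative_transform_within_open[OF has_derivative_const])
        (simp_all only: ComplI ComplD x eq_0_outside_support Compl_iff not_False_eq_True)
    then have "frechet_derivative g (at x) = (\<lambda>_. 0)"
      by (rule frechet_derivative_at[symmetric])
    then show ?thesis unfolding pd_def by (rule fun_cong)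
  qed
  have "{x. pd b g x \<noteq> 0} \<subseteq> support g"
    using * by blast
  then show ?thesis
    unfolding support_def[of "pd b g"] using closed_support by (rule closure_minimal)
qed

lemma compact_support_mono: "compact (support g) \<Longrightarrow> support h \<subseteq> support g \<Longrightarrow> compact (support h)"
  using compact_Int_closed[of "support g" "support h"]
  unfolding support_def by (metis Int_absorb1 closed_closure)

lemma compact_support_add:
  assumes "compact (support g)" "compact (support h)"
  shows "compact (support (\<lambda>x. g x + h x))"
proof -
  have "compact ((support g \<union> support h) \<inter> support (\<lambda>x. g x + h x))"
    using assms by (intro compact_Int_closed compact_Un) (auto simp: support_def)
  moreover have "(support g \<union> support h) \<inter> support (\<lambda>x. g x + h x) = support (\<lambda>x. g x + h x)"
    using support_add[of g h] by blast
  ultimately show ?thesis by metis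
qed

typedef test_fun = "{g. smooth g \<and> compact (support g)}" morphisms test_apply Abs_test_fun
  by (rule exI[of _ "\<lambda>_. 0"]) (simp add: smooth_zero support_def)

setup_lifting type_definition_test_fun

instantiation test_fun :: real_vector
begin

lift_definition zero_test_fun :: test_fun is "\<lambda>_. 0"
  by (simp add: smooth_zero support_def)

lift_definition plus_test_fun :: "test_fun \<Rightarrow> test_fun \<Rightarrow> test_fun" is "\<lambda>g h x. g x + h x"
  by (simp add: smooth_add compact_support_add)

lift_definition scaleR_test_fun :: "real \<Rightarrow> test_fun \<Rightarrow> test_fun" is "\<lambda>c g x. c * g x"
  using compact_support_mono support_scaleR by (auto simp: smooth_scaleR)

definition uminus_test_fun :: "test_fun \<Rightarrow> test_fun" where
  "uminus_test_fun g = (-1) *\<^sub>R g"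

definition minus_test_fun :: "test_fun \<Rightarrow> test_fun \<Rightarrow> test_fun" where
  "minus_test_fun g h = g + (-1) *\<^sub>R h"

instance
  by standard
    (simp_all add: uminus_test_fun_def minus_test_fun_def, (transfer, auto simp: algebra_simps)+)

end

lift_definition test_pd1 :: "test_fun \<Rightarrow> test_fun" is "pd (1, 0)"
  using compact_support_mono support_pd by (auto simp: smooth_pd Basis_prod_def)

lift_definition test_pd2 :: "test_fun \<Rightarrow> test_fun" is "pd (0, 1)"
  using compact_support_mono support_pd by (auto simp: smooth_pd Basis_prod_def)

text \<open>Each multi-index derivative occurs once for every ordering of its differentiations,
  which changes the seminorm only up to a constant depending on \<open>N\<close>.\<close>

definition test_seminorm :: "nat \<Rightarrow> test_fun \<Rightarrow> real" where
  "test_seminorm N \<phi> =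
    (\<Sum>w\<in>{w. w \<in> lists Basis \<and> length w \<le> N}. SUP x. \<bar>pds w (test_apply \<phi>) x\<bar>)"

lemma support_pds: "support (pds w g) \<subseteq> support g"
  by (induction w) (use support_pd in \<open>fastforce simp: pds_Cons\<close>)+

lemma continuous_test: "continuous_on S (test_apply \<phi>)"
  using smoothD[of "test_apply \<phi>" "[]"] test_apply[of \<phi>]
  by (auto intro!: continuous_at_imp_continuous_on differentiable_imp_continuous_within)

lemma bdd_pds:
  assumes "w \<in> lists Basis"
  shows "bdd_above (range (\<lambda>x. \<bar>pds w (test_apply \<phi>) x\<bar>))"
proof -
  let ?g = "pds w (test_apply \<phi>)"
  have s: "smooth (test_apply \<phi>)" and c: "compact (support (test_apply \<phi>))"
    using test_apply[of \<phi>] by auto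
  have "continuous_on (support (test_apply \<phi>)) ?g"
    using smoothD[OF s assms]
    by (auto intro!: continuous_at_imp_continuous_on differentiable_imp_continuous_within)
  then have "bounded (?g ` support (test_apply \<phi>))"
    using c compact_continuous_image compact_imp_bounded by blast
  then obtain B where B: "\<And>x. x \<in> support (test_apply \<phi>) \<Longrightarrow> \<bar>?g x\<bar> \<le> B"
    unfolding bounded_iff by auto
  have "\<bar>?g x\<bar> \<le> max B 0" for x
  proof (cases "x \<in> support (test_apply \<phi>)")
    case False
    then have "?g x = 0"
      using support_pds[of w "test_apply \<phi>"] eq_0_outside_support by blast
    then show ?thesis by simp
  qed (use B[of x] in auto)
  then show ?thesis by (intro bdd_aboveI[of _ "max B 0"]) auto
qed

lemma finite_words: "finite {w. w \<in> lists (Basis :: plane set) \<and> length w \<le> N}"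
  using finite_lists_length_le[of "Basis :: plane set" N]
  by (simp only: lists_eq_set mem_Collect_eq finite_Basis)

lemma SUP_pds_nonneg:
  assumes "w \<in> lists Basis"
  shows "0 \<le> (SUP x. \<bar>pds w (test_apply \<phi>) x\<bar>)"
  using cSUP_upper2[OF bdd_pds[OF assms], of 0] by simp

lemma test_seminorm_nonneg: "0 \<le> test_seminorm N \<phi>"
  unfolding test_seminorm_def by (intro sum_nonneg) (auto intro: SUP_pds_nonneg)

lemma test_seminorm_mono: "M \<le> N \<Longrightarrow> test_seminorm M \<phi> \<le> test_seminorm N \<phi>"
  unfolding test_seminorm_def
  by (intro sum_mono2 finite_words) (auto intro: SUP_pds_nonneg)

lemma test_seminorm_pd:
  assumes "b \<in> Basis" "test_apply \<psi> = pd b (test_apply \<phi>)"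
  shows "test_seminorm N \<psi> \<le> test_seminorm (Suc N) \<phi>"
proof -
  let ?W = "{w. w \<in> lists (Basis :: plane set) \<and> length w \<le> N}"
  have "test_seminorm N \<psi> = (\<Sum>w\<in>?W. SUP x. \<bar>pds (w @ [b]) (test_apply \<phi>) x\<bar>)"
    by (simp add: test_seminorm_def assms(2) pds_pd)
  also have "\<dots> = (\<Sum>w\<in>(\<lambda>w. w @ [b]) ` ?W. SUP x. \<bar>pds w (test_apply \<phi>) x\<bar>)"
    by (subst sum.reindex) (auto simp: inj_on_def)
  also have "\<dots> \<le> test_seminorm (Suc N) \<phi>"
    unfolding test_seminorm_def using assms(1)
    by (intro sum_mono2 finite_words) (auto intro!: SUP_pds_nonneg)
  finally show ?thesis .
qed

definition is_distribution :: "(test_fun \<Rightarrow> real) \<Rightarrow> bool" where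
  "is_distribution u \<longleftrightarrow> linear u \<and>
    (\<forall>S. compact S \<longrightarrow> (\<exists>C N. \<forall>\<phi>. support (test_apply \<phi>) \<subseteq> S \<longrightarrow> \<bar>u \<phi>\<bar> \<le> C * test_seminorm N \<phi>))"

lemma is_distribution_zero: "is_distribution (\<lambda>_. 0)"
  unfolding is_distribution_def
  by (auto simp: linear_iff intro!: exI[of _ 0])

lemma is_distribution_add:
  assumes "is_distribution u" "is_distribution v"
  shows "is_distribution (\<lambda>\<phi>. u \<phi> + v \<phi>)"
  unfolding is_distribution_def
proof (intro conjI allI impI)
  show "linear (\<lambda>\<phi>. u \<phi> + v \<phi>)"
    using assms by (auto simp: is_distribution_def linear_iff algebra_simps)
  fix S :: "plane set" assume "compact S"
  then obtain C N C' N' where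
    u: "\<And>\<phi>. support (test_apply \<phi>) \<subseteq> S \<Longrightarrow> \<bar>u \<phi>\<bar> \<le> C * test_seminorm N \<phi>" and
    v: "\<And>\<phi>. support (test_apply \<phi>) \<subseteq> S \<Longrightarrow> \<bar>v \<phi>\<bar> \<le> C' * test_seminorm N' \<phi>"
    using assms unfolding is_distribution_def by meson
  show "\<exists>C N. \<forall>\<phi>. support (test_apply \<phi>) \<subseteq> S \<longrightarrow> \<bar>u \<phi> + v \<phi>\<bar> \<le> C * test_seminorm N \<phi>"
  proof (intro exI allI impI)
    fix \<phi> assume s: "support (test_apply \<phi>) \<subseteq> S"
    let ?s = "test_seminorm (max N N') \<phi>"
    have "\<bar>u \<phi>\<bar> \<le> \<bar>C\<bar> * ?s"
      using u[OF s] test_seminorm_nonneg[of N \<phi>] test_seminorm_mono[of N "max N N'" \<phi>]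
      by (smt (verit) max.cobounded1 mult_right_mono mult_left_mono)
    moreover have "\<bar>v \<phi>\<bar> \<le> \<bar>C'\<bar> * ?s"
      using v[OF s] test_seminorm_nonneg[of N' \<phi>] test_seminorm_mono[of N' "max N N'" \<phi>]
      by (smt (verit) max.cobounded2 mult_right_mono mult_left_mono)
    ultimately show "\<bar>u \<phi> + v \<phi>\<bar> \<le> (\<bar>C\<bar> + \<bar>C'\<bar>) * ?s"
      unfolding distrib_right by linarith
  qed
qed

lemma is_distribution_scaleR:
  assumes "is_distribution u"
  shows "is_distribution (\<lambda>\<phi>. c * u \<phi>)"
  unfolding is_distribution_def
proof (intro conjI allI impI)
  show "linear (\<lambda>\<phi>. c * u \<phi>)"
    using assms by (auto simp: is_distribution_def linear_iff algebra_simps)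
  fix S :: "plane set" assume "compact S"
  then obtain C N where
    u: "\<And>\<phi>. support (test_apply \<phi>) \<subseteq> S \<Longrightarrow> \<bar>u \<phi>\<bar> \<le> C * test_seminorm N \<phi>"
    using assms unfolding is_distribution_def by meson
  show "\<exists>C N. \<forall>\<phi>. support (test_apply \<phi>) \<subseteq> S \<longrightarrow> \<bar>c * u \<phi>\<bar> \<le> C * test_seminorm N \<phi>"
  proof (intro exI allI impI)
    fix \<phi> assume s: "support (test_apply \<phi>) \<subseteq> S"
    show "\<bar>c * u \<phi>\<bar> \<le> (\<bar>c\<bar> * C) * test_seminorm N \<phi>"
      using mult_left_mono[OF u[OF s], of "\<bar>c\<bar>"] by (simp add: abs_mult mult.assoc)
  qed
qed

lemma is_distribution_pd:
  assumes u: "is_distribution u" and T: "linear T"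
    and pd: "\<And>\<phi>. test_apply (T \<phi>) = pd b (test_apply \<phi>)" and b: "b \<in> Basis"
  shows "is_distribution (\<lambda>\<phi>. - u (T \<phi>))"
  unfolding is_distribution_def
proof (intro conjI allI impI)
  show "linear (\<lambda>\<phi>. - u (T \<phi>))"
    using u T by (auto simp: is_distribution_def linear_iff algebra_simps)
  fix S :: "plane set" assume "compact S"
  then obtain C N where
    *: "\<And>\<phi>. support (test_apply \<phi>) \<subseteq> S \<Longrightarrow> \<bar>u \<phi>\<bar> \<le> C * test_seminorm N \<phi>"
    using u unfolding is_distribution_def by meson
  show "\<exists>C N. \<forall>\<phi>. support (test_apply \<phi>) \<subseteq> S \<longrightarrow> \<bar>- u (T \<phi>)\<bar> \<le> C * test_seminorm N \<phi>"
  proof (intro exI allI impI)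
    fix \<phi> assume s: "support (test_apply \<phi>) \<subseteq> S"
    then have "support (test_apply (T \<phi>)) \<subseteq> S"
      using support_pd[of b "test_apply \<phi>"] by (auto simp: pd)
    from *[OF this] have "\<bar>- u (T \<phi>)\<bar> \<le> C * test_seminorm N (T \<phi>)" by simp
    also have "\<dots> \<le> \<bar>C\<bar> * test_seminorm N (T \<phi>)"
      by (intro mult_right_mono test_seminorm_nonneg) auto
    also have "\<dots> \<le> \<bar>C\<bar> * test_seminorm (Suc N) \<phi>"
      by (intro mult_left_mono test_seminorm_pd[OF b]) (auto simp: pd)
    finally show "\<bar>- u (T \<phi>)\<bar> \<le> \<bar>C\<bar> * test_seminorm (Suc N) \<phi>" .
  qed
qed

lemma linear_test_pd1: "linear test_pd1"
  unfolding linear_iff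
proof (intro conjI allI; transfer)
  fix g h :: "plane \<Rightarrow> real" and c :: real
  assume "smooth g \<and> compact (support g)"
  then have g: "g differentiable (at x)" for x using smoothD[of g "[]"] by auto
  from g show "pd (1, 0) (\<lambda>x. c * g x) = (\<lambda>x. c * pd (1, 0) g x)" by (rule pd_scaleR)
  assume "smooth h \<and> compact (support h)"
  then have "h differentiable (at x)" for x using smoothD[of h "[]"] by auto
  with g show "pd (1, 0) (\<lambda>x. g x + h x) = (\<lambda>x. pd (1, 0) g x + pd (1, 0) h x)" by (rule pd_add)
qed

lemma linear_test_pd2: "linear test_pd2"
  unfolding linear_iff
proof (intro conjI allI; transfer)
  fix g h :: "plane \<Rightarrow> real" and c :: real
  assume "smooth g \<and> compact (support g)"
  then have g: "g differentiable (at x)" for x using smoothD[of g "[]"] by auto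
  from g show "pd (0, 1) (\<lambda>x. c * g x) = (\<lambda>x. c * pd (0, 1) g x)" by (rule pd_scaleR)
  assume "smooth h \<and> compact (support h)"
  then have "h differentiable (at x)" for x using smoothD[of h "[]"] by auto
  with g show "pd (0, 1) (\<lambda>x. g x + h x) = (\<lambda>x. pd (0, 1) g x + pd (0, 1) h x)" by (rule pd_add)
qed

typedef distribution = "{u. is_distribution u}" morphisms dist_apply Abs_distribution
  using is_distribution_zero by auto

setup_lifting type_definition_distribution

instantiation distribution :: real_vector
begin

lift_definition zero_distribution :: distribution is "\<lambda>_. 0"
  by (rule is_distribution_zero)

lift_definition plus_distribution :: "distribution \<Rightarrow> distribution \<Rightarrow> distribution"
  is "\<lambda>u v \<phi>. u \<phi> + v \<phi>"
  by (rule is_distribution_add)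

lift_definition scaleR_distribution :: "real \<Rightarrow> distribution \<Rightarrow> distribution"
  is "\<lambda>c u \<phi>. c * u \<phi>"
  by (rule is_distribution_scaleR)

definition uminus_distribution :: "distribution \<Rightarrow> distribution" where
  "uminus_distribution u = (-1) *\<^sub>R u"

definition minus_distribution :: "distribution \<Rightarrow> distribution \<Rightarrow> distribution" where
  "minus_distribution u v = u + (-1) *\<^sub>R v"

instance
  by standard
    (simp_all add: uminus_distribution_def minus_distribution_def,
      (transfer, auto simp: algebra_simps)+)

end

lift_definition D1 :: "distribution \<Rightarrow> distribution" is "\<lambda>u \<phi>. - u (test_pd1 \<phi>)"
  by (rule is_distribution_pd[where b = "(1, 0)"])
    (auto simp: linear_test_pd1 test_pd1.rep_eq Basis_prod_def)

lift_definition D2 :: "distribution \<Rightarrow> distribution" is "\<lambda>u \<phi>. - u (test_pd2 \<phi>)"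
  by (rule is_distribution_pd[where b = "(0, 1)"])
    (auto simp: linear_test_pd2 test_pd2.rep_eq Basis_prod_def)

definition DD :: "distribution \<Rightarrow> distribution" where
  "DD u = D1 (D2 u)"

lift_definition distr_of :: "(plane \<Rightarrow>\<^sub>C real) \<Rightarrow> distribution"
  is "\<lambda>\<phi> \<psi>. \<integral>x. apply_bcontfun \<phi> x * test_apply \<psi> x \<partial>lborel"
proof -
  fix \<phi> :: "plane \<Rightarrow>\<^sub>C real"
  let ?u = "\<lambda>\<psi>. \<integral>x. apply_bcontfun \<phi> x * test_apply \<psi> x \<partial>lborel"
  have eq: "indicator S x *\<^sub>R (apply_bcontfun \<phi> x * test_apply \<psi> x)
      = apply_bcontfun \<phi> x * test_apply \<psi> x"
    if "support (test_apply \<psi>) \<subseteq> S" for \<psi> S x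
    using that eq_0_outside_support[of x "test_apply \<psi>"] by (auto simp: indicator_def)
  have int: "integrable lborel (\<lambda>x. apply_bcontfun \<phi> x * test_apply \<psi> x)" for \<psi>
  proof -
    have "integrable lborel (\<lambda>x. indicator (support (test_apply \<psi>)) x *\<^sub>R
        (apply_bcontfun \<phi> x * test_apply \<psi> x))"
      using test_apply[of \<psi>]
      by (intro borel_integrable_compact continuous_on_mult continuous_test) auto
    then show ?thesis by (simp only: eq[OF order_refl])
  qed
  show "is_distribution ?u"
    unfolding is_distribution_def
  proof (intro conjI allI impI)
    show "linear ?u"
      using int
      by (auto simp: linear_iff plus_test_fun.rep_eq scaleR_test_fun.rep_eq distrib_left
          mult.left_commute)
    fix S :: "plane set" assume S: "compact S"
    show "\<exists>C N. \<forall>\<psi>. support (test_apply \<psi>) \<subseteq> S \<longrightarrow> \<bar>?u \<psi>\<bar> \<le> C * test_seminorm N \<psi>"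
    proof (intro exI allI impI)
      fix \<psi> assume s: "support (test_apply \<psi>) \<subseteq> S"
      have sn: "\<bar>test_apply \<psi> x\<bar> \<le> test_seminorm 0 \<psi>" for x
      proof -
        have "{w. w \<in> lists (Basis :: plane set) \<and> length w \<le> 0} = {[]}" by auto
        then show ?thesis
          using cSUP_upper[OF UNIV_I bdd_pds[of "[]" \<psi>], of x] by (simp add: test_seminorm_def)
      qed
      have bd: "\<bar>apply_bcontfun \<phi> x * test_apply \<psi> x\<bar>
          \<le> indicator S x * (norm \<phi> * test_seminorm 0 \<psi>)" for x
      proof (cases "x \<in> S")
        case True
        then show ?thesis
          using norm_bounded[of \<phi> x] sn[of x] by (auto simp: abs_mult intro!: mult_mono)
      next
        case False
        then show ?thesis using s eq_0_outside_support[of x "test_apply \<psi>"] by auto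
      qed
      have "\<bar>?u \<psi>\<bar> \<le> (\<integral>x. \<bar>apply_bcontfun \<phi> x * test_apply \<psi> x\<bar> \<partial>lborel)"
        using integral_norm_bound[of lborel "\<lambda>x. apply_bcontfun \<phi> x * test_apply \<psi> x"] by simp
      also have "\<dots> \<le> (\<integral>x. indicator S x * (norm \<phi> * test_seminorm 0 \<psi>) \<partial>lborel)"
        using int[of \<psi>] S bd
        by (intro integral_mono integrable_abs integrable_mult_left)
          (auto intro!: integrable_real_indicator emeasure_compact_finite simp: borel_compact)
      also have "\<dots> = (measure lborel S * norm \<phi>) * test_seminorm 0 \<psi>"
        by simp
      finally show "\<bar>?u \<psi>\<bar> \<le> (measure lborel S * norm \<phi>) * test_seminorm 0 \<psi>" .
    qed
  qed
qed

text \<open>Set functions are normalised to vanish outside the Borel sets, so that equality of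
  signed measures is equality of functions.\<close>

definition signed_measure :: "(plane set \<Rightarrow> real) \<Rightarrow> bool" where
  "signed_measure \<mu> \<longleftrightarrow>
    (\<forall>A. A \<notin> sets borel \<longrightarrow> \<mu> A = 0) \<and> \<mu> {} = 0 \<and>
    (\<forall>A :: nat \<Rightarrow> plane set. range A \<subseteq> sets borel \<longrightarrow> disjoint_family A \<longrightarrow>
      (\<lambda>i. \<mu> (A i)) sums \<mu> (\<Union>i. A i))"

definition total_variation :: "(plane set \<Rightarrow> real) \<Rightarrow> ennreal" where
  "total_variation \<mu> =
    (SUP P\<in>{P. finite P \<and> P \<subseteq> sets borel \<and> disjoint P}. \<Sum>B\<in>P. ennreal \<bar>\<mu> B\<bar>)"

text \<open>Jordan decomposition: the positive part is \<open>A \<mapsto> sup {\<mu> B | B \<subseteq> A Borel}\<close>;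
  negative values of \<open>\<mu>\<close> are truncated by \<^const>\<open>ennreal\<close>, which does not change the
  supremum because \<open>\<mu> {} = 0\<close>.\<close>

definition positive_part :: "(plane set \<Rightarrow> real) \<Rightarrow> plane measure" where
  "positive_part \<mu> =
    measure_of UNIV (sets borel) (\<lambda>A. SUP B\<in>{B\<in>sets borel. B \<subseteq> A}. ennreal (\<mu> B))"

definition signed_integral :: "(plane set \<Rightarrow> real) \<Rightarrow> (plane \<Rightarrow> real) \<Rightarrow> real" where
  "signed_integral \<mu> g =
    (\<integral>x. g x \<partial>positive_part \<mu>) - (\<integral>x. g x \<partial>positive_part (\<lambda>A. - \<mu> A))"

text \<open>The identification of a finite signed measure with a distribution.\<close>

definition represents :: "(plane set \<Rightarrow> real) \<Rightarrow> distribution \<Rightarrow> bool" where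
  "represents \<mu> u \<longleftrightarrow>
    signed_measure \<mu> \<and> (\<forall>\<phi>. dist_apply u \<phi> = signed_integral \<mu> (test_apply \<phi>))"

definition measure_of_distr :: "distribution \<Rightarrow> plane set \<Rightarrow> real" where
  "measure_of_distr u = (THE \<mu>. represents \<mu> u)"

definition M_norm :: "distribution \<Rightarrow> real" where
  "M_norm u = enn2real (total_variation (measure_of_distr u))"

text \<open>The distribution is a finite signed measure, in exactly one way, and the total
  variation occurring in \<^const>\<open>M_norm\<close> is finite.\<close>

definition M_norm_well_defined :: "distribution \<Rightarrow> bool" where
  "M_norm_well_defined u \<longleftrightarrow>
    (\<exists>!\<mu>. represents \<mu> u) \<and> total_variation (measure_of_distr u) < \<infinity>"

definition unit_square :: "plane set" where
  "unit_square = {0..1} \<times> {0..1}"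

definition measures_on :: "plane set \<Rightarrow> distribution set" where
  "measures_on S =
    {u. \<exists>\<mu>. represents \<mu> u \<and> (\<forall>A\<in>sets borel. A \<inter> S = {} \<longrightarrow> \<mu> A = 0)}"

definition M_DD0 :: "distribution set" where
  "M_DD0 = {f. DD f \<in> measures_on unit_square \<and>
    (\<forall>\<phi>. support (test_apply \<phi>) \<subseteq> - unit_square \<longrightarrow> dist_apply f \<phi> = 0)}"

definition grad_norm :: "distribution \<Rightarrow> real" where
  "grad_norm f = M_norm (D2 f) + M_norm (D1 f)"

definition norm_theta :: "real \<Rightarrow> distribution \<Rightarrow> real" where
  "norm_theta \<theta> f = \<theta> * M_norm (DD f) + (1 - \<theta>) * grad_norm f"

text \<open>The spaces involved are subspaces of the distributions with several competing norms,
  quotients of them and duals of quotients, so operations and norm are explicit.\<close>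

record 'a nspace =
  carr :: "'a set"
  nzero :: 'a
  nadd :: "'a \<Rightarrow> 'a \<Rightarrow> 'a"
  nscale :: "real \<Rightarrow> 'a \<Rightarrow> 'a"
  nnorm :: "'a \<Rightarrow> real"

definition normed_space :: "'a nspace \<Rightarrow> bool" where
  "normed_space S \<longleftrightarrow>
    nzero S \<in> carr S \<and>
    (\<forall>x\<in>carr S. \<forall>y\<in>carr S. nadd S x y \<in> carr S \<and> nadd S x y = nadd S y x) \<and>
    (\<forall>x\<in>carr S. \<forall>y\<in>carr S. \<forall>z\<in>carr S. nadd S (nadd S x y) z = nadd S x (nadd S y z)) \<and>
    (\<forall>x\<in>carr S. nadd S (nzero S) x = x \<and> nadd S x (nscale S (-1) x) = nzero S \<and>
      nscale S 1 x = x) \<and>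
    (\<forall>a. \<forall>x\<in>carr S. nscale S a x \<in> carr S) \<and>
    (\<forall>a b. \<forall>x\<in>carr S. nscale S a (nscale S b x) = nscale S (a * b) x \<and>
      nscale S (a + b) x = nadd S (nscale S a x) (nscale S b x)) \<and>
    (\<forall>a. \<forall>x\<in>carr S. \<forall>y\<in>carr S.
      nscale S a (nadd S x y) = nadd S (nscale S a x) (nscale S a y)) \<and>
    (\<forall>x\<in>carr S. 0 \<le> nnorm S x \<and> (nnorm S x = 0 \<longleftrightarrow> x = nzero S)) \<and>
    (\<forall>a. \<forall>x\<in>carr S. nnorm S (nscale S a x) = \<bar>a\<bar> * nnorm S x) \<and>
    (\<forall>x\<in>carr S. \<forall>y\<in>carr S. nnorm S (nadd S x y) \<le> nnorm S x + nnorm S y)"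

definition ndist :: "'a nspace \<Rightarrow> 'a \<Rightarrow> 'a \<Rightarrow> real" where
  "ndist S x y = nnorm S (nadd S x (nscale S (-1) y))"

definition banach_space :: "'a nspace \<Rightarrow> bool" where
  "banach_space S \<longleftrightarrow> normed_space S \<and>
    (\<forall>s :: nat \<Rightarrow> 'a. range s \<subseteq> carr S \<longrightarrow>
      (\<forall>e>0. \<exists>n0. \<forall>m\<ge>n0. \<forall>n\<ge>n0. ndist S (s m) (s n) < e) \<longrightarrow>
      (\<exists>l\<in>carr S. (\<lambda>n. ndist S (s n) l) \<longlonglongrightarrow> 0))"

definition subspace_with_norm :: "'a::real_vector set \<Rightarrow> ('a \<Rightarrow> real) \<Rightarrow> 'a nspace" where
  "subspace_with_norm V N =
    \<lparr>carr = V, nzero = 0, nadd = (+), nscale = (*\<^sub>R), nnorm = N\<rparr>"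

definition coset :: "'a nspace \<Rightarrow> 'a set \<Rightarrow> 'a \<Rightarrow> 'a set" where
  "coset S M v = nadd S v ` M"

definition quotient_nspace :: "'a nspace \<Rightarrow> 'a set \<Rightarrow> 'a set nspace" where
  "quotient_nspace S M =
    \<lparr>carr = coset S M ` carr S,
     nzero = M,
     nadd = (\<lambda>A B. {nadd S a b | a b. a \<in> A \<and> b \<in> B}),
     nscale = (\<lambda>c A. {nadd S (nscale S c a) m | a m. a \<in> A \<and> m \<in> M}),
     nnorm = (\<lambda>A. INF a\<in>A. nnorm S a)\<rparr>"

text \<open>Functionals are extensional, i.e. normalised to \<^const>\<open>undefined\<close> off the carrier,
  so that each functional is counted once.\<close>

definition dual_nspace :: "'a nspace \<Rightarrow> ('a \<Rightarrow> real) nspace" where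
  "dual_nspace S =
    \<lparr>carr = {l \<in> extensional (carr S).
        (\<forall>x\<in>carr S. \<forall>y\<in>carr S. l (nadd S x y) = l x + l y) \<and>
        (\<forall>c. \<forall>x\<in>carr S. l (nscale S c x) = c * l x) \<and>
        (\<exists>C. \<forall>x\<in>carr S. \<bar>l x\<bar> \<le> C * nnorm S x)},
     nzero = restrict (\<lambda>x. 0) (carr S),
     nadd = (\<lambda>l k. restrict (\<lambda>x. l x + k x) (carr S)),
     nscale = (\<lambda>c l. restrict (\<lambda>x. c * l x) (carr S)),
     nnorm = (\<lambda>l. SUP x\<in>{x\<in>carr S. nnorm S x \<le> 1}. \<bar>l x\<bar>)\<rparr>"

definition isometric_isomorphism :: "('a \<Rightarrow> 'b) \<Rightarrow> 'a nspace \<Rightarrow> 'b nspace \<Rightarrow> bool" where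
  "isometric_isomorphism J S T \<longleftrightarrow>
    bij_betw J (carr S) (carr T) \<and>
    (\<forall>x\<in>carr S. \<forall>y\<in>carr S. J (nadd S x y) = nadd T (J x) (J y)) \<and>
    (\<forall>c. \<forall>x\<in>carr S. J (nscale S c x) = nscale T c (J x)) \<and>
    (\<forall>x\<in>carr S. nnorm T (J x) = nnorm S x)"

definition C0 :: "(plane \<Rightarrow>\<^sub>C real) set" where
  "C0 = {\<phi>. (apply_bcontfun \<phi> \<longlongrightarrow> 0) at_infinity}"

definition DD_C0 :: "distribution set" where
  "DD_C0 = (\<lambda>\<phi>. DD (distr_of \<phi>)) ` C0"

definition C0_primitive :: "distribution \<Rightarrow> (plane \<Rightarrow>\<^sub>C real)" where
  "C0_primitive = the_inv_into C0 (\<lambda>\<phi>. DD (distr_of \<phi>))"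

text \<open>\<^term>\<open>norm (\<phi> :: plane \<Rightarrow>\<^sub>C real)\<close> is the supremum norm.\<close>

definition DD_C0_norm :: "distribution \<Rightarrow> real" where
  "DD_C0_norm v = norm (C0_primitive v)"

definition pairing :: "distribution \<Rightarrow> distribution \<Rightarrow> real" where
  "pairing f v = signed_integral (measure_of_distr (DD f)) (apply_bcontfun (C0_primitive v))"

definition M0 :: "distribution set" where
  "M0 = {v \<in> DD_C0. \<forall>f\<in>M_DD0. pairing f v = 0}"

definition predual :: "distribution set nspace" where
  "predual = quotient_nspace (subspace_with_norm DD_C0 DD_C0_norm) M0"

end

theory Submission
  imports Defs
begin

text \<open>A distribution that vanishes outside the square and is annihilated by a coordinate derivative
  is zero: translating a test function far along that direction changes it by a derivative and moves
  it off the square. Hence an element \<open>f\<close> of \<^const>\<open>M_DD0\<close> is determined by the measure \<open>DD f\<close>. The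
  measures arising in this way are those carried by the square whose two marginals vanish: spreading
  the mass of such a measure \<open>\<mu>\<close> along segments towards the far side of the square yields a measure
  \<open>\<nu>\<close> with \<open>\<partial>\<^sub>e \<nu> = \<mu>\<close> and no larger total variation, which applied twice recovers \<open>f\<close> and bounds
  both components of its gradient by \<open>DD f\<close>. So all the norms are equivalent to the total variation
  of \<open>DD f\<close>, and vanishing marginals survive limits in total variation.

  A bounded functional on the quotient by \<^const>\<open>M0\<close> is a functional on continuous functions that
  only depends on their values on the square, i.e. a measure by Riesz' theorem. It kills functions
  of a single variable, because these are annihilated by all of \<^const>\<open>M_DD0\<close>, so its marginals
  vanish.\<close>

section \<open>Signed measures\<close>

text \<open>An antiderivative of a compactly supported test function has unbounded support in
  general, so test functions are only integrated over finite segments, which inverts a derivative up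
  to a translation. The translation is harmless for two different reasons: on \<open>M_DD0\<close>
  because the distribution vanishes outside the square, on \<open>C0\<close> because of decay at
  infinity. The second case gives the injectivity of \<open>DD\<close> on \<open>C0\<close>, on
  which the meaning of \<open>C0_primitive\<close> rests. Vanishing marginals are exactly what
  removes the boundary term of a sweep. They are stated for bounded Borel functions, since sweeping
  turns test functions into functions known only to be of that kind, and the second sweep must start
  from a measure whose other marginal still vanishes. On the dual side, nonzero functions of one
  variable do not belong to \<open>C0\<close>. A cutoff equal to 1 on the square brings them there;
  it leaves the class modulo \<open>M0\<close> of an element of \<open>C0\<close> unchanged, since
  that class depends only on the values on the square, and it does not increase the sup norm, so
  that the duality is isometric and not merely bounded.\<close>

lemma signed_measure_outside: "signed_measure \<mu> \<Longrightarrow> A \<notin> sets borel \<Longrightarrow> \<mu> A = 0"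
  and signed_measure_empty: "signed_measure \<mu> \<Longrightarrow> \<mu> {} = 0"
  unfolding signed_measure_def by blast+

lemma signed_measure_sums:
  "signed_measure \<mu> \<Longrightarrow> range A \<subseteq> sets borel \<Longrightarrow> disjoint_family A \<Longrightarrow> (\<lambda>i::nat. \<mu> (A i)) sums \<mu> (\<Union>i. A i)"
  unfolding signed_measure_def by blast

lemma signed_measure_Un:
  assumes "signed_measure \<mu>" "A \<in> sets borel" "B \<in> sets borel" "A \<inter> B = {}"
  shows "\<mu> (A \<union> B) = \<mu> A + \<mu> B"
proof -
  have "(\<lambda>i. \<mu> (binaryset A B i)) sums \<mu> (\<Union>i. binaryset A B i)"
    using assms by (intro signed_measure_sums) (auto simp: range_binaryset_eq disjoint_family_on_def binaryset_def)
  moreover have "(\<lambda>i. \<mu> (binaryset A B i)) sums (\<mu> A + \<mu> B)"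
    using assms by (intro binaryset_sums signed_measure_empty)
  ultimately show ?thesis
    by (metis UN_binaryset_eq sums_unique2)
qed

lemma signed_measure_Diff:
  assumes "signed_measure \<mu>" "A \<in> sets borel" "B \<in> sets borel" "B \<subseteq> A"
  shows "\<mu> (A - B) = \<mu> A - \<mu> B"
proof -
  have "\<mu> ((A - B) \<union> B) = \<mu> (A - B) + \<mu> B"
    using assms by (intro signed_measure_Un) auto
  moreover have "(A - B) \<union> B = A" using assms by blast
  ultimately show ?thesis by simp
qed

lemma signed_measure_lincomb:
  assumes "signed_measure \<mu>" "signed_measure \<nu>"
  shows "signed_measure (\<lambda>A. a * \<mu> A + b * \<nu> A)"
  using assms unfolding signed_measure_def by (auto intro!: sums_add sums_mult)

lemma signed_measure_zero: "signed_measure (\<lambda>_. 0)"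
  unfolding signed_measure_def by auto

lemma signed_measure_uminus: "signed_measure \<mu> \<Longrightarrow> signed_measure (\<lambda>A. - \<mu> A)"
  using signed_measure_lincomb[of \<mu> \<mu> "-1" 0] by simp

section \<open>Upper variation and the Jordan parts of a signed measure\<close>

context
  fixes \<mu> :: "plane set \<Rightarrow> real"
  assumes sm: "signed_measure \<mu>"
begin

text \<open>The set function inside \<open>positive_part\<close>, studied on its own before it is
  known to be a measure.\<close>

definition upper_variation :: "plane set \<Rightarrow> ennreal" where
  "upper_variation A = (SUP B\<in>{B\<in>sets borel. B \<subseteq> A}. ennreal (\<mu> B))"

lemma upper_variation_upper: "B \<in> sets borel \<Longrightarrow> B \<subseteq> A \<Longrightarrow> ennreal (\<mu> B) \<le> upper_variation A"
  unfolding upper_variation_def by (intro SUP_upper) auto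

lemma upper_variation_mono: "A \<subseteq> B \<Longrightarrow> upper_variation A \<le> upper_variation B"
  unfolding upper_variation_def by (intro SUP_subset_mono) auto

text \<open>Competitors for the two disjoint parts join to a competitor for the union. The case
  split is due to the truncation by \<open>ennreal\<close>: a competitor of negative mass counts as
  0 and has to be dropped, since joining it would lower the mass.\<close>

lemma upper_variation_superadditive:
  assumes "A \<inter> B = {}"
  shows "upper_variation A + upper_variation B \<le> upper_variation (A \<union> B)"
proof -
  have 1: "ennreal (\<mu> C) + ennreal (\<mu> D) \<le> upper_variation (A \<union> B)"
    if "C \<in> sets borel" "C \<subseteq> A" "D \<in> sets borel" "D \<subseteq> B" for C D
  proof -
    consider "\<mu> C \<le> 0" | "\<mu> D \<le> 0" | "\<mu> C \<ge> 0" "\<mu> D \<ge> 0" by linarith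
    then show ?thesis
    proof cases
      case 1
      then show ?thesis using that upper_variation_upper[of D "A \<union> B"] by (auto simp: ennreal_neg)
    next
      case 2
      then show ?thesis using that upper_variation_upper[of C "A \<union> B"] by (auto simp: ennreal_neg)
    next
      case 3
      then have "ennreal (\<mu> C) + ennreal (\<mu> D) = ennreal (\<mu> (C \<union> D))"
        using that assms by (subst signed_measure_Un[OF sm]) auto
      then show ?thesis using that upper_variation_upper[of "C \<union> D" "A \<union> B"] by auto
    qed
  qed
  have le: "upper_variation A + c \<le> d"
    if "\<And>C. C \<in> sets borel \<Longrightarrow> C \<subseteq> A \<Longrightarrow> ennreal (\<mu> C) + c \<le> d" for A c d
  proof -
    have "{B \<in> sets borel. B \<subseteq> A} \<noteq> {}" by blast
    then show ?thesis
      unfolding upper_variation_def using that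
      by (subst ennreal_SUP_add_left[symmetric]) (auto intro: SUP_least)
  qed
  show ?thesis
    by (intro le, subst add.commute, intro le, subst add.commute) (rule 1)
qed

lemma upper_variation_empty: "upper_variation {} = 0"
proof -
  have "upper_variation {} \<le> 0"
    unfolding upper_variation_def by (intro SUP_least) (auto simp: signed_measure_empty[OF sm])
  then show ?thesis by simp
qed

text \<open>One inequality iterates superadditivity. For the other, a competitor for the union is
  cut into its pieces inside the \<open>A i\<close>, and countable additivity of
  \<open>\<mu>\<close> recovers its mass.\<close>

lemma upper_variation_countably_additive: "countably_additive (sets borel) upper_variation"
proof (rule countably_additiveI)
  fix A :: "nat \<Rightarrow> plane set"
  assume A: "range A \<subseteq> sets borel" "disjoint_family A"
  show "(\<Sum>i. upper_variation (A i)) = upper_variation (\<Union>i. A i)"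
  proof (rule antisym)
    have "(\<Sum>i<n. upper_variation (A i)) \<le> upper_variation (\<Union>i<n. A i)" for n
    proof (induction n)
      case (Suc n)
      have "(\<Sum>i<Suc n. upper_variation (A i)) \<le> upper_variation (\<Union>i<n. A i) + upper_variation (A n)"
        unfolding sum.lessThan_Suc by (rule add_right_mono) (rule Suc)
      also have "\<dots> \<le> upper_variation ((\<Union>i<n. A i) \<union> A n)"
      proof (rule upper_variation_superadditive)
        have "A i \<inter> A n = {}" if "i < n" for i
          using disjoint_family_onD[OF A(2), of i n] that by simp
        then show "(\<Union>i<n. A i) \<inter> A n = {}" by blast
      qed
      also have "(\<Union>i<n. A i) \<union> A n = (\<Union>i<Suc n. A i)" by (auto simp: less_Suc_eq)
      finally show ?case .
    qed (simp add: upper_variation_empty)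
    then have "(\<Sum>i<n. upper_variation (A i)) \<le> upper_variation (\<Union>i. A i)" for n
      by (rule order_trans[OF _ upper_variation_mono]) blast
    then show "(\<Sum>i. upper_variation (A i)) \<le> upper_variation (\<Union>i. A i)"
      by (intro suminf_le_const) auto
    show "upper_variation (\<Union>i. A i) \<le> (\<Sum>i. upper_variation (A i))"
      unfolding upper_variation_def[of "\<Union>i. A i"]
    proof (intro SUP_least)
      fix B assume "B \<in> {B \<in> sets borel. B \<subseteq> (\<Union>i. A i)}"
      then have B: "B \<in> sets borel" "B \<subseteq> (\<Union>i. A i)" by auto
      have "(\<lambda>i. \<mu> (B \<inter> A i)) sums \<mu> (\<Union>i. B \<inter> A i)"
        using A B by (intro signed_measure_sums[OF sm]) (auto simp: disjoint_family_on_def)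
      moreover have "(\<Union>i. B \<inter> A i) = B" using B by blast
      ultimately have "(\<lambda>n. ennreal (\<Sum>i<n. \<mu> (B \<inter> A i))) \<longlonglongrightarrow> ennreal (\<mu> B)"
        unfolding sums_def by (intro tendsto_ennrealI) simp
      moreover have "ennreal (\<Sum>i<n. \<mu> (B \<inter> A i)) \<le> (\<Sum>i. upper_variation (A i))" for n
      proof -
        \<comment> \<open>Raising negative terms to 0 makes \<open>ennreal\<close> commute with the
          finite sum.\<close>
        have "ennreal (\<Sum>i<n. \<mu> (B \<inter> A i)) \<le> ennreal (\<Sum>i<n. max 0 (\<mu> (B \<inter> A i)))"
          by (intro ennreal_leI sum_mono) auto
        also have "\<dots> = (\<Sum>i<n. ennreal (max 0 (\<mu> (B \<inter> A i))))"
          by (subst sum_ennreal) auto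
        also have "\<dots> \<le> (\<Sum>i<n. upper_variation (A i))"
        proof (rule sum_mono)
          fix i
          have "B \<inter> A i \<in> sets borel" using A B by auto
          then show "ennreal (max 0 (\<mu> (B \<inter> A i))) \<le> upper_variation (A i)"
            using upper_variation_upper[of "B \<inter> A i" "A i"] by (auto simp: max_def)
        qed
        also have "\<dots> \<le> (\<Sum>i. upper_variation (A i))"
          by (intro sum_le_suminf) auto
        finally show ?thesis .
      qed
      ultimately show "ennreal (\<mu> B) \<le> (\<Sum>i. upper_variation (A i))"
        by (intro LIMSEQ_le_const2) auto
    qed
  qed
qed

lemma sets_positive_part [simp]: "sets (positive_part \<mu>) = sets borel"
  unfolding positive_part_def by (simp add: sets.sets_measure_of_eq[of borel, simplified])

lemma space_positive_part [simp]: "space (positive_part \<mu>) = UNIV"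
  using sets_eq_imp_space_eq[OF sets_positive_part] by simp

lemma emeasure_positive_part:
  assumes "A \<in> sets borel"
  shows "emeasure (positive_part \<mu>) A = upper_variation A"
proof -
  have eq: "positive_part \<mu> = measure_of UNIV (sets borel) upper_variation"
    unfolding positive_part_def upper_variation_def ..
  show ?thesis
    unfolding eq
  proof (rule emeasure_measure_of_sigma)
    show "sigma_algebra UNIV (sets (borel :: plane measure))"
      using sets.sigma_algebra_axioms[of "borel :: plane measure"] by simp
    show "positive (sets borel) upper_variation"
      by (simp add: positive_def upper_variation_empty)
  qed (use assms upper_variation_countably_additive in auto)
qed

text \<open>If \<open>A\<close> has infinite upper variation, one of the two halves of a suitable splitting of \<open>A\<close>
  has, too, while \<open>\<mu>\<close> is large on both halves; iterating contradicts continuity of \<open>\<mu>\<close> from above.\<close>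

lemma upper_variation_finite: "upper_variation UNIV < \<infinity>"
proof (rule ccontr)
  assume "\<not> upper_variation UNIV < \<infinity>"
  then have inf: "upper_variation UNIV = \<infinity>" by (metis infinity_ennreal_def less_top)
  define P where "P n B \<longleftrightarrow> B \<in> sets borel \<and> upper_variation B = \<infinity> \<and> \<bar>\<mu> B\<bar> \<ge> real n" for n B
  have "\<exists>B. \<forall>n. P n (B n) \<and> B (Suc n) \<subseteq> B n"
  proof (rule dependent_nat_choice)
    show "\<exists>B. P 0 B" using inf by (auto simp: P_def intro!: exI[of _ UNIV])
    fix A n assume "P n A"
    then have A: "A \<in> sets borel" "upper_variation A = \<infinity>" by (auto simp: P_def)
    \<comment> \<open>With \<open>\<mu> E\<close> above this threshold,
      \<open>\<mu> A - \<mu> E\<close> lies below \<open>- real (Suc n)\<close>, so both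
      \<open>E\<close> and \<open>A - E\<close> satisfy the size condition of
      \<open>P (Suc n)\<close> and either may be kept.\<close>
    let ?c = "real (Suc n) + \<bar>\<mu> A\<bar>"
    have "ennreal ?c < upper_variation A" using A by (simp del: of_nat_Suc)
    then obtain E where E: "E \<in> sets borel" "E \<subseteq> A" "ennreal ?c < ennreal (\<mu> E)"
      unfolding upper_variation_def less_SUP_iff by auto
    then have c: "?c < \<mu> E" by (subst (asm) ennreal_less_iff) auto
    have d: "\<mu> (A - E) = \<mu> A - \<mu> E" using E A by (intro signed_measure_Diff[OF sm]) auto
    have "upper_variation A = upper_variation E + upper_variation (A - E)"
    proof -
      have "emeasure (positive_part \<mu>) (E \<union> (A - E)) =
          emeasure (positive_part \<mu>) E + emeasure (positive_part \<mu>) (A - E)"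
        using E A by (intro plus_emeasure[symmetric]) auto
      moreover have "E \<union> (A - E) = A" using E by blast
      ultimately show ?thesis using E A by (simp add: emeasure_positive_part)
    qed
    then consider "upper_variation E = \<infinity>" | "upper_variation (A - E) = \<infinity>"
      using A(2) by (metis ennreal_add_eq_top infinity_ennreal_def)
    then show "\<exists>B. P (Suc n) B \<and> B \<subseteq> A"
      by cases (use E A c d in \<open>auto simp: P_def intro: exI[of _ E] exI[of _ "A - E"]\<close>)
  qed
  then obtain B where B: "\<And>n. P n (B n)" "\<And>n. B (Suc n) \<subseteq> B n" by blast
  have bor: "B n \<in> sets borel" for n using B(1) by (auto simp: P_def)
  have mono: "B j \<subseteq> B i" if "i \<le> j" for i j
    using lift_Suc_antimono_le[of B, OF B(2) that] .
  have dis: "disjoint_family (\<lambda>i. B i - B (Suc i))"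
    unfolding disjoint_family_on_def
  proof (intro ballI impI)
    fix i j :: nat assume "i \<noteq> j"
    then show "(B i - B (Suc i)) \<inter> (B j - B (Suc j)) = {}"
      using mono[of "Suc i" j] mono[of "Suc j" i] by (cases "i < j") (auto simp: not_less)
  qed
  have "(\<lambda>i. \<mu> (B i - B (Suc i))) sums \<mu> (\<Union>i. B i - B (Suc i))"
    using dis bor by (intro signed_measure_sums[OF sm]) auto
  moreover have "\<mu> (B i - B (Suc i)) = \<mu> (B i) - \<mu> (B (Suc i))" for i
    using bor B(2) by (intro signed_measure_Diff[OF sm])
  ultimately have "(\<lambda>n. \<Sum>i<n. \<mu> (B i) - \<mu> (B (Suc i))) \<longlonglongrightarrow> \<mu> (\<Union>i. B i - B (Suc i))"
    by (simp add: sums_def)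
  then have "(\<lambda>n. \<mu> (B 0) - (\<Sum>i<n. \<mu> (B i) - \<mu> (B (Suc i)))) \<longlonglongrightarrow> \<mu> (B 0) - \<mu> (\<Union>i. B i - B (Suc i))"
    by (intro tendsto_diff tendsto_const)
  then have "(\<lambda>n. \<mu> (B n)) \<longlonglongrightarrow> \<mu> (B 0) - \<mu> (\<Union>i. B i - B (Suc i))"
    unfolding sum_lessThan_telescope'[of "\<lambda>i. \<mu> (B i)"] diff_diff_eq2 add_diff_cancel_left' .
  then have "Bseq (\<lambda>n. \<mu> (B n))" by (intro convergent_imp_Bseq) (auto simp: convergent_def)
  then obtain c where c: "\<And>n. \<bar>\<mu> (B n)\<bar> \<le> c" by (auto simp: Bseq_def)
  obtain n where "c < real n" using reals_Archimedean2 by blast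
  with c[of n] B(1)[of n] show False by (auto simp: P_def)
qed

lemma finite_measure_positive_part: "finite_measure (positive_part \<mu>)"
  using upper_variation_finite by (intro finite_measureI) (simp add: emeasure_positive_part)

lemma measure_positive_part_approx:
  assumes "A \<in> sets borel" "\<epsilon> > 0"
  shows "\<exists>B\<in>sets borel. B \<subseteq> A \<and> measure (positive_part \<mu>) A - \<epsilon> < \<mu> B"
\<comment> \<open>If the difference is negative, \<open>ennreal\<close> truncates it and strict
  inequalities are lost; the empty set then serves as \<open>B\<close>.\<close>
proof (cases "measure (positive_part \<mu>) A < \<epsilon>")
  case True
  then show ?thesis by (intro bexI[of _ "{}"]) (auto simp: signed_measure_empty[OF sm])
next
  case False
  interpret finite_measure "positive_part \<mu>" by (rule finite_measure_positive_part)
  have "ennreal (measure (positive_part \<mu>) A - \<epsilon>) < ennreal (measure (positive_part \<mu>) A)"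
    using assms False by (intro ennreal_lessI) auto
  also have "\<dots> = upper_variation A"
    using assms(1) by (simp add: emeasure_positive_part[symmetric] emeasure_eq_measure)
  finally obtain B where "B \<in> sets borel" "B \<subseteq> A" "ennreal (measure (positive_part \<mu>) A - \<epsilon>) < ennreal (\<mu> B)"
    unfolding upper_variation_def less_SUP_iff by auto
  then show ?thesis using False by (auto simp: ennreal_less_iff)
qed

lemma le_measure_positive_part:
  assumes "A \<in> sets borel" "B \<in> sets borel" "B \<subseteq> A"
  shows "\<mu> B \<le> measure (positive_part \<mu>) A"
proof -
  interpret finite_measure "positive_part \<mu>" by (rule finite_measure_positive_part)
  have "ennreal (\<mu> B) \<le> ennreal (measure (positive_part \<mu>) A)"
    using upper_variation_upper[OF assms(2,3)] assms(1)
    by (simp add: emeasure_positive_part[symmetric] emeasure_eq_measure)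
  then show ?thesis by (simp add: ennreal_le_iff)
qed

end

abbreviation (input) negative_part :: "(plane set \<Rightarrow> real) \<Rightarrow> plane measure" where
  "negative_part \<mu> \<equiv> positive_part (\<lambda>A. - \<mu> A)"

text \<open>If \<open>B\<close> almost attains the positive part of \<open>A\<close>, then
  \<open>A - B\<close> competes for the negative part with value \<open>\<mu> B - \<mu> A\<close>.
  This gives one inequality, and the same argument for \<open>- \<mu>\<close> gives the
  other.\<close>

lemma jordan_decomposition:
  assumes sm: "signed_measure \<mu>" and A: "A \<in> sets borel"
  shows "\<mu> A = measure (positive_part \<mu>) A - measure (negative_part \<mu>) A"
proof -
  note sm' = signed_measure_uminus[OF sm]
  have le: "measure (positive_part \<mu>) A \<le> \<mu> A + measure (negative_part \<mu>) A"
    if sm: "signed_measure \<mu>" for \<mu>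
  proof (rule field_le_epsilon)
    fix \<epsilon> :: real assume "\<epsilon> > 0"
    from measure_positive_part_approx[OF sm A this] obtain B where
      B: "B \<in> sets borel" "B \<subseteq> A" "measure (positive_part \<mu>) A - \<epsilon> < \<mu> B" by blast
    have "- \<mu> (A - B) \<le> measure (negative_part \<mu>) A"
      using A B by (intro le_measure_positive_part[OF signed_measure_uminus[OF sm]]) auto
    moreover have "\<mu> (A - B) = \<mu> A - \<mu> B" using A B by (intro signed_measure_Diff[OF sm])
    ultimately show "measure (positive_part \<mu>) A \<le> \<mu> A + measure (negative_part \<mu>) A + \<epsilon>"
      using B by linarith
  qed
  from le[OF sm] have 1: "measure (positive_part \<mu>) A \<le> \<mu> A + measure (negative_part \<mu>) A" .
  from le[OF sm'] have 2: "measure (negative_part \<mu>) A \<le> - \<mu> A + measure (positive_part \<mu>) A" by (simp only: minus_minus)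
  from 1 2 show ?thesis by linarith
qed

section \<open>The total variation and its norm properties\<close>

lemma total_variation_le:
  assumes M: "finite_measure M" "sets M = sets borel" and N: "finite_measure N" "sets N = sets borel"
    and eq: "\<And>A. A \<in> sets borel \<Longrightarrow> \<mu> A = measure M A - measure N A"
  shows "total_variation \<mu> \<le> ennreal (measure M UNIV + measure N UNIV)"
  unfolding total_variation_def
proof (rule SUP_least)
  fix P :: "plane set set" assume "P \<in> {P. finite P \<and> P \<subseteq> sets borel \<and> disjoint P}"
  then have P: "finite P" "P \<subseteq> sets borel" "disjoint P" by auto
  have le: "(\<Sum>B\<in>P. measure M B) \<le> measure M UNIV" if M: "finite_measure M" "sets M = sets borel" for M
  proof -
    interpret finite_measure M by fact
    have "(\<Sum>B\<in>P. measure M B) = measure M (\<Union>B\<in>P. B)"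
      using P M(2) by (intro finite_measure_finite_Union[symmetric])
        (auto simp: disjoint_family_on_def pairwise_def disjnt_def)
    also have "\<dots> \<le> measure M UNIV"
      using M(2) sets_eq_imp_space_eq[OF M(2)] bounded_measure[of "\<Union>B\<in>P. B"] by simp
    finally show ?thesis .
  qed
  have "(\<Sum>B\<in>P. \<bar>\<mu> B\<bar>) \<le> (\<Sum>B\<in>P. measure M B + measure N B)"
  proof (rule sum_mono)
    fix B assume "B \<in> P"
    then have "\<mu> B = measure M B - measure N B" using P eq by blast
    then show "\<bar>\<mu> B\<bar> \<le> measure M B + measure N B"
      using measure_nonneg[of M B] measure_nonneg[of N B] by linarith
  qed
  also have "\<dots> \<le> measure M UNIV + measure N UNIV"
    using le[OF M] le[OF N] by (simp add: sum.distrib)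
  finally show "(\<Sum>B\<in>P. ennreal \<bar>\<mu> B\<bar>) \<le> ennreal (measure M UNIV + measure N UNIV)"
    by (simp only: sum_ennreal abs_ge_zero) (rule ennreal_leI)
qed

text \<open>A partition into two sets almost attains the supremum: for an almost positive set
  \<open>B\<close> the sum of \<open>\<bar>\<mu> B\<bar>\<close> and
  \<open>\<bar>\<mu> (UNIV - B)\<bar>\<close> is at least \<open>2 * \<mu> B - \<mu> UNIV\<close>.
  The defect of \<open>B\<close> enters twice, hence \<open>e / 2\<close>.\<close>

lemma total_variation_eq:
  assumes sm: "signed_measure \<mu>"
  shows "total_variation \<mu> = ennreal (measure (positive_part \<mu>) UNIV + measure (negative_part \<mu>) UNIV)"
    (is "_ = ennreal (?p + ?n)")
proof (rule antisym)
  show "total_variation \<mu> \<le> ennreal (?p + ?n)"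
    using sm signed_measure_uminus[OF sm]
    by (intro total_variation_le finite_measure_positive_part sets_positive_part jordan_decomposition)
  show "ennreal (?p + ?n) \<le> total_variation \<mu>"
  proof (rule ennreal_le_epsilon)
    fix e :: real assume "e > 0"
    then have "e / 2 > 0" by simp
    from measure_positive_part_approx[OF sm _ this, of UNIV]
    obtain B where B: "B \<in> sets borel" "?p - e / 2 < \<mu> B" by auto
    have "\<mu> (UNIV - B) = \<mu> UNIV - \<mu> B"
      using B by (intro signed_measure_Diff[OF sm]) auto
    moreover have "\<mu> UNIV = ?p - ?n"
      by (rule jordan_decomposition[OF sm]) simp
    ultimately have "?p + ?n \<le> \<bar>\<mu> B\<bar> + \<bar>\<mu> (UNIV - B)\<bar> + e"
      using B by linarith
    then have "ennreal (?p + ?n) \<le> ennreal (\<bar>\<mu> B\<bar> + \<bar>\<mu> (UNIV - B)\<bar> + e)"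
      by (rule ennreal_leI)
    also have "\<dots> = (\<Sum>B\<in>{B, UNIV - B}. ennreal \<bar>\<mu> B\<bar>) + ennreal e"
    proof -
      \<comment> \<open>Otherwise the sum over the two-element set would collapse to one
        term.\<close>
      have "B \<noteq> UNIV - B" by blast
      then show ?thesis using \<open>e > 0\<close> by simp
    qed
    also have "\<dots> \<le> total_variation \<mu> + ennreal e"
      unfolding total_variation_def using B
      by (intro add_right_mono SUP_upper) (auto simp: pairwise_def disjnt_def)
    finally show "ennreal (?p + ?n) \<le> total_variation \<mu> + ennreal e" .
  qed
qed

lemma total_variation_finite: "signed_measure \<mu> \<Longrightarrow> total_variation \<mu> < \<infinity>"
  by (simp add: total_variation_eq)

definition tv :: "(plane set \<Rightarrow> real) \<Rightarrow> real" where
  "tv \<mu> = enn2real (total_variation \<mu>)"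

lemma tv_nonneg [simp]: "0 \<le> tv \<mu>"
  unfolding tv_def by simp

lemma tv_eq:
  "signed_measure \<mu> \<Longrightarrow> tv \<mu> = measure (positive_part \<mu>) UNIV + measure (negative_part \<mu>) UNIV"
  unfolding tv_def by (simp only: total_variation_eq) (simp add: enn2real_ennreal del: ennreal_plus)

lemma ennreal_tv: "signed_measure \<mu> \<Longrightarrow> ennreal (tv \<mu>) = total_variation \<mu>"
  by (simp add: tv_eq total_variation_eq)

lemma sum_abs_le_tv:
  assumes "signed_measure \<mu>" "finite P" "P \<subseteq> sets borel" "disjoint P"
  shows "(\<Sum>B\<in>P. \<bar>\<mu> B\<bar>) \<le> tv \<mu>"
proof -
  have "ennreal (\<Sum>B\<in>P. \<bar>\<mu> B\<bar>) = (\<Sum>B\<in>P. ennreal \<bar>\<mu> B\<bar>)"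
    by simp
  also have "\<dots> \<le> ennreal (tv \<mu>)"
    unfolding ennreal_tv[OF assms(1)] total_variation_def using assms by (intro SUP_upper) auto
  finally show ?thesis by (simp add: ennreal_le_iff)
qed

lemma abs_le_tv:
  assumes "signed_measure \<mu>"
  shows "\<bar>\<mu> A\<bar> \<le> tv \<mu>"
proof (cases "A \<in> sets borel")
  case True
  then show ?thesis using sum_abs_le_tv[OF assms, of "{A}"] by simp
next
  case False
  then show ?thesis using signed_measure_outside[OF assms] by simp
qed

lemma tv_leI:
  assumes "\<And>P. finite P \<Longrightarrow> P \<subseteq> sets borel \<Longrightarrow> disjoint P \<Longrightarrow> (\<Sum>B\<in>P. \<bar>\<mu> B\<bar>) \<le> c"
  shows "tv \<mu> \<le> c"
proof -
  have c: "0 \<le> c" using assms[of "{}"] by simp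
  have "total_variation \<mu> \<le> ennreal c"
    unfolding total_variation_def
    by (intro SUP_least) (auto intro!: ennreal_leI assms)
  then show ?thesis unfolding tv_def using c by (simp add: enn2real_leI)
qed

lemma tv_le_measures:
  assumes "finite_measure M" "sets M = sets borel" "finite_measure N" "sets N = sets borel"
    and "\<And>A. A \<in> sets borel \<Longrightarrow> \<mu> A = measure M A - measure N A"
  shows "tv \<mu> \<le> measure M UNIV + measure N UNIV"
  unfolding tv_def using total_variation_le[OF assms] by (intro enn2real_leI) auto

lemma tv_add:
  assumes "signed_measure \<mu>" "signed_measure \<nu>"
  shows "tv (\<lambda>A. \<mu> A + \<nu> A) \<le> tv \<mu> + tv \<nu>"
proof (rule tv_leI)
  fix P :: "plane set set" assume P: "finite P" "P \<subseteq> sets borel" "disjoint P"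
  have "(\<Sum>B\<in>P. \<bar>\<mu> B + \<nu> B\<bar>) \<le> (\<Sum>B\<in>P. \<bar>\<mu> B\<bar>) + (\<Sum>B\<in>P. \<bar>\<nu> B\<bar>)"
    unfolding sum.distrib[symmetric] by (intro sum_mono abs_triangle_ineq)
  also have "\<dots> \<le> tv \<mu> + tv \<nu>"
    using assms P by (intro add_mono sum_abs_le_tv)
  finally show "(\<Sum>B\<in>P. \<bar>\<mu> B + \<nu> B\<bar>) \<le> tv \<mu> + tv \<nu>" .
qed

lemma tv_scale: "tv (\<lambda>A. c * \<mu> A) = \<bar>c\<bar> * tv \<mu>"
proof -
  have "total_variation (\<lambda>A. c * \<mu> A) = ennreal \<bar>c\<bar> * total_variation \<mu>"
    unfolding total_variation_def
    by (subst SUP_mult_left_ennreal) (auto intro!: SUP_cong simp: sum_distrib_left abs_mult ennreal_mult simp del: sum_ennreal)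
  then show ?thesis unfolding tv_def by (simp add: enn2real_mult)
qed

lemma tv_eq_0D:
  assumes "signed_measure \<mu>" "tv \<mu> = 0"
  shows "\<mu> A = 0"
  using abs_le_tv[OF assms(1), of A] assms(2) by simp

section \<open>Integrals of bounded Borel functions against a signed measure\<close>

definition bounded_borel :: "(plane \<Rightarrow> real) \<Rightarrow> bool" where
  "bounded_borel g \<longleftrightarrow> g \<in> borel_measurable borel \<and> (\<exists>c. \<forall>x. \<bar>g x\<bar> \<le> c)"

lemma integrable_bounded_borel:
  assumes "finite_measure M" "sets M = sets borel" "bounded_borel g"
  shows "integrable M g"
proof -
  interpret finite_measure M by fact
  from assms(3) obtain c where "\<And>x. \<bar>g x\<bar> \<le> c" unfolding bounded_borel_def by blast
  moreover have "g \<in> borel_measurable M"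
    using assms(3) unfolding measurable_cong_sets[OF assms(2) refl] bounded_borel_def by simp
  ultimately show ?thesis by (intro integrable_const_bound[of _ c]) auto
qed

lemma bounded_borel_scale: "bounded_borel g \<Longrightarrow> bounded_borel (\<lambda>x. c * g x)"
  unfolding bounded_borel_def
  by (auto simp: abs_mult intro!: borel_measurable_times) (meson abs_ge_zero mult_left_mono)

lemma bounded_borel_const [simp]: "bounded_borel (\<lambda>x. c)"
  unfolding bounded_borel_def by auto

text \<open>Jordan parts do not depend additively on the signed measure, so linearity of
  \<open>signed_integral\<close> in the measure cannot be read off its definition. It is derived
  from linear relations between finite measures that hold on all Borel sets. The relations sit in a
  list because those used below involve four and six measures.\<close>

lemma sum_list_lincomb_zero_simple:
  fixes s :: "plane \<Rightarrow> real"
  assumes xs: "\<And>d M. (d, M) \<in> set xs \<Longrightarrow> finite_measure M \<and> sets M = sets borel"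
    and zero: "\<And>A. A \<in> sets borel \<Longrightarrow> (\<Sum>(d, M)\<leftarrow>xs. d * measure M A) = 0"
    and s: "simple_function borel s"
  shows "(\<Sum>(d, M)\<leftarrow>xs. d * (\<integral>x. s x \<partial>M)) = 0"
proof -
  have fin: "finite (range s)" using simple_functionD(1)[OF s] by simp
  have meas: "s -` {y} \<in> sets borel" for y using simple_functionD(2)[OF s, of "{y}"] by simp
  have int: "(\<integral>x. s x \<partial>M) = (\<Sum>y\<in>range s. y * measure M (s -` {y}))"
    if M: "finite_measure M" "sets M = sets borel" for M
  proof -
    interpret finite_measure M by fact
    have "(\<integral>x. s x \<partial>M) = (\<integral>x. (\<Sum>y\<in>range s. y * indicator (s -` {y}) x) \<partial>M)"
    proof (rule Bochner_Integration.integral_cong[OF refl])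
      fix x
      have "(\<Sum>y\<in>range s. y * indicator (s -` {y}) x) = (\<Sum>y\<in>{s x}. y * indicator (s -` {y}) x)"
        using fin by (intro sum.mono_neutral_right) (auto simp: indicator_def)
      then show "s x = (\<Sum>y\<in>range s. y * indicator (s -` {y}) x)" by simp
    qed
    also have "\<dots> = (\<Sum>y\<in>range s. \<integral>x. y * indicator (s -` {y}) x \<partial>M)"
      using meas M(2) by (intro Bochner_Integration.integral_sum integrable_mult_right integrable_real_indicator)
        (auto simp: emeasure_eq_measure)
    also have "\<dots> = (\<Sum>y\<in>range s. y * measure M (s -` {y}))"
      using meas M(2) sets_eq_imp_space_eq[OF M(2)] by simp
    finally show ?thesis .
  qed
  have "(\<Sum>(d, M)\<leftarrow>xs. d * (\<integral>x. s x \<partial>M)) = (\<Sum>(d, M)\<leftarrow>xs. \<Sum>y\<in>range s. y * (d * measure M (s -` {y})))"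
    using xs by (intro arg_cong[of _ _ sum_list] map_cong) (auto simp: int sum_distrib_left algebra_simps)
  also have "\<dots> = (\<Sum>y\<in>range s. y * (\<Sum>(d, M)\<leftarrow>xs. d * measure M (s -` {y})))"
    by (induction xs) (auto simp: algebra_simps sum.distrib)
  also have "\<dots> = 0" using zero[OF meas] by simp
  finally show ?thesis .
qed

text \<open>Simple functions bounded by \<open>2 * c\<close> converge to \<open>g\<close> pointwise,
  and dominated convergence carries the relation over; the constant bound is integrable because the
  measures are finite.\<close>

lemma sum_list_lincomb_zero:
  assumes xs: "\<And>d M. (d, M) \<in> set xs \<Longrightarrow> finite_measure M \<and> sets M = sets borel"
    and zero: "\<And>A. A \<in> sets borel \<Longrightarrow> (\<Sum>(d, M)\<leftarrow>xs. d * measure M A) = 0"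
    and g: "bounded_borel g"
  shows "(\<Sum>(d, M)\<leftarrow>xs. d * (\<integral>x. g x \<partial>M)) = 0"
proof -
  obtain c where c: "\<And>x. \<bar>g x\<bar> \<le> c" using g unfolding bounded_borel_def by blast
  have gm: "g \<in> borel_measurable borel" using g unfolding bounded_borel_def by blast
  from borel_measurable_implies_sequence_metric[OF gm, of 0] obtain s where
    s: "\<And>i. simple_function borel (s i)" "\<And>x. (\<lambda>i. s i x) \<longlonglongrightarrow> g x"
       "\<And>i x. dist (s i x) 0 \<le> 2 * dist (g x) 0" by auto
  have sb: "\<bar>s i x\<bar> \<le> 2 * c" for i x using s(3)[of i x] c[of x] by (simp add: dist_real_def)
  have lim: "(\<lambda>i. \<integral>x. s i x \<partial>M) \<longlonglongrightarrow> (\<integral>x. g x \<partial>M)" if M: "finite_measure M" "sets M = sets borel" for M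
  proof -
    interpret finite_measure M by fact
    have "g \<in> borel_measurable M" "s i \<in> borel_measurable M" for i
      using gm borel_measurable_simple_function[OF s(1)[of i]]
      unfolding measurable_cong_sets[OF M(2) refl] by auto
    then show ?thesis
      using s(2) sb by (intro integral_dominated_convergence[where w = "\<lambda>_. 2 * c"]) auto
  qed
  have "(\<lambda>i. \<Sum>(d, M)\<leftarrow>ys. d * (\<integral>x. s i x \<partial>M)) \<longlonglongrightarrow> (\<Sum>(d, M)\<leftarrow>ys. d * (\<integral>x. g x \<partial>M))"
    if "set ys \<subseteq> set xs" for ys
    using that
  proof (induction ys)
    case (Cons y ys)
    obtain d M where y: "y = (d, M)" by force
    then have "finite_measure M \<and> sets M = sets borel" using xs[of d M] Cons.prems by auto
    then show ?case using Cons y by (auto intro!: tendsto_add tendsto_mult lim)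
  qed simp
  from this[of xs] have "(\<lambda>i. 0) \<longlonglongrightarrow> (\<Sum>(d, M)\<leftarrow>xs. d * (\<integral>x. g x \<partial>M))"
    using sum_list_lincomb_zero_simple[OF xs zero s(1)] by simp
  then show ?thesis by (simp add: LIMSEQ_const_iff)
qed

text \<open>Permits decompositions of \<open>\<mu>\<close> other than the Jordan one, such as those
  that arise from swept measures and from Riesz measures: the two decompositions differ by a
  vanishing linear relation of four measures.\<close>

lemma signed_integral_eq:
  assumes sm: "signed_measure \<mu>" and M: "finite_measure M" "sets M = sets borel"
    and N: "finite_measure N" "sets N = sets borel"
    and eq: "\<And>A. A \<in> sets borel \<Longrightarrow> \<mu> A = measure M A - measure N A" and g: "bounded_borel g"
  shows "signed_integral \<mu> g = (\<integral>x. g x \<partial>M) - (\<integral>x. g x \<partial>N)"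
proof -
  let ?xs = "[(1, positive_part \<mu>), (-1, negative_part \<mu>), (-1, M), (1, N)]"
  note sm' = signed_measure_uminus[OF sm]
  have "(\<Sum>(d, M)\<leftarrow>?xs. d * (\<integral>x. g x \<partial>M)) = 0"
  proof (rule sum_list_lincomb_zero[OF _ _ g])
    fix A :: "plane set" assume "A \<in> sets borel"
    then show "(\<Sum>(d, M)\<leftarrow>?xs. d * measure M A) = 0"
      using eq[of A] jordan_decomposition[OF sm, of A] by simp
  qed (use M N finite_measure_positive_part[OF sm] finite_measure_positive_part[OF sm']
    sets_positive_part[OF sm] sets_positive_part[OF sm'] in auto)
  then show ?thesis unfolding signed_integral_def by simp
qed

lemma signed_integral_lincomb:
  assumes \<mu>: "signed_measure \<mu>" and \<nu>: "signed_measure \<nu>" and g: "bounded_borel g"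
  shows "signed_integral (\<lambda>A. a * \<mu> A + b * \<nu> A) g = a * signed_integral \<mu> g + b * signed_integral \<nu> g"
proof -
  let ?\<kappa> = "\<lambda>A. a * \<mu> A + b * \<nu> A"
  let ?xs = "[(1, positive_part ?\<kappa>), (-1, negative_part ?\<kappa>), (-a, positive_part \<mu>), (a, negative_part \<mu>),
    (-b, positive_part \<nu>), (b, negative_part \<nu>)]"
  note \<kappa> = signed_measure_lincomb[OF \<mu> \<nu>, of a b]
  note ms = \<mu> \<nu> \<kappa> and ms' = \<mu>[THEN signed_measure_uminus] \<nu>[THEN signed_measure_uminus] \<kappa>[THEN signed_measure_uminus]
  have "(\<Sum>(d, M)\<leftarrow>?xs. d * (\<integral>x. g x \<partial>M)) = 0"
  proof (rule sum_list_lincomb_zero[OF _ _ g])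
    fix A :: "plane set" assume "A \<in> sets borel"
    note j = this[THEN jordan_decomposition[rotated]]
    have "1 * x + (- 1 * x' + (- a * y + (a * y' + (- b * z + (b * z' + 0))))) = 0"
      if "a * m + b * n = x - x'" "m = y - y'" "n = z - z'" for m n x x' y y' z z' :: real
      using that by (simp add: algebra_simps)
    from this[OF j[OF \<kappa>] j[OF \<mu>] j[OF \<nu>]]
    show "(\<Sum>(d, M)\<leftarrow>?xs. d * measure M A) = 0"
      by (simp only: list.map prod.case sum_list.Cons sum_list.Nil)
  qed (use ms[THEN finite_measure_positive_part] ms'[THEN finite_measure_positive_part]
    ms[THEN sets_positive_part] ms'[THEN sets_positive_part] in auto)
  then show ?thesis unfolding signed_integral_def by (simp add: algebra_simps)
qed

lemma integrable_positive_part: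
  "signed_measure \<mu> \<Longrightarrow> bounded_borel g \<Longrightarrow> integrable (positive_part \<mu>) g"
  by (intro integrable_bounded_borel finite_measure_positive_part sets_positive_part)

lemma signed_integral_add:
  assumes "signed_measure \<mu>" "bounded_borel g" "bounded_borel h"
  shows "signed_integral \<mu> (\<lambda>x. g x + h x) = signed_integral \<mu> g + signed_integral \<mu> h"
  using assms signed_measure_uminus[OF assms(1)]
  unfolding signed_integral_def by (simp add: integrable_positive_part)

lemma signed_integral_scale: "signed_integral \<mu> (\<lambda>x. c * g x) = c * signed_integral \<mu> g"
  unfolding signed_integral_def by (simp add: algebra_simps)

lemma signed_integral_diff:
  assumes "signed_measure \<mu>" "bounded_borel g" "bounded_borel h"
  shows "signed_integral \<mu> (\<lambda>x. g x - h x) = signed_integral \<mu> g - signed_integral \<mu> h"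
  using signed_integral_add[OF assms(1,2) bounded_borel_scale[OF assms(3), of "-1"]]
    signed_integral_scale[of \<mu> "-1" h] by simp

lemma abs_signed_integral_le:
  assumes sm: "signed_measure \<mu>" and g: "g \<in> borel_measurable borel" and c: "\<And>x. \<bar>g x\<bar> \<le> c"
  shows "\<bar>signed_integral \<mu> g\<bar> \<le> c * tv \<mu>"
proof -
  have *: "\<bar>\<integral>x. g x \<partial>positive_part \<mu>\<bar> \<le> c * measure (positive_part \<mu>) UNIV" if sm: "signed_measure \<mu>" for \<mu>
  proof -
    interpret finite_measure "positive_part \<mu>" using sm by (rule finite_measure_positive_part)
    have "integrable (positive_part \<mu>) g"
      using g c by (intro integrable_positive_part[OF sm]) (auto simp: bounded_borel_def)
    then have "\<bar>\<integral>x. g x \<partial>positive_part \<mu>\<bar> \<le> (\<integral>x. \<bar>g x\<bar> \<partial>positive_part \<mu>)"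
      using integral_norm_bound[of "positive_part \<mu>" g] by simp
    also have "\<dots> \<le> (\<integral>x. c \<partial>positive_part \<mu>)"
      using \<open>integrable (positive_part \<mu>) g\<close> c by (intro integral_mono) auto
    finally show ?thesis using space_positive_part[OF sm] by (simp add: mult.commute)
  qed
  show ?thesis
    using *[OF sm] *[OF signed_measure_uminus[OF sm]] unfolding signed_integral_def tv_eq[OF sm]
    by (simp add: algebra_simps)
qed

definition vanishes_off :: "plane set \<Rightarrow> (plane set \<Rightarrow> real) \<Rightarrow> bool" where
  "vanishes_off S \<mu> \<longleftrightarrow> (\<forall>A\<in>sets borel. A \<inter> S = {} \<longrightarrow> \<mu> A = 0)"

text \<open>Every Borel set inside the complement of \<open>S\<close> has mass 0, so the supremum
  defining the positive part of that complement is 0.\<close>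

lemma AE_positive_part_vanishes_off:
  assumes sm: "signed_measure \<mu>" and "vanishes_off S \<mu>" and S: "S \<in> sets borel"
  shows "AE x in positive_part \<mu>. x \<in> S"
proof -
  have "ennreal (\<mu> B) \<le> 0" if "B \<in> sets borel" "B \<subseteq> - S" for B
  proof -
    have "\<mu> B = 0" using that assms(2) unfolding vanishes_off_def by blast
    then show ?thesis by simp
  qed
  then have "upper_variation \<mu> (- S) \<le> 0"
    unfolding upper_variation_def[OF sm] by (intro SUP_least) simp
  then have "emeasure (positive_part \<mu>) (- S) = 0"
    using S by (subst emeasure_positive_part[OF sm]) auto
  then show ?thesis
    using S sm by (intro AE_I[of _ _ "- S"]) auto
qed

lemma vanishes_off_uminus: "vanishes_off S \<mu> \<Longrightarrow> vanishes_off S (\<lambda>A. - \<mu> A)"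
  unfolding vanishes_off_def by auto

lemma signed_integral_cong_on:
  assumes sm: "signed_measure \<mu>" and "vanishes_off S \<mu>" "S \<in> sets borel"
    and "g \<in> borel_measurable borel" "h \<in> borel_measurable borel" and eq: "\<And>x. x \<in> S \<Longrightarrow> g x = h x"
  shows "signed_integral \<mu> g = signed_integral \<mu> h"
proof -
  have *: "(\<integral>x. g x \<partial>positive_part \<mu>) = (\<integral>x. h x \<partial>positive_part \<mu>)"
    if sm: "signed_measure \<mu>" and van: "vanishes_off S \<mu>" for \<mu>
    using AE_positive_part_vanishes_off[OF sm van assms(3)] assms(4,5) eq
    by (intro integral_cong_AE) (auto simp: measurable_cong_sets[OF sets_positive_part[OF sm] refl])
  show ?thesis
    unfolding signed_integral_def
    using *[OF sm assms(2)] *[OF signed_measure_uminus[OF sm] vanishes_off_uminus[OF assms(2)]] by simp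
qed

definition measure_diff :: "plane measure \<Rightarrow> plane measure \<Rightarrow> plane set \<Rightarrow> real" where
  "measure_diff M N A = (if A \<in> sets borel then measure M A - measure N A else 0)"

lemma signed_measure_measure_diff:
  assumes M: "finite_measure M" "sets M = sets borel" and N: "finite_measure N" "sets N = sets borel"
  shows "signed_measure (measure_diff M N)"
proof -
  have *: "(\<lambda>i. measure M (A i)) sums measure M (\<Union>i. A i)"
    if "finite_measure M" "sets M = sets borel" "range A \<subseteq> sets borel" "disjoint_family A"
    for M :: "plane measure" and A :: "nat \<Rightarrow> plane set"
    using finite_measure.finite_measure_UNION[OF that(1)] that by auto
  show ?thesis
    unfolding signed_measure_def measure_diff_def
  proof (intro conjI allI impI; (simp; fail)?)
    fix A :: "nat \<Rightarrow> plane set" assume A: "range A \<subseteq> sets borel" "disjoint_family A"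
    then have "(\<Union>i. A i) \<in> sets borel" and "\<And>i. A i \<in> sets borel" by auto
    then show "(\<lambda>i. if A i \<in> sets borel then measure M (A i) - measure N (A i) else 0) sums
        (if (\<Union>i. A i) \<in> sets borel then measure M (\<Union>i. A i) - measure N (\<Union>i. A i) else 0)"
      using *[OF M A] *[OF N A] by (auto intro!: sums_diff)
  qed
qed

section \<open>Smooth bump functions\<close>

text \<open>Iterated derivatives are awkward to compute but easy to enclose: it is enough to find a
  class of differentiable functions that is stable under the coordinate derivatives. Sums of
  products, multiples of \<open>flat\<close> and segment integrals are such classes.\<close>

lemma smooth_coinduct:
  assumes "g \<in> S" "\<And>h x. h \<in> S \<Longrightarrow> h differentiable (at x)" "\<And>h b. h \<in> S \<Longrightarrow> b \<in> Basis \<Longrightarrow> pd b h \<in> S"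
  shows "smooth g"
proof -
  have "pds w g \<in> S" if "w \<in> lists Basis" for w
    using that by (induction w) (auto simp: pds_Cons assms)
  then show ?thesis unfolding smooth_def using assms(2) by blast
qed

lemma smooth_differentiable: "smooth g \<Longrightarrow> g differentiable (at x)"
  using smoothD[of g "[]"] by simp

lemma pd_eqI:
  assumes "\<And>x. (g has_derivative g' x) (at x)"
  shows "pd b g = (\<lambda>x. g' x b)"
  unfolding pd_def using frechet_derivative_at[OF assms] by metis

lemma smooth_has_derivative:
  "smooth g \<Longrightarrow> (g has_derivative frechet_derivative g (at x)) (at x)"
  using smooth_differentiable frechet_derivative_works by blast

text \<open>The product rule leads out of the products of smooth functions but not out of their
  finite sums.\<close>

inductive_set product_sums :: "(plane \<Rightarrow> real) set" where
  prod: "smooth g \<Longrightarrow> smooth h \<Longrightarrow> (\<lambda>x. g x * h x) \<in> product_sums"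
| sum: "g \<in> product_sums \<Longrightarrow> h \<in> product_sums \<Longrightarrow> (\<lambda>x. g x + h x) \<in> product_sums"

lemma product_sums_differentiable: "h \<in> product_sums \<Longrightarrow> h differentiable (at x)"
  by (induction rule: product_sums.induct) (auto intro!: differentiable_mult intro: smooth_differentiable)

lemma smooth_mult:
  assumes "smooth g" "smooth h"
  shows "smooth (\<lambda>x. g x * h x)"
proof (rule smooth_coinduct[of _ product_sums])
  show "(\<lambda>x. g x * h x) \<in> product_sums" using assms by (rule product_sums.prod)
  show "h differentiable (at x)" if "h \<in> product_sums" for h x
    using that by (rule product_sums_differentiable)
  show "pd b h \<in> product_sums" if "h \<in> product_sums" "b \<in> Basis" for h b
    using that
  proof (induction rule: product_sums.induct)
    case (prod g h)
    have "pd b (\<lambda>x. g x * h x) = (\<lambda>x. g x * pd b h x + pd b g x * h x)"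
      unfolding pd_def[of b g] pd_def[of b h]
      by (rule pd_eqI) (intro has_derivative_mult smooth_has_derivative prod)
    then show ?case
      using prod by (simp only:) (intro product_sums.intros smooth_pd prod)
  next
    case (sum g h)
    then have "pd b (\<lambda>x. g x + h x) = (\<lambda>x. pd b g x + pd b h x)"
      by (intro pd_add product_sums_differentiable)
    with sum show ?case by (auto intro: product_sums.intros)
  qed
qed

text \<open>The polynomial parameter closes the family of the classical function
  \<open>exp (- 1 / x)\<close> under differentiation.\<close>

definition flat :: "real poly \<Rightarrow> real \<Rightarrow> real" where
  "flat P x = (if x > 0 then poly P (inverse x) * exp (- inverse x) else 0)"

lemma tendsto_poly_exp_0: "((\<lambda>t::real. poly P t * exp (- t)) \<longlongrightarrow> 0) at_top"
proof -
  have "((\<lambda>t::real. \<Sum>i\<le>degree P. coeff P i * (t ^ i / exp t)) \<longlongrightarrow> (\<Sum>i\<le>degree P. coeff P i * 0)) at_top"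
    by (intro tendsto_sum tendsto_mult tendsto_const tendsto_power_div_exp_0)
  then show ?thesis
    by (simp add: poly_altdef exp_minus field_simps sum_divide_distrib)
qed

text \<open>In the variable \<open>t = 1 / x\<close> differentiation by \<open>x\<close> is
  \<open>- t^2\<close> times differentiation by \<open>t\<close>, so \<open>P(t) exp(-t)\<close>
  becomes \<open>t^2 (P - P')(t) exp(-t)\<close>. At the origin the difference quotient is
  \<open>t P(t) exp(-t)\<close>, which tends to 0; its polynomial is
  \<open>pCons 0 P\<close>.\<close>

lemma flat_has_derivative:
  "(flat P has_real_derivative flat (monom 1 2 * (P - pderiv P)) x) (at x)"
proof -
  consider "x > 0" | "x < 0" | "x = 0" by linarith
  then show ?thesis
  proof cases
    case 1
    have "((\<lambda>x. poly P (inverse x) * exp (- inverse x)) has_real_derivative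
        flat (monom 1 2 * (P - pderiv P)) x) (at x)"
      using 1 by (auto intro!: derivative_eq_intros DERIV_chain'[OF _ poly_DERIV]
          simp: flat_def poly_monom algebra_simps power2_eq_square)
    moreover have "eventually (\<lambda>y. y > 0) (nhds x)" using eventually_nhds_in_open[of "{0<..}" x] 1 by simp
    ultimately show ?thesis
      by (subst DERIV_cong_ev[OF refl _ refl]) (auto simp: flat_def elim!: eventually_mono)
  next
    case 2
    have "(flat P has_real_derivative 0) (at x)"
      by (rule has_field_derivative_transform_within_open[of "\<lambda>_. 0" _ _ "{..<0}"])
        (use 2 in \<open>auto simp: flat_def\<close>)
    then show ?thesis using 2 by (simp add: flat_def)
  next
    case 3
    have "((\<lambda>h. poly (pCons 0 P) (inverse h) * exp (- inverse h)) \<longlongrightarrow> 0) (at_right 0)"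
      using filterlim_compose[OF tendsto_poly_exp_0 filterlim_inverse_at_top_right] .
    then have "((\<lambda>h. flat P h / h) \<longlongrightarrow> 0) (at_right 0)"
      by (rule Lim_transform_eventually)
        (auto simp: eventually_at_filter flat_def field_simps)
    moreover have "((\<lambda>h. flat P h / h) \<longlongrightarrow> 0) (at_left 0)"
      by (rule Lim_transform_eventually[of "\<lambda>_. 0"]) (auto simp: eventually_at_filter flat_def)
    ultimately have "((\<lambda>h. flat P h / h) \<longlongrightarrow> 0) (at 0)"
      by (simp add: filterlim_split_at)
    then show ?thesis using 3 by (simp add: DERIV_def flat_def)
  qed
qed

lemma smooth_flat: "smooth (\<lambda>z. flat P (m * (z \<bullet> b) + d))"
\<comment> \<open>The factor \<open>k\<close> absorbs the constants that the chain rule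
  produces.\<close>
proof (rule smooth_coinduct[of _ "{\<lambda>z. k * flat P (m * (z \<bullet> b) + d) | k P. True}"])
  show "(\<lambda>z. flat P (m * (z \<bullet> b) + d)) \<in> {\<lambda>z. k * flat P (m * (z \<bullet> b) + d) | k P. True}"
    by (intro CollectI exI[of _ "1 :: real"] exI[of _ P]) simp
  have *: "((\<lambda>z. k * flat P (m * (z \<bullet> b) + d)) has_derivative
      (\<lambda>v. (k * (m * (v \<bullet> b))) * flat (monom 1 2 * (P - pderiv P)) (m * (x \<bullet> b) + d))) (at x)" for k P x
  proof -
    have "((\<lambda>z. m * (z \<bullet> b) + d) has_derivative (\<lambda>v. m * (v \<bullet> b))) (at x)"
      by (auto intro!: derivative_eq_intros)
    from has_derivative_mult_right[OF DERIV_compose_FDERIV[OF flat_has_derivative this], of k]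
    show ?thesis by (simp add: algebra_simps)
  qed
  show "h differentiable (at x)" if "h \<in> {\<lambda>z. k * flat P (m * (z \<bullet> b) + d) | k P. True}" for h x
    using that * unfolding differentiable_def by blast
  show "pd c h \<in> {\<lambda>z. k * flat P (m * (z \<bullet> b) + d) | k P. True}"
    if "h \<in> {\<lambda>z. k * flat P (m * (z \<bullet> b) + d) | k P. True}" for h c
  proof -
    from that obtain k P where h: "h = (\<lambda>z. k * flat P (m * (z \<bullet> b) + d))" by blast
    show ?thesis unfolding h pd_eqI[OF *] by blast
  qed
qed

text \<open>Positive exactly between \<open>l\<close> and \<open>r\<close> for every
  \<open>n\<close>, while growing \<open>n\<close> steepens both flanks until the functions tend to
  the indicator of the open interval. \<open>Suc\<close> keeps \<open>n = 0\<close> a genuine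
  bump.\<close>

definition edge :: "nat \<Rightarrow> real \<Rightarrow> real \<Rightarrow> real \<Rightarrow> real" where
  "edge n l r x = flat 1 (real (Suc n) * (x - l)) * flat 1 (real (Suc n) * (r - x))"

lemma flat_1: "flat 1 x = (if x > 0 then exp (- inverse x) else 0)"
  unfolding flat_def by simp

lemma edge_nonneg [simp]: "0 \<le> edge n l r x"
  unfolding edge_def flat_1 by auto

lemma edge_not_neg [simp]: "\<not> edge n l r x < 0"
  by (simp add: not_less)

lemma edge_le_1: "edge n l r x \<le> 1"
proof -
  have "0 \<le> flat 1 t \<and> flat 1 t \<le> 1" for t unfolding flat_1 by simp
  then show ?thesis unfolding edge_def by (intro mult_le_one) auto
qed

lemma edge_pos_iff: "0 < edge n l r x \<longleftrightarrow> l < x \<and> x < r"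
  unfolding edge_def flat_1 by (auto simp: zero_less_mult_iff)

lemma edge_eq_0: "\<not> (l < x \<and> x < r) \<Longrightarrow> edge n l r x = 0"
  using edge_pos_iff[of n l r x] edge_nonneg[of n l r x] by linarith

lemma tendsto_edge: "(\<lambda>n. edge n l r x) \<longlonglongrightarrow> indicator {l<..<r} x"
proof -
  have *: "(\<lambda>n. flat 1 (real (Suc n) * t)) \<longlonglongrightarrow> (if t > 0 then 1 else 0)" for t
  proof (cases "t > 0")
    case True
    have "filterlim (\<lambda>n. real (Suc n) * t) at_top sequentially"
      using True filterlim_real_sequentially[THEN filterlim_compose[OF _ filterlim_Suc]]
      by (intro filterlim_at_top_mult_tendsto_pos[OF tendsto_const]) (auto simp: mult.commute)
    then have "(\<lambda>n. exp (- inverse (real (Suc n) * t))) \<longlonglongrightarrow> exp (- 0)"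
      by (intro tendsto_exp tendsto_minus tendsto_inverse_0_at_top)
    then show ?thesis using True by (simp add: flat_1)
  next
    case False
    then have "flat 1 (real (Suc n) * t) = 0" for n
      unfolding flat_1 by (auto simp: zero_less_mult_iff)
    then show ?thesis using False by simp
  qed
  have "(\<lambda>n. edge n l r x) \<longlonglongrightarrow> (if x - l > 0 then 1 else 0) * (if r - x > 0 then 1 else 0)"
    unfolding edge_def by (intro tendsto_mult *)
  then show ?thesis by (auto simp: indicator_def split: if_splits)
qed

text \<open>Open boxes are an intersection-stable generator of the Borel sets, so these bumps
  separate measures. The product form allows one coordinate to be frozen or exchanged in
  \<open>box_bump_split\<close>.\<close>

definition box_bump :: "nat \<Rightarrow> plane \<Rightarrow> plane \<Rightarrow> plane \<Rightarrow> real" where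
  "box_bump n p q z = edge n (fst p) (fst q) (fst z) * edge n (snd p) (snd q) (snd z)"

lemma box_bump_nonneg [simp]: "0 \<le> box_bump n p q z"
  and box_bump_le_1: "box_bump n p q z \<le> 1"
  unfolding box_bump_def by (auto intro: mult_le_one edge_le_1)

lemma mem_box_plane: "z \<in> box p q \<longleftrightarrow> fst p < fst z \<and> fst z < fst q \<and> snd p < snd z \<and> snd z < snd (q :: plane)"
  by (auto simp: mem_box Basis_prod_def inner_prod_def)

lemma box_bump_pos_iff: "0 < box_bump n p q z \<longleftrightarrow> z \<in> box p q"
  unfolding box_bump_def mem_box_plane
  by (auto simp: zero_less_mult_iff edge_pos_iff)

lemma box_bump_eq_0: "z \<notin> box p q \<Longrightarrow> box_bump n p q z = 0"
  using box_bump_pos_iff[of n p q z] box_bump_nonneg[of n p q z] by linarith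

lemma tendsto_box_bump: "(\<lambda>n. box_bump n p q z) \<longlonglongrightarrow> indicator (box p q) z"
proof -
  have "(\<lambda>n. box_bump n p q z) \<longlonglongrightarrow> indicator {fst p<..<fst q} (fst z) * indicator {snd p<..<snd q} (snd z)"
    unfolding box_bump_def by (intro tendsto_mult tendsto_edge)
  also have "indicator {fst p<..<fst q} (fst z) * indicator {snd p<..<snd q} (snd z) = (indicator (box p q) z :: real)"
    by (auto simp: indicator_def mem_box_plane)
  finally show ?thesis .
qed

lemma smooth_box_bump: "smooth (box_bump n p q)"
proof -
  have *: "smooth (\<lambda>z. flat 1 (real (Suc n) * (z \<bullet> b - l)))" "smooth (\<lambda>z. flat 1 (real (Suc n) * (r - z \<bullet> b)))"
    for b l r
    using smooth_flat[of 1 "Suc n" b "- (Suc n * l)"] smooth_flat[of 1 "- real (Suc n)" b "Suc n * r"]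
    by (simp_all add: algebra_simps)
  have **: "z \<bullet> (1, 0) = fst z" "z \<bullet> (0, 1) = snd z" for z :: plane
    by (simp_all add: inner_prod_def)
  show ?thesis
    unfolding box_bump_def edge_def **[symmetric] by (intro smooth_mult *)
qed

lemma support_box_bump: "support (box_bump n p q) \<subseteq> cbox p q"
  unfolding support_def using box_bump_eq_0[of _ p q n] box_subset_cbox[of p q]
  by (intro closure_minimal) auto

lemma support_subset_compact: "support g \<subseteq> S \<Longrightarrow> compact S \<Longrightarrow> compact (support g)"
  using compact_Int_closed[of S "support g"] by (simp add: Int_absorb1)

lift_definition box_test :: "nat \<Rightarrow> plane \<Rightarrow> plane \<Rightarrow> test_fun" is box_bump
  by (auto intro: smooth_box_bump support_subset_compact[OF support_box_bump compact_cbox])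

lemma measurable_box_bump [measurable]: "box_bump n p q \<in> borel_measurable borel"
  using borel_measurable_continuous_onI[OF continuous_test[of UNIV "box_test n p q"]]
  by (simp add: box_test.rep_eq)

lemma bounded_borel_test: "bounded_borel (test_apply \<phi>)"
proof -
  have "bdd_above (range (\<lambda>x. \<bar>test_apply \<phi> x\<bar>))" using bdd_pds[of "[]" \<phi>] by simp
  then show ?thesis
    unfolding bounded_borel_def bdd_above_def
    using borel_measurable_continuous_onI[OF continuous_test] by auto
qed

text \<open>As \<open>n\<close> grows the integrals tend to the measures of open boxes, and finite
  measures that agree on all open boxes are equal.\<close>

lemma measure_eqI_box_bump:
  assumes M: "finite_measure M" "sets M = sets borel" and N: "finite_measure N" "sets N = sets borel"
    and eq: "\<And>n p q. (\<integral>x. box_bump n p q x \<partial>M) = (\<integral>x. box_bump n p q x \<partial>N)"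
  shows "M = N"
proof -
  have lim: "(\<lambda>n. \<integral>x. box_bump n p q x \<partial>M) \<longlonglongrightarrow> measure M (box p q)"
    if M: "finite_measure M" "sets M = sets borel" for M :: "plane measure" and p q
  proof -
    interpret finite_measure M by fact
    have "(\<lambda>n. \<integral>x. box_bump n p q x \<partial>M) \<longlonglongrightarrow> (\<integral>x. indicator (box p q) x \<partial>M)"
      by (rule integral_dominated_convergence[where w = "\<lambda>_. 1"])
        (auto simp: measurable_cong_sets[OF M(2) refl] tendsto_box_bump box_bump_le_1)
    then show ?thesis using sets_eq_imp_space_eq[OF M(2)] by simp
  qed
  have *: "emeasure M (box p q) = emeasure N (box p q)" for p q
    using LIMSEQ_unique[OF lim[OF M] lim[OF N, folded eq]] M N
    by (simp add: finite_measure.emeasure_eq_measure)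
  show ?thesis
  proof (rule measure_eqI_generator_eq[where \<Omega> = UNIV and E = "range (\<lambda>(a, b). box a b)"
        and A = "\<lambda>n. box (- (real n, real n)) (real n, real n)"])
    show "Int_stable (range (\<lambda>(a, b). box a b :: plane set))"
      unfolding Int_stable_def by (auto simp: box_Int_box)
    show "sets M = sigma_sets UNIV (range (\<lambda>(a, b). box a b))"
      "sets N = sigma_sets UNIV (range (\<lambda>(a, b). box a b))"
      using M(2) N(2) unfolding borel_eq_box by auto
    show "(\<Union>i. box (- (real i, real i)) (real i, real i)) = (UNIV :: plane set)"
    proof (intro equalityI subsetI UNIV_I)
      fix z :: plane
      obtain n where "norm z < real n" using reals_Archimedean2 by blast
      moreover have "\<bar>fst z\<bar> \<le> norm z" "\<bar>snd z\<bar> \<le> norm z"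
        by (metis norm_fst_le prod.collapse real_norm_def, metis norm_snd_le prod.collapse real_norm_def)
      ultimately have "\<bar>fst z\<bar> < real n" "\<bar>snd z\<bar> < real n" by linarith+
      then show "z \<in> (\<Union>i. box (- (real i, real i)) (real i, real i))"
        by (auto simp: mem_box_plane intro!: exI[of _ n])
    qed
    show "emeasure M (box (- (real i, real i)) (real i, real i)) \<noteq> \<infinity>" for i
      using M(1) by (simp add: finite_measure.emeasure_eq_measure)
  qed (use * in auto)
qed

text \<open>The hypothesis makes the positive and the negative part the same measure, so they
  cancel.\<close>

lemma signed_measure_eq_0I:
  assumes sm: "signed_measure \<mu>" and eq: "\<And>n p q. signed_integral \<mu> (box_bump n p q) = 0"
  shows "\<mu> = (\<lambda>_. 0)"
proof
  fix A
  note sm' = signed_measure_uminus[OF sm]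
  have "positive_part \<mu> = negative_part \<mu>"
    using eq unfolding signed_integral_def
    by (intro measure_eqI_box_bump finite_measure_positive_part sets_positive_part sm sm') simp
  then show "\<mu> A = 0"
    using jordan_decomposition[OF sm, of A] signed_measure_outside[OF sm, of A]
    by (cases "A \<in> sets borel") auto
qed

section \<open>Signed measures as distributions\<close>

lemma represents_unique:
  assumes "represents \<mu> u" "represents \<nu> u"
  shows "\<mu> = \<nu>"
proof -
  have \<mu>: "signed_measure \<mu>" and \<nu>: "signed_measure \<nu>" using assms by (auto simp: represents_def)
  have "(\<lambda>A. 1 * \<mu> A + - 1 * \<nu> A) = (\<lambda>_. 0)"
  proof (rule signed_measure_eq_0I[OF signed_measure_lincomb[OF \<mu> \<nu>]])
    fix n p q
    have "signed_integral \<mu> (test_apply (box_test n p q)) = signed_integral \<nu> (test_apply (box_test n p q))"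
      using assms unfolding represents_def by metis
    then show "signed_integral (\<lambda>A. 1 * \<mu> A + - 1 * \<nu> A) (box_bump n p q) = 0"
      using bounded_borel_test[of "box_test n p q"]
      by (simp only: signed_integral_lincomb[OF \<mu> \<nu>] box_test.rep_eq)
  qed
  then show ?thesis by (metis add.commute add_uminus_conv_diff eq_iff_diff_eq_0 mult_1 mult_minus1 ext)
qed

lemma measure_of_distr_eqI: "represents \<mu> u \<Longrightarrow> measure_of_distr u = \<mu>"
  unfolding measure_of_distr_def using represents_unique by blast

lemma M_norm_eq: "represents \<mu> u \<Longrightarrow> M_norm u = tv \<mu>"
  unfolding M_norm_def tv_def by (simp add: measure_of_distr_eqI)

lemma M_norm_well_definedI: "represents \<mu> u \<Longrightarrow> M_norm_well_defined u"
  unfolding M_norm_well_defined_def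
  using represents_unique measure_of_distr_eqI total_variation_finite by (metis represents_def)

lemma distribution_eqI: "(\<And>\<phi>. dist_apply u \<phi> = dist_apply v \<phi>) \<Longrightarrow> u = v"
  by (metis dist_apply_inject ext)

lemma is_distribution_dist_apply: "is_distribution (dist_apply u)"
  using dist_apply[of u] by simp

lemma linear_dist_apply: "linear (dist_apply u)"
  using is_distribution_dist_apply[of u] unfolding is_distribution_def by blast

lemma abs_test_apply_le: "\<bar>test_apply \<psi> x\<bar> \<le> test_seminorm 0 \<psi>"
proof -
  have "{w. w \<in> lists (Basis :: plane set) \<and> length w \<le> 0} = {[]}" by auto
  then show ?thesis
    using cSUP_upper[OF UNIV_I bdd_pds[of "[]" \<psi>], of x] by (simp add: test_seminorm_def)
qed

lemma is_distribution_signed_integral: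
  assumes sm: "signed_measure \<mu>"
  shows "is_distribution (\<lambda>\<phi>. signed_integral \<mu> (test_apply \<phi>))"
  unfolding is_distribution_def
proof (intro conjI allI impI)
  show "linear (\<lambda>\<phi>. signed_integral \<mu> (test_apply \<phi>))"
    by (auto simp: linear_iff plus_test_fun.rep_eq scaleR_test_fun.rep_eq signed_integral_scale
        signed_integral_add[OF sm bounded_borel_test bounded_borel_test])
  have "\<bar>signed_integral \<mu> (test_apply \<phi>)\<bar> \<le> tv \<mu> * test_seminorm 0 \<phi>" for \<phi>
    using abs_signed_integral_le[OF sm _ abs_test_apply_le[of \<phi>]] bounded_borel_test[of \<phi>]
    by (simp add: bounded_borel_def mult.commute)
  then show "\<exists>C N. \<forall>\<phi>. support (test_apply \<phi>) \<subseteq> S \<longrightarrow> \<bar>signed_integral \<mu> (test_apply \<phi>)\<bar> \<le> C * test_seminorm N \<phi>" for S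
    by blast
qed

definition measure_distr :: "(plane set \<Rightarrow> real) \<Rightarrow> distribution" where
  "measure_distr \<mu> = Abs_distribution (\<lambda>\<phi>. signed_integral \<mu> (test_apply \<phi>))"

lemma dist_apply_measure_distr:
  "signed_measure \<mu> \<Longrightarrow> dist_apply (measure_distr \<mu>) \<phi> = signed_integral \<mu> (test_apply \<phi>)"
  unfolding measure_distr_def by (simp add: Abs_distribution_inverse is_distribution_signed_integral)

lemma represents_measure_distr: "signed_measure \<mu> \<Longrightarrow> represents \<mu> (measure_distr \<mu>)"
  unfolding represents_def by (simp add: dist_apply_measure_distr)

lemma represents_iff: "represents \<mu> u \<longleftrightarrow> signed_measure \<mu> \<and> u = measure_distr \<mu>"
  unfolding represents_def by (auto simp: dist_apply_measure_distr intro: distribution_eqI)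

lemma measure_distr_lincomb:
  assumes "signed_measure \<mu>" "signed_measure \<nu>"
  shows "measure_distr (\<lambda>A. a * \<mu> A + b * \<nu> A) = a *\<^sub>R measure_distr \<mu> + b *\<^sub>R measure_distr \<nu>"
  by (rule distribution_eqI)
    (simp add: dist_apply_measure_distr signed_measure_lincomb signed_integral_lincomb assms bounded_borel_test
      plus_distribution.rep_eq scaleR_distribution.rep_eq)

section \<open>Derivatives of distributions along a coordinate direction\<close>

text \<open>This operator inverts differentiation along \<open>e\<close> up to a translation and, unlike an
  antiderivative, preserves compactness of the support.\<close>

definition segment_integral :: "real \<Rightarrow> plane \<Rightarrow> (plane \<Rightarrow> real) \<Rightarrow> plane \<Rightarrow> real" where
  "segment_integral R e g z = integral {0..R} (\<lambda>s. g (z + s *\<^sub>R e))"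

lemma Basis_plane: "(Basis :: plane set) = {(1, 0), (0, 1)}"
  by (auto simp: Basis_prod_def)

lemma smooth_continuous: "smooth g \<Longrightarrow> continuous_on S g"
  using smooth_differentiable by (auto intro!: continuous_at_imp_continuous_on differentiable_imp_continuous_within)

lemma frechet_derivative_plane:
  assumes "smooth g"
  shows "frechet_derivative g (at x) v = fst v * pd (1, 0) g x + snd v * pd (0, 1) g x"
proof -
  have "linear (frechet_derivative g (at x))"
    using smooth_differentiable[OF assms] by (rule linear_frechet_derivative)
  then have "frechet_derivative g (at x) (fst v *\<^sub>R (1, 0) + snd v *\<^sub>R (0, 1)) =
      fst v *\<^sub>R frechet_derivative g (at x) (1, 0) + snd v *\<^sub>R frechet_derivative g (at x) (0, 1)"
    by (simp only: linear_add linear_scale)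
  then show ?thesis by (simp add: pd_def)
qed

lemma segment_integral_has_derivative:
  assumes g: "smooth g"
  shows "(segment_integral R e g has_derivative
    (\<lambda>v. fst v * segment_integral R e (pd (1, 0) g) z + snd v * segment_integral R e (pd (0, 1) g) z)) (at z)"
proof -
  let ?L1 = "Blinfun (\<lambda>v::plane. fst v)" and ?L2 = "Blinfun (\<lambda>v::plane. snd v)"
  \<comment> \<open>\<open>leibniz_rule\<close> asks for the derivative as a jointly continuous
    family of bounded linear maps, so it is assembled from the two partial derivatives.\<close>
  define f' where "f' z s = pd (1, 0) g (z + s *\<^sub>R e) *\<^sub>R ?L1 + pd (0, 1) g (z + s *\<^sub>R e) *\<^sub>R ?L2" for z s
  have app: "blinfun_apply (f' z s) v = fst v * pd (1, 0) g (z + s *\<^sub>R e) + snd v * pd (0, 1) g (z + s *\<^sub>R e)" for z s v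
    unfolding f'_def
    by (simp add: blinfun.add_left blinfun.scaleR_left bounded_linear_Blinfun_apply bounded_linear_fst bounded_linear_snd)
  have cont: "continuous_on S (\<lambda>x. pd b g (h x))" if "b \<in> Basis" "continuous_on S h" for S :: "(plane \<times> real) set" and b h
    using continuous_on_compose2[OF smooth_continuous[OF smooth_pd[OF g that(1)], of UNIV] that(2)] by auto
  have contf: "continuous_on S (\<lambda>x. h (k x))" if "smooth h" "continuous_on S k" for S :: "real set" and h k
    using continuous_on_compose2[OF smooth_continuous[OF that(1), of UNIV] that(2)] by auto
  have cf: "continuous_on (UNIV \<times> cbox 0 R) (\<lambda>(z, s). f' z s)"
    unfolding f'_def case_prod_beta
    by (intro continuous_intros cont) (auto simp: Basis_plane)
  have "((\<lambda>z. integral (cbox 0 R) (\<lambda>s. g (z + s *\<^sub>R e))) has_derivative integral (cbox 0 R) (f' z)) (at z within UNIV)"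
  proof (rule leibniz_rule[OF _ _ cf])
    fix x t
    have "((\<lambda>x. x + t *\<^sub>R e) has_derivative (\<lambda>v. v)) (at x)" by (auto intro!: derivative_eq_intros)
    from has_derivative_compose[OF this smooth_has_derivative[OF g]]
    have "((\<lambda>x. g (x + t *\<^sub>R e)) has_derivative frechet_derivative g (at (x + t *\<^sub>R e))) (at x)" .
    moreover have "frechet_derivative g (at (x + t *\<^sub>R e)) = blinfun_apply (f' x t)"
      by (rule ext) (simp only: app frechet_derivative_plane[OF g])
    ultimately show "((\<lambda>x. g (x + t *\<^sub>R e)) has_derivative blinfun_apply (f' x t)) (at x within UNIV)"
      by simp
  next
    show "(\<lambda>s. g (x + s *\<^sub>R e)) integrable_on cbox 0 R" for x
      by (intro integrable_continuous contf[OF g] continuous_intros)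
  qed auto
  moreover have "blinfun_apply (integral (cbox 0 R) (f' z)) =
      (\<lambda>v. fst v * segment_integral R e (pd (1, 0) g) z + snd v * segment_integral R e (pd (0, 1) g) z)"
  proof
    fix v
    have "continuous_on (cbox 0 R) (f' z)"
      unfolding f'_def by (intro continuous_intros contf smooth_pd g) (auto simp: Basis_plane)
    then have "blinfun_apply (integral (cbox 0 R) (f' z)) v = integral (cbox 0 R) (\<lambda>s. blinfun_apply (f' z s) v)"
      by (intro blinfun_apply_integral integrable_continuous)
    also have "\<dots> = integral (cbox 0 R) (\<lambda>s. fst v * pd (1, 0) g (z + s *\<^sub>R e)) + integral (cbox 0 R) (\<lambda>s. snd v * pd (0, 1) g (z + s *\<^sub>R e))"
      unfolding app
      by (intro integral_add integrable_continuous continuous_intros contf smooth_pd g) (auto simp: Basis_plane)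
    finally show "blinfun_apply (integral (cbox 0 R) (f' z)) v =
      fst v * segment_integral R e (pd (1, 0) g) z + snd v * segment_integral R e (pd (0, 1) g) z"
      unfolding segment_integral_def by simp
  qed
  ultimately show ?thesis unfolding segment_integral_def by simp
qed

lemma pd_segment_integral:
  assumes "smooth g" "b \<in> Basis"
  shows "pd b (segment_integral R e g) = segment_integral R e (pd b g)"
  unfolding pd_eqI[OF segment_integral_has_derivative[OF assms(1)]]
  using assms(2) by (auto simp: Basis_plane)

lemma smooth_segment_integral:
  assumes "smooth g"
  shows "smooth (segment_integral R e g)"
proof (rule smooth_coinduct[of _ "{segment_integral R e g | g. smooth g}"])
  show "h differentiable (at x)" if "h \<in> {segment_integral R e g | g. smooth g}" for h x
    using that segment_integral_has_derivative unfolding differentiable_def by blast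
  show "pd b h \<in> {segment_integral R e g | g. smooth g}"
    if "h \<in> {segment_integral R e g | g. smooth g}" "b \<in> Basis" for h b
    using that pd_segment_integral smooth_pd by blast
qed (use assms in blast)

lemma segment_integral_pd:
  assumes g: "smooth g" and "0 \<le> R"
  shows "segment_integral R e (pd e g) z = g (z + R *\<^sub>R e) - g z"
proof -
  have "((\<lambda>s. pd e g (z + s *\<^sub>R e)) has_integral (g (z + R *\<^sub>R e) - g (z + 0 *\<^sub>R e))) {0..R}"
  proof (rule fundamental_theorem_of_calculus[OF assms(2)])
    fix s assume "s \<in> {0..R}"
    have "((\<lambda>s. z + s *\<^sub>R e) has_derivative (\<lambda>h. h *\<^sub>R e)) (at s)" by (auto intro!: derivative_eq_intros)
    from has_derivative_compose[OF this smooth_has_derivative[OF g]]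
    have "((\<lambda>s. g (z + s *\<^sub>R e)) has_derivative (\<lambda>h. frechet_derivative g (at (z + s *\<^sub>R e)) (h *\<^sub>R e))) (at s)" .
    then have "((\<lambda>s. g (z + s *\<^sub>R e)) has_vector_derivative pd e g (z + s *\<^sub>R e)) (at s)"
      unfolding has_vector_derivative_def pd_def
      by (simp add: linear_scale[OF linear_frechet_derivative[OF smooth_differentiable[OF g]]])
    then show "((\<lambda>s. g (z + s *\<^sub>R e)) has_vector_derivative pd e g (z + s *\<^sub>R e)) (at s within {0..R})"
      by (rule has_vector_derivative_at_within)
  qed
  then show ?thesis unfolding segment_integral_def by (simp add: integral_unique)
qed

lemma support_segment_integral:
  assumes "compact (support g)"
  shows "compact (support (segment_integral R e g))"
proof -
  \<comment> \<open>The points whose segment meets the support of \<open>g\<close>; compact as a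
    continuous image of a product of compact sets.\<close>
  let ?S = "(\<lambda>(x, s). x - s *\<^sub>R e) ` (support g \<times> {0..R})"
  have "compact ?S"
    by (intro compact_continuous_image compact_Times assms)
      (auto simp: case_prod_beta intro!: continuous_intros)
  moreover have "support (segment_integral R e g) \<subseteq> ?S"
    unfolding support_def[of "segment_integral R e g"]
  proof (intro closure_minimal compact_imp_closed \<open>compact ?S\<close> subsetI CollectI)
    fix z assume z: "z \<in> {z. segment_integral R e g z \<noteq> 0}"
    have "\<exists>s\<in>{0..R}. g (z + s *\<^sub>R e) \<noteq> 0"
    proof (rule ccontr)
      assume "\<not> (\<exists>s\<in>{0..R}. g (z + s *\<^sub>R e) \<noteq> 0)"
      then have "integral {0..R} (\<lambda>s. g (z + s *\<^sub>R e)) = integral {0..R} (\<lambda>s. 0)"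
        by (intro integral_cong) auto
      with z show False by (simp add: segment_integral_def)
    qed
    then obtain s where "s \<in> {0..R}" "z + s *\<^sub>R e \<in> support g"
      using eq_0_outside_support by blast
    then show "z \<in> ?S" by (intro image_eqI[of _ _ "(z + s *\<^sub>R e, s)"]) auto
  qed
  ultimately show ?thesis by (rule support_subset_compact[rotated])
qed

lift_definition test_segment :: "real \<Rightarrow> plane \<Rightarrow> test_fun \<Rightarrow> test_fun" is segment_integral
  by (simp add: smooth_segment_integral support_segment_integral)

text \<open>Makes the direction a parameter, so that each argument is carried out once for both
  coordinates. Any \<open>e\<close> other than \<open>(1, 0)\<close> is read as
  \<open>(0, 1)\<close>.\<close>

definition test_pd :: "plane \<Rightarrow> test_fun \<Rightarrow> test_fun" where
  "test_pd e = (if e = (1, 0) then test_pd1 else test_pd2)"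

lemma test_apply_test_pd: "e \<in> Basis \<Longrightarrow> test_apply (test_pd e \<phi>) = pd e (test_apply \<phi>)"
  by (auto simp: test_pd_def Basis_plane test_pd1.rep_eq test_pd2.rep_eq)

definition distr_pd :: "plane \<Rightarrow> distribution \<Rightarrow> distribution" where
  "distr_pd e = (if e = (1, 0) then D1 else D2)"

lemma D1_eq: "D1 = distr_pd (1, 0)" and D2_eq: "D2 = distr_pd (0, 1)"
  by (auto simp: distr_pd_def)

lemma dist_apply_distr_pd: "dist_apply (distr_pd e u) \<phi> = - dist_apply u (test_pd e \<phi>)"
  by (simp add: distr_pd_def test_pd_def D1.rep_eq D2.rep_eq)

lemma smooth_test: "smooth (test_apply \<phi>)" and compact_support_test: "compact (support (test_apply \<phi>))"
  using test_apply[of \<phi>] by auto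

lemma test_eqI: "(\<And>z. test_apply \<phi> z = test_apply \<psi> z) \<Longrightarrow> \<phi> = \<psi>"
  by (metis test_apply_inject ext)

lemma dist_apply_minus: "dist_apply (u - v) \<phi> = dist_apply u \<phi> - dist_apply v \<phi>"
  unfolding minus_distribution_def plus_distribution.rep_eq scaleR_distribution.rep_eq by simp

lemma test_segment_pd:
  assumes "e \<in> Basis" "b \<in> Basis"
  shows "test_segment R e (test_pd b \<phi>) = test_pd b (test_segment R e \<phi>)"
  by (rule test_eqI) (simp add: test_segment.rep_eq test_apply_test_pd assms pd_segment_integral smooth_test)

text \<open>Translation by \<open>-R e\<close>, written so that it is a test function by construction and differs
  from the identity by a derivative along \<open>e\<close>.\<close>

definition test_shift :: "real \<Rightarrow> plane \<Rightarrow> test_fun \<Rightarrow> test_fun" where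
  "test_shift R e \<phi> = \<phi> + test_pd e (test_segment R e \<phi>)"

lemma test_apply_pd_segment:
  assumes "e \<in> Basis" "0 \<le> R"
  shows "test_apply (test_pd e (test_segment R e \<phi>)) z = test_apply \<phi> (z + R *\<^sub>R e) - test_apply \<phi> z"
  using assms by (simp add: test_segment_pd[symmetric] test_segment.rep_eq test_apply_test_pd
      segment_integral_pd smooth_test)

lemma test_apply_shift:
  "e \<in> Basis \<Longrightarrow> 0 \<le> R \<Longrightarrow> test_apply (test_shift R e \<phi>) z = test_apply \<phi> (z + R *\<^sub>R e)"
  by (simp add: test_shift_def plus_test_fun.rep_eq test_apply_pd_segment)

text \<open>The identity behind both uniqueness and the vanishing of marginals: moving a test
  function along \<open>e\<close> costs only a pairing with the derivative along
  \<open>e\<close>.\<close>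

lemma dist_apply_shift:
  "dist_apply u (test_shift R e \<phi>) = dist_apply u \<phi> - dist_apply (distr_pd e u) (test_segment R e \<phi>)"
  by (simp add: test_shift_def dist_apply_distr_pd linear_add[OF linear_dist_apply])

lemma test_bounded: "\<exists>c>0. \<forall>z. test_apply \<phi> z \<noteq> 0 \<longrightarrow> norm z < c"
proof -
  from compact_imp_bounded[OF compact_support_test[of \<phi>]] obtain c where
    c: "c > 0" "\<And>z. z \<in> support (test_apply \<phi>) \<Longrightarrow> norm z \<le> c"
    by (auto simp: bounded_pos)
  then have "\<forall>z. test_apply \<phi> z \<noteq> 0 \<longrightarrow> norm z < c + 1"
    using eq_0_outside_support by fastforce
  with c(1) show ?thesis by (intro exI[of _ "c + 1"]) auto
qed

lemma test_pd_diff: "test_pd b (\<phi> - \<psi>) = test_pd b \<phi> - test_pd b \<psi>"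
  unfolding test_pd_def by (simp add: linear_diff[OF linear_test_pd1] linear_diff[OF linear_test_pd2])

lemma test_pd_shift:
  assumes "e \<in> Basis" "b \<in> Basis" "0 \<le> R"
  shows "test_pd b (test_shift R e \<phi>) = test_shift R e (test_pd b \<phi>)"
proof (rule test_eqI)
  fix z
  have "((\<lambda>z. test_apply \<phi> (z + R *\<^sub>R e)) has_derivative
      frechet_derivative (test_apply \<phi>) (at (x + R *\<^sub>R e))) (at x)" for x
  proof -
    have "((\<lambda>z. z + R *\<^sub>R e) has_derivative (\<lambda>v. v)) (at x)" by (auto intro!: derivative_eq_intros)
    from has_derivative_compose[OF this smooth_has_derivative[OF smooth_test]] show ?thesis .
  qed
  from pd_eqI[OF this] have "pd b (\<lambda>z. test_apply \<phi> (z + R *\<^sub>R e)) = (\<lambda>z. pd b (test_apply \<phi>) (z + R *\<^sub>R e))"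
    unfolding pd_def .
  moreover have "test_apply (test_shift R e \<phi>) = (\<lambda>z. test_apply \<phi> (z + R *\<^sub>R e))"
    using test_apply_shift[OF assms(1,3)] by blast
  ultimately show "test_apply (test_pd b (test_shift R e \<phi>)) z = test_apply (test_shift R e (test_pd b \<phi>)) z"
    by (simp add: test_apply_shift[OF assms(1,3)] test_apply_test_pd[OF assms(2)])
qed

text \<open>Both mixed derivatives have the same integral over every segment in direction \<open>e\<close>, and
  such integrals determine a test function.\<close>

lemma test_pd_commute:
  assumes "e \<in> Basis" "b \<in> Basis"
  shows "test_pd e (test_pd b \<phi>) = test_pd b (test_pd e \<phi>)" (is "?\<alpha> = ?\<beta>")
proof (rule test_eqI)
  fix z :: plane
  obtain c where c: "c > 0" "\<And>z. test_apply ?\<alpha> z \<noteq> 0 \<Longrightarrow> norm z < c" using test_bounded by blast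
  obtain d where d: "d > 0" "\<And>z. test_apply ?\<beta> z \<noteq> 0 \<Longrightarrow> norm z < d" using test_bounded by blast
  \<comment> \<open>Starting from \<open>z\<close>, a shift of this length ends at norm at least
    \<open>c + d\<close>, outside both supports; the term \<open>norm z\<close> pays for the
    starting point.\<close>
  define R where "R = c + d + norm z"
  have R: "0 \<le> R" using c(1) d(1) by (simp add: R_def)
  have seg: "test_segment R e (test_pd e \<eta>) = test_shift R e \<eta> - \<eta>" for \<eta>
    by (simp add: test_shift_def test_segment_pd assms)
  have "test_segment R e ?\<alpha> = test_segment R e ?\<beta>"
  proof -
    have "test_segment R e ?\<beta> = test_pd b (test_segment R e (test_pd e \<phi>))"
      using assms by (rule test_segment_pd)
    also have "\<dots> = test_shift R e (test_pd b \<phi>) - test_pd b \<phi>"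
      by (simp only: seg test_pd_diff test_pd_shift[OF assms R])
    finally show ?thesis by (simp only: seg)
  qed
  then have *: "test_apply ?\<alpha> (z + R *\<^sub>R e) - test_apply ?\<alpha> z = test_apply ?\<beta> (z + R *\<^sub>R e) - test_apply ?\<beta> z"
    using test_apply_pd_segment[OF assms(1) R, of ?\<alpha> z] test_apply_pd_segment[OF assms(1) R, of ?\<beta> z] by simp
  have "norm (R *\<^sub>R e) \<le> norm (z + R *\<^sub>R e) + norm z"
    using norm_triangle_ineq4[of "z + R *\<^sub>R e" z] by simp
  then have n: "c + d \<le> norm (z + R *\<^sub>R e)"
    using R assms(1) by (simp add: R_def)
  then have "test_apply ?\<alpha> (z + R *\<^sub>R e) = 0" "test_apply ?\<beta> (z + R *\<^sub>R e) = 0"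
    using c d by (smt (verit))+
  with * show "test_apply ?\<alpha> z = test_apply ?\<beta> z" by simp
qed

lemma distr_pd_commute:
  "e \<in> Basis \<Longrightarrow> b \<in> Basis \<Longrightarrow> distr_pd e (distr_pd b u) = distr_pd b (distr_pd e u)"
  by (rule distribution_eqI) (simp add: dist_apply_distr_pd test_pd_commute[of e b])

lemma distr_pd_diff: "distr_pd e (u - v) = distr_pd e u - distr_pd e v"
  by (rule distribution_eqI) (simp add: dist_apply_distr_pd dist_apply_minus)

lemma DD_eq: "DD u = distr_pd (1, 0) (distr_pd (0, 1) u)"
  by (simp add: DD_def D1_eq D2_eq)

section \<open>Distributions that vanish outside the square\<close>

definition vanishes_outside_square :: "distribution \<Rightarrow> bool" where
  "vanishes_outside_square u \<longleftrightarrow> (\<forall>\<phi>. support (test_apply \<phi>) \<subseteq> - unit_square \<longrightarrow> dist_apply u \<phi> = 0)"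

lemma vanishes_outside_square_pd:
  assumes "vanishes_outside_square u" "e \<in> Basis"
  shows "vanishes_outside_square (distr_pd e u)"
  unfolding vanishes_outside_square_def
proof (intro allI impI)
  fix \<phi> assume "support (test_apply \<phi>) \<subseteq> - unit_square"
  then have "support (test_apply (test_pd e \<phi>)) \<subseteq> - unit_square"
    using support_pd[of e "test_apply \<phi>"] by (simp add: test_apply_test_pd[OF assms(2)])
  then show "dist_apply (distr_pd e u) \<phi> = 0"
    using assms(1) by (simp add: dist_apply_distr_pd vanishes_outside_square_def)
qed

lemma vanishes_outside_square_diff:
  "vanishes_outside_square u \<Longrightarrow> vanishes_outside_square v \<Longrightarrow> vanishes_outside_square (u - v)"
  by (simp add: vanishes_outside_square_def dist_apply_minus)

lemma mem_unit_square: "z \<in> unit_square \<longleftrightarrow> 0 \<le> fst z \<and> fst z \<le> 1 \<and> 0 \<le> snd z \<and> snd z \<le> 1"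
  by (auto simp: unit_square_def mem_Times_iff)

lemma mem_unit_square_Basis: "z \<in> unit_square \<longleftrightarrow> (\<forall>e\<in>Basis. 0 \<le> z \<bullet> e \<and> z \<bullet> e \<le> 1)"
  by (auto simp: mem_unit_square Basis_plane inner_prod_def)

text \<open>The support is a closure, so vanishing pointwise on the square would not keep it away
  from the square; the closed set \<open>S\<close> in between does.\<close>

lemma dist_apply_eq_0I:
  assumes "vanishes_outside_square u" "closed S" "S \<inter> unit_square = {}" "\<And>z. test_apply \<phi> z \<noteq> 0 \<Longrightarrow> z \<in> S"
  shows "dist_apply u \<phi> = 0"
proof -
  have "support (test_apply \<phi>) \<subseteq> S"
    unfolding support_def using assms(2,4) by (intro closure_minimal) auto
  then show ?thesis using assms(1,3) by (auto simp: vanishes_outside_square_def)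
qed

lemma closed_halfplane: "closed {z::plane. z \<bullet> e \<le> c}" "closed {z::plane. c \<le> z \<bullet> e}"
  by (intro closed_Collect_le continuous_intros)+

lemma distr_pd_eq_0D:
  assumes e: "e \<in> Basis" and pd: "distr_pd e u = 0" and van: "vanishes_outside_square u"
  shows "u = 0"
proof (rule distribution_eqI)
  fix \<phi>
  obtain c where c: "c > 0" "\<And>z. test_apply \<phi> z \<noteq> 0 \<Longrightarrow> norm z < c" using test_bounded by blast
  \<comment> \<open>Since \<open>norm z < c\<close> where \<open>\<phi>\<close> is nonzero, a shift
    by \<open>c + 1\<close> moves these points into the half-plane
    \<open>z \<bullet> e \<le> -1\<close>, which misses the square.\<close>
  have R: "0 \<le> c + 1" using c(1) by simp
  have "dist_apply u \<phi> = dist_apply u (test_shift (c + 1) e \<phi>)"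
    by (simp add: dist_apply_shift pd zero_distribution.rep_eq)
  also have "\<dots> = 0"
  proof (rule dist_apply_eq_0I[OF van closed_halfplane(1)[of e "-1"]])
    show "{z. z \<bullet> e \<le> - 1} \<inter> unit_square = {}"
      using e by (force simp: mem_unit_square_Basis)
    fix z assume "test_apply (test_shift (c + 1) e \<phi>) z \<noteq> 0"
    then have "norm (z + (c + 1) *\<^sub>R e) < c" using c(2) by (simp add: test_apply_shift[OF e R])
    then have "(z + (c + 1) *\<^sub>R e) \<bullet> e < c"
      using Basis_le_norm[OF e, of "z + (c + 1) *\<^sub>R e"] by linarith
    then show "z \<in> {z. z \<bullet> e \<le> - 1}" using e by (simp add: inner_add_left)
  qed
  finally show "dist_apply u \<phi> = dist_apply 0 \<phi>" by (simp add: zero_distribution.rep_eq)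
qed

lemma DD_eq_0D:
  assumes "DD f = 0" "vanishes_outside_square f"
  shows "f = 0"
  using assms vanishes_outside_square_pd[of f "(0, 1)"] distr_pd_eq_0D[of "(1, 0)" "distr_pd (0, 1) f"]
    distr_pd_eq_0D[of "(0, 1)" f]
  by (simp add: DD_eq Basis_plane)

section \<open>Injectivity of the mixed derivative on \<open>C0\<close>\<close>

lemma dist_apply_distr_of: "dist_apply (distr_of g) \<psi> = (\<integral>x. apply_bcontfun g x * test_apply \<psi> x \<partial>lborel)"
  by (simp add: distr_of.rep_eq)

lemma integrable_bcontfun_test:
  "integrable lborel (\<lambda>x. apply_bcontfun g x * test_apply \<psi> x)"
proof -
  have "integrable lborel (\<lambda>x. indicator (support (test_apply \<psi>)) x *\<^sub>R (apply_bcontfun g x * test_apply \<psi> x))"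
    by (intro borel_integrable_compact continuous_on_mult continuous_test compact_support_test) auto
  moreover have eq: "indicator (support (test_apply \<psi>)) x *\<^sub>R (apply_bcontfun g x * test_apply \<psi> x)
      = apply_bcontfun g x * test_apply \<psi> x" for x
    using eq_0_outside_support[of x "test_apply \<psi>"] by (auto simp: indicator_def)
  ultimately show ?thesis by (simp only: eq)
qed

lemma integrable_test: "integrable lborel (test_apply \<psi>)"
  using integrable_bcontfun_test[of "const_bcontfun 1" \<psi>] by (simp add: const_bcontfun.rep_eq)

text \<open>Substitution moves the translation from the test function to \<open>g\<close>, whose
  values at \<open>x - n e\<close> tend to 0. For \<open>C0\<close> this decay takes the place of
  vanishing outside the square.\<close>

lemma tendsto_dist_apply_shift:
  assumes g: "g \<in> C0" and e: "e \<in> Basis"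
  shows "(\<lambda>n. dist_apply (distr_of g) (test_shift (real n) e \<psi>)) \<longlonglongrightarrow> 0"
proof -
  have meas: "(\<lambda>x. apply_bcontfun g (x - real n *\<^sub>R e) * test_apply \<psi> x) \<in> borel_measurable lborel" for n
  proof -
    have "continuous_on UNIV (\<lambda>x. apply_bcontfun g (x - real n *\<^sub>R e) * test_apply \<psi> x)"
      by (intro continuous_intros continuous_test continuous_on_compose2[OF continuous_on_apply_bcontfun[of UNIV g]]) auto
    then show ?thesis using borel_measurable_continuous_onI by simp
  qed
  have eq: "dist_apply (distr_of g) (test_shift (real n) e \<psi>) =
      (\<integral>x. apply_bcontfun g (x - real n *\<^sub>R e) * test_apply \<psi> x \<partial>lborel)" for n
  proof -
    have "dist_apply (distr_of g) (test_shift (real n) e \<psi>) =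
        (\<integral>x. apply_bcontfun g x * test_apply \<psi> (real n *\<^sub>R e + x) \<partial>lborel)"
      by (simp add: dist_apply_distr_of test_apply_shift[OF e] add.commute)
    also have "\<dots> = (\<integral>x. (\<lambda>y. apply_bcontfun g (y - real n *\<^sub>R e) * test_apply \<psi> y) (real n *\<^sub>R e + x) \<partial>lborel)"
      by simp
    also have "\<dots> = (\<integral>x. apply_bcontfun g (x - real n *\<^sub>R e) * test_apply \<psi> x \<partial>lborel)"
      by (subst (2) lborel_distr_plus[of "real n *\<^sub>R e", symmetric], rule integral_distr[symmetric])
        (use meas in simp_all)
    finally show ?thesis .
  qed
  have "(\<lambda>n. \<integral>x. apply_bcontfun g (x - real n *\<^sub>R e) * test_apply \<psi> x \<partial>lborel) \<longlonglongrightarrow> (\<integral>x. 0 \<partial>(lborel :: plane measure))"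
  proof (rule integral_dominated_convergence[OF _ meas, where w = "\<lambda>x. norm g * \<bar>test_apply \<psi> x\<bar>"])
    show "integrable lborel (\<lambda>x. norm g * \<bar>test_apply \<psi> x\<bar>)"
      by (intro integrable_mult_right integrable_abs integrable_test)
    show "AE x in lborel. (\<lambda>n. apply_bcontfun g (x - real n *\<^sub>R e) * test_apply \<psi> x) \<longlonglongrightarrow> 0"
    proof (rule AE_I2)
      fix x
      have "filterlim (\<lambda>n. x - real n *\<^sub>R e) at_infinity sequentially"
        unfolding filterlim_at_infinity[OF order_refl]
      proof (intro allI impI)
        fix r :: real
        obtain N where N: "r + norm x < real N" using reals_Archimedean2 by blast
        have "r \<le> norm (x - real n *\<^sub>R e)" if "n \<ge> N" for n
        proof -
          have "norm (real n *\<^sub>R e) \<le> norm (x - real n *\<^sub>R e) + norm x"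
            using norm_triangle_ineq4[of x "x - real n *\<^sub>R e"] by (simp add: add.commute)
          then show ?thesis using e N that by simp
        qed
        then show "\<forall>\<^sub>F n in sequentially. r \<le> norm (x - real n *\<^sub>R e)"
          unfolding eventually_sequentially by blast
      qed
      from filterlim_compose[OF _ this, of "apply_bcontfun g" "nhds 0"]
      have "(\<lambda>n. apply_bcontfun g (x - real n *\<^sub>R e)) \<longlonglongrightarrow> 0"
        using g by (simp add: C0_def)
      from tendsto_mult_left_zero[OF this]
      show "(\<lambda>n. apply_bcontfun g (x - real n *\<^sub>R e) * test_apply \<psi> x) \<longlonglongrightarrow> 0" .
    qed
    show "AE x in lborel. norm (apply_bcontfun g (x - real n *\<^sub>R e) * test_apply \<psi> x) \<le> norm g * \<bar>test_apply \<psi> x\<bar>" for n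
    proof (rule AE_I2)
      have "\<bar>apply_bcontfun g y\<bar> \<le> norm g" for y using norm_bounded[of g y] by simp
      then show "norm (apply_bcontfun g (x - real n *\<^sub>R e) * test_apply \<psi> x) \<le> norm g * \<bar>test_apply \<psi> x\<bar>" for x
        by (simp add: abs_mult mult_right_mono)
    qed
  qed simp
  then show ?thesis by (simp add: eq)
qed

text \<open>Near a point where \<open>g\<close> is nonzero it keeps its sign on a box, and a bump on
  that box detects it.\<close>

lemma distr_of_eq_0D:
  assumes "distr_of g = 0"
  shows "g = 0"
proof (rule ccontr)
  assume "g \<noteq> 0"
  then obtain z where z: "apply_bcontfun g z \<noteq> 0" by (metis bcontfun_eqI zero_bcontfun.rep_eq)
  \<comment> \<open>Multiplying by the value at \<open>z\<close> treats both signs of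
    \<open>g\<close> at once.\<close>
  define c where "c = apply_bcontfun g z"
  have "open {x. 0 < c * apply_bcontfun g x}"
    by (intro open_Collect_less continuous_intros continuous_on_apply_bcontfun)
  moreover have "z \<in> {x. 0 < c * apply_bcontfun g x}" using z by (metis c_def mem_Collect_eq not_real_square_gt_zero)
  ultimately obtain p q where pq: "z \<in> box p q" "box p q \<subseteq> {x. 0 < c * apply_bcontfun g x}"
    by (meson open_contains_box)
  let ?h = "\<lambda>x. c * (apply_bcontfun g x * box_bump 0 p q x)"
  have int: "integrable lborel ?h"
    using integrable_bcontfun_test[of g "box_test 0 p q"] by (simp add: box_test.rep_eq)
  have nonneg: "0 \<le> ?h x" for x
    using pq(2) box_bump_nonneg[of 0 p q x] box_bump_eq_0[of x p q 0]
    by (cases "x \<in> box p q") (auto simp: mult.assoc[symmetric])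
  have "(\<integral>x. ?h x \<partial>lborel) = c * dist_apply (distr_of g) (box_test 0 p q)"
    by (simp add: dist_apply_distr_of box_test.rep_eq)
  also have "\<dots> = 0" by (simp add: assms zero_distribution.rep_eq)
  finally have ae: "AE x in lborel. ?h x = 0"
    using integral_nonneg_eq_0_iff_AE[OF int] nonneg by simp
  have ne: "?h x \<noteq> 0" if "x \<in> box p q" for x
    using that pq(2) box_bump_pos_iff[of 0 p q x] by (auto simp: zero_less_mult_iff)
  from ae have "AE x in lborel. x \<notin> box p q" by (rule eventually_mono) (use ne in blast)
  then have "emeasure lborel (box p q) = 0"
    by (subst (asm) AE_iff_measurable[of "box p q"]) auto
  moreover have "0 < measure lborel (box p q)"
    using pq(1) by (subst measure_lborel_box) (auto simp: mem_box box_ne_empty inner_diff_left intro!: prod_pos less_imp_le dest: less_trans)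
  ultimately show False by (simp add: measure_def)
qed

lemma distr_of_diff: "distr_of (g - h) = distr_of g - distr_of h"
  by (rule distribution_eqI)
    (simp add: dist_apply_minus dist_apply_distr_of minus_bcontfun.rep_eq algebra_simps
      integrable_bcontfun_test Bochner_Integration.integral_diff)

text \<open>A distribution annihilated by the derivative along \<open>e\<close> is invariant under
  translation along \<open>e\<close>, while its values on translates tend to 0. This applies to the
  second partial derivative in direction \<open>(1, 0)\<close>, then to \<open>g\<close> itself in
  direction \<open>(0, 1)\<close>.\<close>

lemma DD_distr_of_eq_0D:
  assumes g: "g \<in> C0" and "DD (distr_of g) = 0"
  shows "g = 0"
proof -
  have 1: "(1, 0) \<in> (Basis :: plane set)" and 2: "(0, 1) \<in> (Basis :: plane set)" by (auto simp: Basis_plane)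
  have inv: "dist_apply u \<psi> = 0"
    if "e \<in> Basis" "distr_pd e u = 0" "(\<lambda>n. dist_apply u (test_shift (real n) e \<psi>)) \<longlonglongrightarrow> 0" for e u \<psi>
    using that by (simp add: dist_apply_shift zero_distribution.rep_eq LIMSEQ_const_iff)
  have "distr_pd (0, 1) (distr_of g) = 0"
  proof (rule distribution_eqI)
    fix \<psi>
    have "dist_apply (distr_pd (0, 1) (distr_of g)) \<psi> = 0"
    proof (rule inv[OF 1])
      show "distr_pd (1, 0) (distr_pd (0, 1) (distr_of g)) = 0" using assms(2) by (simp add: DD_eq)
      show "(\<lambda>n. dist_apply (distr_pd (0, 1) (distr_of g)) (test_shift (real n) (1, 0) \<psi>)) \<longlonglongrightarrow> 0"
        using tendsto_minus[OF tendsto_dist_apply_shift[OF g 1]]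
        by (simp add: dist_apply_distr_pd test_pd_shift[OF 1 2])
    qed
    then show "dist_apply (distr_pd (0, 1) (distr_of g)) \<psi> = dist_apply 0 \<psi>"
      by (simp add: zero_distribution.rep_eq)
  qed
  then have "dist_apply (distr_of g) \<psi> = 0" for \<psi>
    by (rule inv[OF 2]) (rule tendsto_dist_apply_shift[OF g 2])
  then have "distr_of g = 0" by (intro distribution_eqI) (simp add: zero_distribution.rep_eq)
  then show ?thesis by (rule distr_of_eq_0D)
qed

section \<open>Measures with vanishing marginals\<close>

text \<open>Keeps the remaining coordinate inside a point of the plane, so that functions of one
  variable are written with test functions on the plane and both directions share one type.\<close>

definition proj :: "plane \<Rightarrow> plane \<Rightarrow> plane" where
  "proj e z = z - (z \<bullet> e) *\<^sub>R e"

text \<open>Says that the image of \<open>\<mu>\<close> under \<open>proj e\<close> is 0. Borel test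
  functions are chosen because \<open>marginal_zero_sweep\<close> inserts a function
  \<open>sweep_fun e g\<close>, known only to be bounded and Borel.\<close>

definition marginal_zero :: "plane \<Rightarrow> (plane set \<Rightarrow> real) \<Rightarrow> bool" where
  "marginal_zero e \<mu> \<longleftrightarrow> (\<forall>g. bounded_borel g \<longrightarrow> signed_integral \<mu> (\<lambda>z. g (proj e z)) = 0)"

lemma measurable_proj [measurable]: "proj e \<in> borel_measurable borel"
proof -
  have "continuous_on UNIV (proj e)" unfolding proj_def by (intro continuous_intros)
  then show ?thesis by (rule borel_measurable_continuous_onI)
qed

lemma bounded_borel_compose:
  "bounded_borel g \<Longrightarrow> h \<in> borel_measurable borel \<Longrightarrow> bounded_borel (\<lambda>z. g (h z))"
  unfolding bounded_borel_def using measurable_compose[of h borel borel g borel] by blast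

lemma bounded_borel_box_bump: "bounded_borel (box_bump n p q)"
  using bounded_borel_test[of "box_test n p q"] by (simp add: box_test.rep_eq)

text \<open>The images of the two Jordan parts under \<open>proj e\<close> are finite measures, and
  box bumps tell finite measures apart. Thus smooth functions decide a condition stated for Borel
  ones.\<close>

lemma marginal_zeroI:
  assumes sm: "signed_measure \<mu>" and eq: "\<And>n p q. signed_integral \<mu> (\<lambda>z. box_bump n p q (proj e z)) = 0"
  shows "marginal_zero e \<mu>"
proof -
  let ?P = "distr (positive_part \<mu>) borel (proj e)" and ?N = "distr (negative_part \<mu>) borel (proj e)"
  note sm' = signed_measure_uminus[OF sm]
  have meas: "proj e \<in> measurable (positive_part \<mu>) borel" "proj e \<in> measurable (negative_part \<mu>) borel"
    by (simp_all add: measurable_cong_sets[OF sets_positive_part[OF sm] refl]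
        measurable_cong_sets[OF sets_positive_part[OF sm'] refl])
  have int: "signed_integral \<mu> (\<lambda>z. g (proj e z)) = (\<integral>x. g x \<partial>?P) - (\<integral>x. g x \<partial>?N)" if "bounded_borel g" for g
    using that meas unfolding signed_integral_def bounded_borel_def by (simp add: integral_distr)
  have "?P = ?N"
  proof (rule measure_eqI_box_bump)
    show "finite_measure ?P" "finite_measure ?N"
      using meas finite_measure_positive_part[OF sm] finite_measure_positive_part[OF sm']
      by (auto intro: finite_measure.finite_measure_distr)
    show "(\<integral>x. box_bump n p q x \<partial>?P) = (\<integral>x. box_bump n p q x \<partial>?N)" for n p q
      using eq[of n p q] int[OF bounded_borel_box_bump] by simp
  qed auto
  then show ?thesis unfolding marginal_zero_def by (simp add: int)
qed

lemma continuous_edge: "continuous_on S (edge n l r)"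
proof -
  have "continuous_on T (flat P)" for T P
    using flat_has_derivative by (meson DERIV_isCont continuous_at_imp_continuous_on)
  then have "continuous_on S (\<lambda>x. flat P (c * (x - d)))" "continuous_on S (\<lambda>x. flat P (c * (d - x)))" for P c d
    by (rule continuous_on_compose2, auto intro!: continuous_intros)+
  then show ?thesis unfolding edge_def by (intro continuous_on_mult)
qed

text \<open>For \<open>x\<close> in the unit interval the window from \<open>x\<close> to
  \<open>x + 2\<close> contains the whole bump, so the integral is independent of \<open>x\<close>.
  The length 2 is that of the shift in \<open>marginal_zero_of_pd\<close>.\<close>

lemma edge_integral:
  assumes "x \<in> {0..1}"
  shows "integral {0..2} (\<lambda>s. edge n (5/4) (7/4) (x + s)) = integral {5/4..7/4} (edge n (5/4) (7/4))"
proof -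
  have "(edge n (5/4) (7/4) has_integral integral {5/4..7/4} (edge n (5/4) (7/4))) {5/4..7/4}"
    by (intro integrable_integral integrable_continuous_interval continuous_edge)
  then have "(edge n (5/4) (7/4) has_integral integral {5/4..7/4} (edge n (5/4) (7/4))) {x..x + 2}"
    by (rule has_integral_on_superset) (use assms in \<open>auto intro: edge_eq_0\<close>)
  then have "((\<lambda>s. edge n (5/4) (7/4) (s + x)) has_integral integral {5/4..7/4} (edge n (5/4) (7/4))) {0..2}"
    using has_integral_shift_Icc_real[of "edge n (5/4) (7/4)" x _ 0 2] by (simp add: comp_def add.commute)
  then show ?thesis by (simp add: add.commute integral_unique)
qed

lemma edge_integral_pos: "0 < integral {5/4..7/4} (edge n (5/4) (7/4))"
proof -
  have "0 \<le> integral {5/4..7/4} (edge n (5/4) (7/4))"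
    by (intro integral_nonneg integrable_continuous_interval continuous_edge) simp
  moreover have "integral {5/4..7/4} (edge n (5/4) (7/4)) \<noteq> 0"
    using edge_pos_iff[of n "5/4" "7/4" "3/2"]
    by (subst integral_eq_0_iff[OF continuous_edge]) (auto intro!: bexI[of _ "3/2"])
  ultimately show ?thesis by simp
qed

text \<open>The interval \<open>(5/4, 7/4)\<close> places a bump strictly beyond one side of the square, so that its
  translate by \<open>-2 e\<close> lies strictly beyond the opposite side.\<close>

lemma box_bump_split:
  assumes "e \<in> Basis"
  shows "\<exists>p' q' k G. bounded_borel G \<and> (\<forall>z. box_bump n p q (proj e z) = k * G z) \<and>
    (\<forall>z s. box_bump n p' q' (z + s *\<^sub>R e) = edge n (5/4) (7/4) (z \<bullet> e + s) * G z)"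
proof -
  have bb: "bounded_borel (\<lambda>z. edge n l r (z \<bullet> b))" for l r and b :: plane
  proof -
    have "continuous_on UNIV (\<lambda>z. edge n l r (z \<bullet> b))"
      by (rule continuous_on_compose2[OF continuous_edge[of UNIV]]) (auto intro!: continuous_intros)
    then show ?thesis
      unfolding bounded_borel_def using edge_le_1[of n l r]
      by (auto intro!: borel_measurable_continuous_onI exI[of _ 1])
  qed
  from assms consider "e = (1, 0)" | "e = (0, 1)" by (auto simp: Basis_plane)
  then show ?thesis
  proof cases
    case 1
    \<comment> \<open>The point \<open>proj e z\<close> has coordinate 0 along \<open>e\<close>, so
      the factor in this direction freezes to the constant \<open>k\<close>; replacing that factor
      by the bump beyond the square gives \<open>p'\<close> and \<open>q'\<close>.\<close>
    show ?thesis
      by (rule exI[of _ "(5/4, snd p)"], rule exI[of _ "(7/4, snd q)"],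
          rule exI[of _ "edge n (fst p) (fst q) 0"], rule exI[of _ "\<lambda>z. edge n (snd p) (snd q) (snd z)"])
        (use 1 bb[of "snd p" "snd q" "(0, 1)"] in \<open>auto simp: box_bump_def proj_def inner_prod_def\<close>)
  next
    case 2
    show ?thesis
      by (rule exI[of _ "(fst p, 5/4)"], rule exI[of _ "(fst q, 7/4)"],
          rule exI[of _ "edge n (snd p) (snd q) 0"], rule exI[of _ "\<lambda>z. edge n (fst p) (fst q) (fst z)"])
        (use 2 bb[of "fst p" "fst q" "(1, 0)"] in \<open>auto simp: box_bump_def proj_def inner_prod_def\<close>)
  qed
qed

text \<open>A bump beyond one side of the square and its translate beyond the opposite side are both
  annihilated by \<open>u\<close>, so the derivative annihilates the segment integral joining them.
  On the square that integral is a positive constant times a function of the other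
  coordinate.\<close>

lemma marginal_zero_of_pd:
  assumes e: "e \<in> Basis" and sm: "signed_measure \<mu>" and van: "vanishes_off unit_square \<mu>"
    and pd: "distr_pd e u = measure_distr \<mu>" and u: "vanishes_outside_square u"
  shows "marginal_zero e \<mu>"
proof (rule marginal_zeroI[OF sm])
  fix n p q
  obtain p' q' k G where G: "bounded_borel G" "\<And>z. box_bump n p q (proj e z) = k * G z"
    "\<And>z s. box_bump n p' q' (z + s *\<^sub>R e) = edge n (5/4) (7/4) (z \<bullet> e + s) * G z"
    using box_bump_split[OF e] by metis
  let ?\<phi> = "box_test n p' q'" and ?c = "integral {5/4..7/4} (edge n (5/4) (7/4))"
  have supp: "5/4 < z \<bullet> e \<and> z \<bullet> e < 7/4" if "test_apply ?\<phi> z \<noteq> 0" for z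
    using that G(3)[of z 0] edge_eq_0[of "5/4" "z \<bullet> e" "7/4" n] by (auto simp: box_test.rep_eq)
  have "dist_apply u ?\<phi> = 0"
    using e supp by (intro dist_apply_eq_0I[OF u closed_halfplane(2)[of "5/4" e]])
      (force simp: mem_unit_square_Basis)+
  moreover have "dist_apply u (test_shift 2 e ?\<phi>) = 0"
  \<comment> \<open>The bump ends at \<open>7/4\<close>, and \<open>7/4 - 2 = -1/4\<close>.\<close>
  proof (rule dist_apply_eq_0I[OF u closed_halfplane(1)[of e "-1/4"]])
    show "{z. z \<bullet> e \<le> - 1 / 4} \<inter> unit_square = {}" using e by (force simp: mem_unit_square_Basis)
    show "z \<in> {z. z \<bullet> e \<le> - 1 / 4}" if "test_apply (test_shift 2 e ?\<phi>) z \<noteq> 0" for z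
      using that supp[of "z + 2 *\<^sub>R e"] e by (auto simp: test_apply_shift inner_add_left)
  qed
  ultimately have "signed_integral \<mu> (test_apply (test_segment 2 e ?\<phi>)) = 0"
    using dist_apply_shift[of u 2 e ?\<phi>] by (simp add: pd dist_apply_measure_distr[OF sm])
  moreover have "signed_integral \<mu> (test_apply (test_segment 2 e ?\<phi>)) = signed_integral \<mu> (\<lambda>z. ?c * G z)"
  proof (rule signed_integral_cong_on[OF sm van])
    fix z assume "z \<in> unit_square"
    then have "z \<bullet> e \<in> {0..1}" using e by (auto simp: mem_unit_square_Basis)
    then show "test_apply (test_segment 2 e ?\<phi>) z = ?c * G z"
      by (simp add: test_segment.rep_eq segment_integral_def box_test.rep_eq G(3) edge_integral)
  qed (use bounded_borel_test bounded_borel_scale[OF G(1)] in \<open>auto simp: bounded_borel_def unit_square_def borel_Times\<close>)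
  ultimately have "signed_integral \<mu> G = 0"
    using edge_integral_pos[of n] by (simp add: signed_integral_scale)
  then show "signed_integral \<mu> (\<lambda>z. box_bump n p q (proj e z)) = 0"
    by (simp add: G(2) signed_integral_scale)
qed

text \<open>A measure \<open>\<nu>\<close> on the square with \<open>\<partial>\<^sub>e \<nu> = \<mu>\<close>: every point mass of \<open>\<mu>\<close> is spread over
  the segment joining the point to the far side of the square. The error committed on that side
  is a function of the marginal of \<open>\<mu>\<close>.\<close>

definition unit_uniform :: "real measure" where
  "unit_uniform = density lborel (indicator {0..1})"

definition toward :: "plane \<Rightarrow> plane \<times> real \<Rightarrow> plane" where
  "toward e = (\<lambda>(z, s). z + (s * (1 - z \<bullet> e)) *\<^sub>R e)"

text \<open>For points of the square this is the length of the segment to the far side, the factor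
  by which the uniform distribution on it has to be multiplied. Clamping it to the unit interval
  elsewhere keeps the swept measure finite and no larger than the original.\<close>

definition sweep_weight :: "plane \<Rightarrow> plane \<Rightarrow> real" where
  "sweep_weight e z = max 0 (min 1 (1 - z \<bullet> e))"

text \<open>The adjoint of \<open>sweep\<close> on functions; at a point of the square, the integral
  of \<open>g\<close> along the segment to the far side.\<close>

definition sweep_fun :: "plane \<Rightarrow> (plane \<Rightarrow> real) \<Rightarrow> plane \<Rightarrow> real" where
  "sweep_fun e g z = sweep_weight e z * (\<integral>s. g (toward e (z, s)) \<partial>unit_uniform)"

definition sweep :: "plane \<Rightarrow> plane measure \<Rightarrow> plane measure" where
  "sweep e M = distr (density M (\<lambda>z. ennreal (sweep_weight e z)) \<Otimes>\<^sub>M unit_uniform) borel (toward e)"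

text \<open>The swept Jordan parts may overlap, so they need not be the Jordan parts of the result;
  the total variation can therefore drop.\<close>

definition sweep_measure :: "plane \<Rightarrow> (plane set \<Rightarrow> real) \<Rightarrow> plane set \<Rightarrow> real" where
  "sweep_measure e \<mu> = measure_diff (sweep e (positive_part \<mu>)) (sweep e (negative_part \<mu>))"

lemma sets_unit_uniform [measurable_cong, simp]: "sets unit_uniform = sets borel"
  and space_unit_uniform [simp]: "space unit_uniform = UNIV"
  by (simp_all add: unit_uniform_def)

lemma emeasure_unit_uniform: "emeasure unit_uniform UNIV = 1"
  by (simp add: unit_uniform_def emeasure_density)

lemma finite_measure_unit_uniform: "finite_measure unit_uniform"
  by (rule finite_measureI) (simp add: emeasure_unit_uniform)

lemma measure_unit_uniform [simp]: "measure unit_uniform UNIV = 1"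
  by (simp add: measure_def emeasure_unit_uniform)

lemma integral_unit_uniform:
  "g \<in> borel_measurable borel \<Longrightarrow> (\<integral>s. g s \<partial>unit_uniform) = (\<integral>s. indicator {0..1} s *\<^sub>R g s \<partial>lborel)" for g :: "real \<Rightarrow> real"
  unfolding unit_uniform_def
  using integral_density[of g lborel "indicator {0..1}"] by (simp add: ennreal_indicator)

lemma measurable_toward [measurable]: "toward e \<in> borel_measurable (borel \<Otimes>\<^sub>M borel)"
proof -
  have "continuous_on UNIV (toward e)"
    unfolding toward_def case_prod_beta by (intro continuous_intros)
  then show ?thesis unfolding borel_prod by (rule borel_measurable_continuous_onI)
qed

lemma measurable_sweep_weight [measurable]: "sweep_weight e \<in> borel_measurable borel"
  unfolding sweep_weight_def by measurable

lemma sweep_weight_bounds [simp]: "0 \<le> sweep_weight e z" "sweep_weight e z \<le> 1"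
  unfolding sweep_weight_def by auto

lemma abs_integral_unit_uniform_le:
  fixes g :: "real \<Rightarrow> real"
  assumes "g \<in> borel_measurable borel" "\<And>s. \<bar>g s\<bar> \<le> c"
  shows "\<bar>\<integral>s. g s \<partial>unit_uniform\<bar> \<le> c"
proof -
  interpret finite_measure unit_uniform by (rule finite_measure_unit_uniform)
  have int: "integrable unit_uniform g"
    using assms by (intro integrable_const_bound[of _ c]) auto
  have "\<bar>\<integral>s. g s \<partial>unit_uniform\<bar> \<le> (\<integral>s. \<bar>g s\<bar> \<partial>unit_uniform)"
    using integral_norm_bound[of unit_uniform g] by simp
  also have "\<dots> \<le> (\<integral>s. c \<partial>unit_uniform)"
    using int assms(2) by (intro integral_mono) auto
  finally show ?thesis by simp
qed

lemma bounded_borel_sweep_fun: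
  assumes g: "bounded_borel g"
  shows "bounded_borel (sweep_fun e g)"
proof -
  obtain c where c: "\<And>x. \<bar>g x\<bar> \<le> c" using g by (auto simp: bounded_borel_def)
  have [measurable]: "g \<in> borel_measurable borel" using g by (simp add: bounded_borel_def)
  interpret finite_measure unit_uniform by (rule finite_measure_unit_uniform)
  have "sweep_fun e g \<in> borel_measurable borel"
    unfolding sweep_fun_def by measurable
  moreover have "\<bar>sweep_fun e g z\<bar> \<le> c" for z
  proof -
    have "\<bar>\<integral>s. g (toward e (z, s)) \<partial>unit_uniform\<bar> \<le> c"
      by (rule abs_integral_unit_uniform_le) (auto simp: c)
    then have "sweep_weight e z * \<bar>\<integral>s. g (toward e (z, s)) \<partial>unit_uniform\<bar> \<le> 1 * c"
      by (intro mult_mono) auto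
    then show ?thesis by (simp add: sweep_fun_def abs_mult)
  qed
  ultimately show ?thesis unfolding bounded_borel_def by blast
qed

lemma sets_sweep [simp]: "sets (sweep e M) = sets borel"
  by (simp add: sweep_def)

context
  fixes M :: "plane measure"
  assumes M: "finite_measure M" "sets M = sets borel"
begin

lemma finite_measure_weighted: "finite_measure (density M (\<lambda>z. ennreal (sweep_weight e z)))"
proof (rule finite_measureI)
  have [measurable_cong]: "sets M = sets borel" by (rule M)
  have le: "ennreal (sweep_weight e z) \<le> 1" for z
    using ennreal_leI[OF sweep_weight_bounds(2)[of e z]] by simp
  have "emeasure (density M (\<lambda>z. ennreal (sweep_weight e z))) (space M) =
      (\<integral>\<^sup>+z. ennreal (sweep_weight e z) * indicator (space M) z \<partial>M)"
    by (rule emeasure_density) measurable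
  also have "\<dots> \<le> (\<integral>\<^sup>+z. indicator (space M) z \<partial>M)"
    using le by (intro nn_integral_mono) (simp add: indicator_def)
  also have "\<dots> = emeasure M (space M)" by simp
  also have "\<dots> < \<infinity>" using finite_measure.emeasure_finite[OF M(1)] by (simp add: less_top)
  finally show "emeasure (density M (\<lambda>z. ennreal (sweep_weight e z))) (space (density M (\<lambda>z. ennreal (sweep_weight e z)))) \<noteq> \<infinity>"
    by simp
qed

lemma finite_measure_sweep: "finite_measure (sweep e M)"
proof -
  have [measurable_cong]: "sets M = sets borel" by (rule M)
  interpret U: finite_measure unit_uniform by (rule finite_measure_unit_uniform)
  have "finite_measure (density M (\<lambda>z. ennreal (sweep_weight e z)) \<Otimes>\<^sub>M unit_uniform)"
    by (intro finite_measure_pair_measure finite_measure_weighted U.finite_measure_axioms)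
  then show ?thesis
    unfolding sweep_def by (rule finite_measure.finite_measure_distr) measurable
qed

lemma integral_sweep:
  assumes g: "bounded_borel g"
  shows "(\<integral>x. g x \<partial>sweep e M) = (\<integral>z. sweep_fun e g z \<partial>M)"
proof -
  have [measurable_cong]: "sets M = sets borel" by (rule M)
  have [measurable]: "g \<in> borel_measurable borel" using g by (simp add: bounded_borel_def)
  obtain c where c: "\<And>x. \<bar>g x\<bar> \<le> c" using g by (auto simp: bounded_borel_def)
  let ?W = "density M (\<lambda>z. ennreal (sweep_weight e z))"
  interpret U: finite_measure unit_uniform by (rule finite_measure_unit_uniform)
  interpret W: finite_measure ?W by (rule finite_measure_weighted)
  interpret pair_sigma_finite ?W unit_uniform ..
  interpret WU: finite_measure "?W \<Otimes>\<^sub>M unit_uniform"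
    by (intro finite_measure_pair_measure W.finite_measure_axioms U.finite_measure_axioms)
  have int: "integrable (?W \<Otimes>\<^sub>M unit_uniform) (\<lambda>x. g (toward e x))"
    by (rule WU.integrable_const_bound[of _ c]) (auto simp: c)
  have "(\<integral>x. g x \<partial>sweep e M) = (\<integral>x. g (toward e x) \<partial>(?W \<Otimes>\<^sub>M unit_uniform))"
    unfolding sweep_def by (rule integral_distr) measurable
  also have "\<dots> = (\<integral>z. \<integral>s. g (toward e (z, s)) \<partial>unit_uniform \<partial>?W)"
    by (rule integral_fst'[OF int, symmetric])
  also have "\<dots> = (\<integral>z. sweep_fun e g z \<partial>M)"
    unfolding sweep_fun_def by (subst integral_density) auto
  finally show ?thesis .
qed

lemma measure_sweep_le: "measure (sweep e M) UNIV \<le> measure M UNIV"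
proof -
  have [measurable_cong]: "sets M = sets borel" by (rule M)
  interpret M: finite_measure M by (rule M)
  have "measure (sweep e M) UNIV = (\<integral>x. 1 \<partial>sweep e M)"
    using sets_eq_imp_space_eq[OF sets_sweep] by simp
  also have "\<dots> = (\<integral>z. sweep_fun e (\<lambda>_. 1) z \<partial>M)" by (rule integral_sweep) simp
  also have "\<dots> \<le> (\<integral>z. 1 \<partial>M)"
    by (intro integral_mono integrable_bounded_borel[OF M] bounded_borel_sweep_fun)
      (auto simp: sweep_fun_def)
  finally show ?thesis using sets_eq_imp_space_eq[OF M(2)] by simp
qed

end

lemma signed_integral_indicator:
  "signed_measure \<mu> \<Longrightarrow> A \<in> sets borel \<Longrightarrow> signed_integral \<mu> (indicator A) = \<mu> A"
  using jordan_decomposition[of \<mu> A] signed_measure_uminus[of \<mu>] unfolding signed_integral_def by simp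

lemma bounded_borel_indicator: "A \<in> sets borel \<Longrightarrow> bounded_borel (indicator A)"
  unfolding bounded_borel_def by (auto simp: indicator_def intro!: exI[of _ 1])

lemma sets_unit_square [simp, measurable]: "unit_square \<in> sets borel"
  unfolding unit_square_def by (intro borel_closed closed_Times) auto

context
  fixes \<mu> :: "plane set \<Rightarrow> real" and e :: plane
  assumes sm: "signed_measure \<mu>" and e: "e \<in> Basis"
begin

lemma signed_measure_sweep: "signed_measure (sweep_measure e \<mu>)"
  unfolding sweep_measure_def using sm signed_measure_uminus[OF sm]
  by (intro signed_measure_measure_diff finite_measure_sweep sets_sweep finite_measure_positive_part sets_positive_part)

lemma signed_integral_sweep:
  assumes "bounded_borel g"
  shows "signed_integral (sweep_measure e \<mu>) g = signed_integral \<mu> (sweep_fun e g)"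
proof -
  note sm' = signed_measure_uminus[OF sm]
  note fin = finite_measure_positive_part[OF sm] finite_measure_positive_part[OF sm']
    and sets = sets_positive_part[OF sm] sets_positive_part[OF sm']
  have "signed_integral (sweep_measure e \<mu>) g =
      (\<integral>x. g x \<partial>sweep e (positive_part \<mu>)) - (\<integral>x. g x \<partial>sweep e (negative_part \<mu>))"
    using fin sets assms
    by (intro signed_integral_eq signed_measure_sweep finite_measure_sweep sets_sweep)
      (auto simp: sweep_measure_def measure_diff_def)
  then show ?thesis
    unfolding signed_integral_def integral_sweep[OF fin(1) sets(1) assms] integral_sweep[OF fin(2) sets(2) assms] .
qed

lemma tv_sweep_le: "tv (sweep_measure e \<mu>) \<le> tv \<mu>"
proof -
  note sm' = signed_measure_uminus[OF sm]
  note fin = finite_measure_positive_part[OF sm] finite_measure_positive_part[OF sm']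
    and sets = sets_positive_part[OF sm] sets_positive_part[OF sm']
  have "tv (sweep_measure e \<mu>) \<le> measure (sweep e (positive_part \<mu>)) UNIV + measure (sweep e (negative_part \<mu>)) UNIV"
    using fin sets by (intro tv_le_measures finite_measure_sweep sets_sweep) (auto simp: sweep_measure_def measure_diff_def)
  also have "\<dots> \<le> tv \<mu>"
    unfolding tv_eq[OF sm] using fin sets by (intro add_mono measure_sweep_le)
  finally show ?thesis .
qed

lemma toward_unit_square: "z \<in> unit_square \<Longrightarrow> s \<in> {0..1} \<Longrightarrow> toward e (z, s) \<in> unit_square"
proof -
  assume z: "z \<in> unit_square" and s: "s \<in> {0..1}"
  have "x + s * (1 - x) \<ge> 0 \<and> x + s * (1 - x) \<le> 1" if "0 \<le> x" "x \<le> 1" for x :: real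
  proof -
    have "0 \<le> s * (1 - x)" using that s by simp
    moreover have "s * (1 - x) \<le> 1 * (1 - x)" by (rule mult_right_mono) (use that s in auto)
    ultimately show ?thesis using that by simp
  qed
  note * = this
  from e consider "e = (1, 0)" | "e = (0, 1)" by (auto simp: Basis_plane)
  then show ?thesis
  proof cases
    case 1
    then have "toward e (z, s) = (fst z + s * (1 - fst z), snd z)"
      by (simp add: toward_def inner_prod_def prod_eq_iff)
    then show ?thesis using z *[of "fst z"] by (simp add: mem_unit_square)
  next
    case 2
    then have "toward e (z, s) = (fst z, snd z + s * (1 - snd z))"
      by (simp add: toward_def inner_prod_def prod_eq_iff)
    then show ?thesis using z *[of "snd z"] by (simp add: mem_unit_square)
  qed
qed

lemma measurable_toward2: "(\<lambda>s. toward e (z, s)) \<in> borel_measurable borel"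
  by measurable

text \<open>Segments that start in the square stay in it, so for a set off the square the adjoint of
  its indicator vanishes on the square.\<close>

lemma vanishes_off_sweep:
  assumes van: "vanishes_off unit_square \<mu>"
  shows "vanishes_off unit_square (sweep_measure e \<mu>)"
  unfolding vanishes_off_def
proof (intro ballI impI)
  fix A :: "plane set" assume A: "A \<in> sets borel" "A \<inter> unit_square = {}"
  have "sweep_measure e \<mu> A = signed_integral \<mu> (sweep_fun e (indicator A))"
    using A(1) by (simp add: signed_integral_sweep[symmetric] bounded_borel_indicator
        signed_integral_indicator signed_measure_sweep)
  also have "\<dots> = signed_integral \<mu> (\<lambda>_. 0)"
  proof (rule signed_integral_cong_on[OF sm van sets_unit_square])
    show "sweep_fun e (indicator A) \<in> borel_measurable borel"
      using bounded_borel_sweep_fun[OF bounded_borel_indicator[OF A(1)]] by (simp add: bounded_borel_def)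
    fix z assume z: "z \<in> unit_square"
    have "indicator {0..1} s *\<^sub>R (indicator A (toward e (z, s)) :: real) = 0" for s
      using toward_unit_square[OF z, of s] A(2) by (auto simp: indicator_def)
    moreover have "(\<lambda>s. indicator A (toward e (z, s)) :: real) \<in> borel_measurable borel"
      using A(1) by (intro measurable_compose[OF measurable_toward2]) simp
    ultimately have "(\<integral>s. indicator A (toward e (z, s)) \<partial>unit_uniform) = (0 :: real)"
      by (simp only: integral_unit_uniform) simp
    then show "sweep_fun e (indicator A) z = 0" by (simp add: sweep_fun_def)
  qed simp
  also have "\<dots> = 0" by (simp add: signed_integral_def)
  finally show "sweep_measure e \<mu> A = 0" .
qed

text \<open>Fundamental theorem of calculus on the segment: the weight is precisely the factor that
  the chain rule takes from the parametrisation by the unit interval. The far end point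
  \<open>proj e z + e\<close> depends on \<open>z\<close> only through the other coordinate.\<close>

lemma sweep_fun_pd:
  assumes z: "z \<in> unit_square"
  shows "sweep_fun e (pd e (test_apply \<phi>)) z = test_apply \<phi> (proj e z + e) - test_apply \<phi> z"
proof -
  let ?d = "1 - z \<bullet> e" and ?g = "test_apply \<phi>"
  have d: "sweep_weight e z = ?d" using z e by (auto simp: sweep_weight_def mem_unit_square_Basis)
  have cont: "continuous_on UNIV (\<lambda>s. pd e ?g (toward e (z, s)))"
    unfolding toward_def case_prod_conv
    by (rule continuous_on_compose2[OF smooth_continuous[OF smooth_pd[OF smooth_test e]]])
      (auto intro!: continuous_intros)
  have "(\<integral>s. indicator {0..1} s *\<^sub>R (?d * pd e ?g (toward e (z, s))) \<partial>lborel) =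
      ?g (toward e (z, 1)) - ?g (toward e (z, 0))"
  proof (rule integral_FTC_atLeastAtMost)
    fix s
    have "((\<lambda>s. toward e (z, s)) has_derivative (\<lambda>h. (h * ?d) *\<^sub>R e)) (at s)"
      unfolding toward_def by (auto intro!: derivative_eq_intros)
    from has_derivative_compose[OF this smooth_has_derivative[OF smooth_test]]
    have "((\<lambda>s. ?g (toward e (z, s))) has_derivative
        (\<lambda>h. frechet_derivative ?g (at (toward e (z, s))) ((h * ?d) *\<^sub>R e))) (at s)" .
    then have "((\<lambda>s. ?g (toward e (z, s))) has_vector_derivative ?d * pd e ?g (toward e (z, s))) (at s)"
      unfolding has_vector_derivative_def pd_def
      by (simp add: linear_scale[OF linear_frechet_derivative[OF smooth_differentiable[OF smooth_test]]] mult.assoc)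
    then show "((\<lambda>s. ?g (toward e (z, s))) has_vector_derivative ?d * pd e ?g (toward e (z, s))) (at s within {0..1})"
      by (rule has_vector_derivative_at_within)
  next
    show "continuous_on {0..1} (\<lambda>s. ?d * pd e ?g (toward e (z, s)))"
      using continuous_on_subset[OF cont, of "{0..1}"] by (intro continuous_intros) auto
  qed simp
  moreover have "(\<integral>s. indicator {0..1} s *\<^sub>R (?d * pd e ?g (toward e (z, s))) \<partial>lborel) =
      ?d * (\<integral>s. pd e ?g (toward e (z, s)) \<partial>unit_uniform)"
    using borel_measurable_continuous_onI[OF cont] by (subst integral_unit_uniform) (auto simp: mult.left_commute)
  ultimately show ?thesis
    unfolding sweep_fun_def d by (simp add: toward_def proj_def algebra_simps)
qed

lemma distr_pd_sweep:
  assumes van: "vanishes_off unit_square \<mu>" and marg: "marginal_zero e \<mu>"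
  shows "distr_pd e (measure_distr (sweep_measure e \<mu>)) = measure_distr \<mu>"
proof (rule distribution_eqI)
  fix \<phi>
  have bb: "bounded_borel (\<lambda>z. test_apply \<phi> (z + e))"
    by (rule bounded_borel_compose[OF bounded_borel_test]) simp
  have bp: "bounded_borel (\<lambda>z. test_apply \<phi> (proj e z + e))"
    using bounded_borel_compose[OF bb measurable_proj] .
  have b: "bounded_borel (pd e (test_apply \<phi>))"
    using bounded_borel_test[of "test_pd e \<phi>"] test_apply_test_pd[OF e] by simp
  have "dist_apply (distr_pd e (measure_distr (sweep_measure e \<mu>))) \<phi> = - signed_integral \<mu> (sweep_fun e (pd e (test_apply \<phi>)))"
    by (simp add: dist_apply_distr_pd dist_apply_measure_distr signed_measure_sweep test_apply_test_pd e signed_integral_sweep b)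
  also have "signed_integral \<mu> (sweep_fun e (pd e (test_apply \<phi>))) =
      signed_integral \<mu> (\<lambda>z. test_apply \<phi> (proj e z + e) - test_apply \<phi> z)"
    using bounded_borel_sweep_fun[OF b, of e] bp bounded_borel_test[of \<phi>]
    by (intro signed_integral_cong_on[OF sm van sets_unit_square] sweep_fun_pd)
      (auto simp: bounded_borel_def intro!: borel_measurable_diff)
  also have "\<dots> = signed_integral \<mu> (\<lambda>z. test_apply \<phi> (proj e z + e)) - signed_integral \<mu> (test_apply \<phi>)"
    by (rule signed_integral_diff[OF sm bp bounded_borel_test])
  also have "signed_integral \<mu> (\<lambda>z. test_apply \<phi> (proj e z + e)) = 0"
    using marg bb unfolding marginal_zero_def by blast
  finally show "dist_apply (distr_pd e (measure_distr (sweep_measure e \<mu>))) \<phi> = dist_apply (measure_distr \<mu>) \<phi>"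
    by (simp add: dist_apply_measure_distr sm)
qed

text \<open>Sweeping along \<open>e\<close> commutes with forgetting the coordinate along
  \<open>e'\<close>, so the adjoint maps functions of \<open>proj e' z\<close> to functions of the
  same kind.\<close>

lemma marginal_zero_sweep:
  assumes e': "e' \<in> Basis" "e' \<noteq> e" and marg: "marginal_zero e' \<mu>"
  shows "marginal_zero e' (sweep_measure e \<mu>)"
  unfolding marginal_zero_def
proof (intro allI impI)
  fix g assume g: "bounded_borel g"
  let ?h = "\<lambda>z. g (proj e' z)"
  have h: "bounded_borel ?h" using g measurable_proj by (rule bounded_borel_compose)
  have "sweep_fun e ?h z = sweep_fun e ?h (proj e' z)" for z
  proof -
    have "sweep_weight e (proj e' z) = sweep_weight e z" "proj e' (toward e (proj e' z, s)) = proj e' (toward e (z, s))" for s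
      using e e' by (auto simp: sweep_weight_def proj_def toward_def Basis_plane inner_prod_def prod_eq_iff)
    then show ?thesis by (simp add: sweep_fun_def)
  qed
  then have "signed_integral (sweep_measure e \<mu>) ?h = signed_integral \<mu> (\<lambda>z. sweep_fun e ?h (proj e' z))"
    using signed_integral_sweep[OF h] by presburger
  also have "\<dots> = 0"
    using marg bounded_borel_sweep_fun[OF h] unfolding marginal_zero_def by blast
  finally show "signed_integral (sweep_measure e \<mu>) ?h = 0" .
qed

end

section \<open>Elements of \<open>M_DD0\<close> and balanced measures\<close>

lemma vanishes_outside_square_measure_distr:
  assumes sm: "signed_measure \<mu>" and van: "vanishes_off unit_square \<mu>"
  shows "vanishes_outside_square (measure_distr \<mu>)"
  unfolding vanishes_outside_square_def
proof (intro allI impI)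
  fix \<phi> assume "support (test_apply \<phi>) \<subseteq> - unit_square"
  then have "test_apply \<phi> z = 0" if "z \<in> unit_square" for z
    using that eq_0_outside_support by blast
  then have "signed_integral \<mu> (test_apply \<phi>) = signed_integral \<mu> (\<lambda>_. 0)"
    using bounded_borel_test[of \<phi>]
    by (intro signed_integral_cong_on[OF sm van sets_unit_square]) (auto simp: bounded_borel_def)
  then show "dist_apply (measure_distr \<mu>) \<phi> = 0"
    by (simp add: dist_apply_measure_distr sm signed_integral_def)
qed

lemma M_DD0_iff:
  "f \<in> M_DD0 \<longleftrightarrow> vanishes_outside_square f \<and>
    (\<exists>\<mu>. signed_measure \<mu> \<and> vanishes_off unit_square \<mu> \<and> DD f = measure_distr \<mu>)"
  by (auto simp: M_DD0_def measures_on_def vanishes_outside_square_def vanishes_off_def represents_iff)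

text \<open>The signed measures on the square that are mixed derivatives of elements of \<^const>\<open>M_DD0\<close>.\<close>

definition balanced :: "(plane set \<Rightarrow> real) \<Rightarrow> bool" where
  "balanced \<mu> \<longleftrightarrow> signed_measure \<mu> \<and> vanishes_off unit_square \<mu> \<and> (\<forall>e\<in>Basis. marginal_zero e \<mu>)"

text \<open>Both \<open>D2 f\<close> and \<open>D1 f\<close> vanish outside the square and have
  \<open>DD f\<close> as a derivative, in direction \<open>(1, 0)\<close> and, after exchanging the
  derivatives, in direction \<open>(0, 1)\<close>. Each yields one marginal.\<close>

lemma M_DD0_balanced:
  assumes "f \<in> M_DD0"
  shows "\<exists>\<mu>. balanced \<mu> \<and> DD f = measure_distr \<mu>"
proof -
  from assms obtain \<mu> where f: "vanishes_outside_square f" and \<mu>: "signed_measure \<mu>" "vanishes_off unit_square \<mu>"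
    "DD f = measure_distr \<mu>" by (auto simp: M_DD0_iff)
  have b: "(1, 0) \<in> (Basis :: plane set)" "(0, 1) \<in> (Basis :: plane set)" by (auto simp: Basis_plane)
  have "marginal_zero (1, 0) \<mu>"
    using \<mu>(3) b by (intro marginal_zero_of_pd[OF b(1) \<mu>(1,2), of "distr_pd (0, 1) f"])
      (auto simp: DD_eq vanishes_outside_square_pd f)
  moreover have "marginal_zero (0, 1) \<mu>"
    using \<mu>(3) b by (intro marginal_zero_of_pd[OF b(2) \<mu>(1,2), of "distr_pd (1, 0) f"])
      (auto simp: DD_eq vanishes_outside_square_pd f distr_pd_commute[of "(0, 1)"])
  ultimately show ?thesis using \<mu> by (auto simp: balanced_def Basis_plane)
qed

text \<open>Sweeping along \<open>(1, 0)\<close> leaves the marginal along \<open>(0, 1)\<close>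
  zero, so the result may be swept once more. The element found is itself a finite measure.\<close>

lemma balanced_M_DD0:
  assumes "balanced \<mu>"
  shows "\<exists>f\<in>M_DD0. DD f = measure_distr \<mu>"
proof -
  let ?\<nu> = "sweep_measure (1, 0) \<mu>"
  let ?f = "measure_distr (sweep_measure (0, 1) ?\<nu>)"
  have b: "(1, 0) \<in> (Basis :: plane set)" "(0, 1) \<in> (Basis :: plane set)" by (auto simp: Basis_plane)
  have \<mu>: "signed_measure \<mu>" "vanishes_off unit_square \<mu>" "marginal_zero (1, 0) \<mu>" "marginal_zero (0, 1) \<mu>"
    using assms b unfolding balanced_def by blast+
  note \<nu> = signed_measure_sweep[OF \<mu>(1) b(1)] vanishes_off_sweep[OF \<mu>(1) b(1) \<mu>(2)]
    marginal_zero_sweep[OF \<mu>(1) b(1,2) _ \<mu>(4), simplified]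
  have "DD ?f = measure_distr \<mu>"
    unfolding DD_eq by (simp add: distr_pd_sweep \<nu> \<mu> b)
  moreover have "vanishes_outside_square ?f"
    by (intro vanishes_outside_square_measure_distr signed_measure_sweep vanishes_off_sweep \<nu> b)
  ultimately have "?f \<in> M_DD0" unfolding M_DD0_iff using \<mu>(1,2) by blast
  with \<open>DD ?f = measure_distr \<mu>\<close> show ?thesis by blast
qed

text \<open>Sweeping in one direction produces the derivative of \<open>f\<close> in the other: the
  two sides have the same derivative along the swept direction and vanish outside the square, so
  \<open>distr_pd_eq_0D\<close> identifies them.\<close>

lemma M_DD0_gradient:
  assumes f: "f \<in> M_DD0" and \<mu>: "balanced \<mu>" "DD f = measure_distr \<mu>"
  shows "D1 f = measure_distr (sweep_measure (0, 1) \<mu>)" "D2 f = measure_distr (sweep_measure (1, 0) \<mu>)"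
proof -
  have b: "(1, 0) \<in> (Basis :: plane set)" "(0, 1) \<in> (Basis :: plane set)" by (auto simp: Basis_plane)
  have van: "vanishes_outside_square f" using f by (simp add: M_DD0_iff)
  have sm: "signed_measure \<mu>" "vanishes_off unit_square \<mu>" and marg: "\<And>e. e \<in> Basis \<Longrightarrow> marginal_zero e \<mu>"
    using \<mu>(1) by (auto simp: balanced_def)
  have *: "distr_pd e' f = measure_distr (sweep_measure e \<mu>)"
    if e: "e \<in> Basis" and e': "e' \<in> Basis" and pd: "distr_pd e (distr_pd e' f) = measure_distr \<mu>" for e e'
  proof -
    let ?u = "distr_pd e' f - measure_distr (sweep_measure e \<mu>)"
    have "?u = 0"
    proof (rule distr_pd_eq_0D[OF e])
      show "distr_pd e ?u = 0" using e by (simp add: distr_pd_diff pd distr_pd_sweep sm marg)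
      show "vanishes_outside_square ?u"
        using e e' van sm
        by (intro vanishes_outside_square_diff vanishes_outside_square_pd vanishes_outside_square_measure_distr
            signed_measure_sweep vanishes_off_sweep)
    qed
    then show ?thesis by simp
  qed
  show "D2 f = measure_distr (sweep_measure (1, 0) \<mu>)"
    unfolding D2_eq using \<mu>(2) b by (intro *) (auto simp: DD_eq)
  show "D1 f = measure_distr (sweep_measure (0, 1) \<mu>)"
    unfolding D1_eq using \<mu>(2) b by (intro *) (auto simp: DD_eq distr_pd_commute[of "(0, 1)"])
qed

section \<open>The Banach space\<close>

lemma signed_measure_finite_UN:
  assumes sm: "signed_measure \<mu>" and A: "range A \<subseteq> sets borel" "disjoint_family A"
  shows "(\<Sum>i<n::nat. \<mu> (A i)) = \<mu> (\<Union>i<n. A i)"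
proof (induction n)
  case 0
  then show ?case by (simp add: signed_measure_empty[OF sm])
next
  case (Suc n)
  have "A i \<inter> A n = {}" if "i < n" for i
    using disjoint_family_onD[OF A(2), of i n] that by simp
  then have "(\<Union>i<n. A i) \<inter> A n = {}" by blast
  moreover have "(\<Union>i<n. A i) \<in> sets borel" "A n \<in> sets borel" using A(1) by auto
  ultimately have "\<mu> ((\<Union>i<n. A i) \<union> A n) = \<mu> (\<Union>i<n. A i) + \<mu> (A n)"
    by (intro signed_measure_Un[OF sm])
  moreover have "(\<Union>i<n. A i) \<union> A n = (\<Union>i<Suc n. A i)" by (auto simp: less_Suc_eq)
  ultimately show ?case using Suc by simp
qed

lemma signed_measure_diff:
  "signed_measure \<mu> \<Longrightarrow> signed_measure \<nu> \<Longrightarrow> signed_measure (\<lambda>A. \<mu> A - \<nu> A)"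
  using signed_measure_lincomb[of \<mu> \<nu> 1 "-1"] by simp

lemma measure_distr_diff:
  "signed_measure \<mu> \<Longrightarrow> signed_measure \<nu> \<Longrightarrow> measure_distr (\<lambda>A. \<mu> A - \<nu> A) = measure_distr \<mu> - measure_distr \<nu>"
  using measure_distr_lincomb[of \<mu> \<nu> 1 "-1"] by simp

text \<open>The limit is taken set by set. The Cauchy estimate on a finite disjoint family passes to
  the limit with a bound independent of the family; the convergence is therefore uniform over Borel
  sets, and this uniformity carries countable additivity to the limit.\<close>

lemma tv_complete:
  assumes sm: "\<And>n::nat. signed_measure (\<mu> n)"
    and Cauchy: "\<And>\<epsilon>. \<epsilon> > 0 \<Longrightarrow> \<exists>N. \<forall>m\<ge>N. \<forall>n\<ge>N. tv (\<lambda>A. \<mu> m A - \<mu> n A) < \<epsilon>"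
  shows "\<exists>\<nu>. signed_measure \<nu> \<and> (\<lambda>n. tv (\<lambda>A. \<mu> n A - \<nu> A)) \<longlonglongrightarrow> 0"
proof -
  have "Cauchy (\<lambda>n. \<mu> n A)" for A
    unfolding Cauchy_def dist_real_def
  proof (intro allI impI)
    fix \<epsilon> :: real assume "\<epsilon> > 0"
    from Cauchy[OF this] obtain N where N: "\<And>m n. m \<ge> N \<Longrightarrow> n \<ge> N \<Longrightarrow> tv (\<lambda>A. \<mu> m A - \<mu> n A) < \<epsilon>" by blast
    have "\<bar>\<mu> m A - \<mu> n A\<bar> < \<epsilon>" if "m \<ge> N" "n \<ge> N" for m n
      using abs_le_tv[OF signed_measure_diff[OF sm[of m] sm[of n]], where A = A] N[OF that] by linarith
    then show "\<exists>N. \<forall>m\<ge>N. \<forall>n\<ge>N. \<bar>\<mu> m A - \<mu> n A\<bar> < \<epsilon>" by blast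
  qed
  then have "convergent (\<lambda>n. \<mu> n A)" for A by (simp add: Cauchy_convergent_iff)
  then obtain \<nu> where \<nu>: "\<And>A. (\<lambda>n. \<mu> n A) \<longlonglongrightarrow> \<nu> A" unfolding convergent_def by metis
  have sums: "(\<Sum>B\<in>P. \<bar>\<mu> n B - \<nu> B\<bar>) \<le> \<epsilon>"
    if N: "\<forall>m\<ge>N. \<forall>n\<ge>N. tv (\<lambda>A. \<mu> m A - \<mu> n A) < \<epsilon>" and "n \<ge> N"
      and P: "finite P" "P \<subseteq> sets borel" "disjoint P" for N n \<epsilon> P
  proof (rule LIMSEQ_le_const2)
    show "(\<lambda>m. \<Sum>B\<in>P. \<bar>\<mu> n B - \<mu> m B\<bar>) \<longlonglongrightarrow> (\<Sum>B\<in>P. \<bar>\<mu> n B - \<nu> B\<bar>)"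
      by (intro tendsto_sum tendsto_rabs tendsto_diff tendsto_const \<nu>)
    have "(\<Sum>B\<in>P. \<bar>\<mu> n B - \<mu> m B\<bar>) \<le> \<epsilon>" if "m \<ge> N" for m
      using sum_abs_le_tv[OF signed_measure_diff[OF sm[of n] sm[of m]] P] N \<open>n \<ge> N\<close> that by force
    then show "\<exists>N. \<forall>m\<ge>N. (\<Sum>B\<in>P. \<bar>\<mu> n B - \<mu> m B\<bar>) \<le> \<epsilon>" by blast
  qed
  have borel0: "\<nu> A = 0" if "A \<notin> sets borel" for A
    using \<nu>[of A] signed_measure_outside[OF sm that] by (simp add: LIMSEQ_const_iff)
  have unif: "\<exists>n. \<forall>A\<in>sets borel. \<bar>\<mu> n A - \<nu> A\<bar> \<le> \<epsilon>" if \<epsilon>: "\<epsilon> > 0" for \<epsilon>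
  proof -
    from Cauchy[OF \<epsilon>] obtain N where N: "\<forall>m\<ge>N. \<forall>n\<ge>N. tv (\<lambda>A. \<mu> m A - \<mu> n A) < \<epsilon>" by blast
    have "\<bar>\<mu> N A - \<nu> A\<bar> \<le> \<epsilon>" if "A \<in> sets borel" for A
      using sums[OF N order_refl, of "{A}"] that by simp
    then show ?thesis by blast
  qed
  have "(\<lambda>i. \<nu> (A i)) sums \<nu> (\<Union>i. A i)" if A: "range A \<subseteq> sets borel" "disjoint_family A" for A :: "nat \<Rightarrow> plane set"
  proof -
    have fin: "(\<Sum>i<k. \<nu> (A i)) = \<nu> (\<Union>i<k. A i)" for k
    proof (rule LIMSEQ_unique)
      show "(\<lambda>n. \<Sum>i<k. \<mu> n (A i)) \<longlonglongrightarrow> (\<Sum>i<k. \<nu> (A i))" by (intro tendsto_sum \<nu>)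
      show "(\<lambda>n. \<Sum>i<k. \<mu> n (A i)) \<longlonglongrightarrow> \<nu> (\<Union>i<k. A i)"
        unfolding signed_measure_finite_UN[OF sm A] by (rule \<nu>)
    qed
    have "(\<lambda>k. \<nu> (\<Union>i<k. A i)) \<longlonglongrightarrow> \<nu> (\<Union>i. A i)"
    proof (rule LIMSEQ_I)
      fix \<epsilon> :: real assume "\<epsilon> > 0"
      \<comment> \<open>Three errors are added: two from replacing \<open>\<nu>\<close> by
        \<open>\<mu> n\<close>, one from the tail of the union under \<open>\<mu> n\<close>.\<close>
      then have e: "\<epsilon> / 4 > 0" by simp
      from unif[OF e] obtain n where n: "\<And>A. A \<in> sets borel \<Longrightarrow> \<bar>\<mu> n A - \<nu> A\<bar> \<le> \<epsilon> / 4" by blast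
      have "(\<lambda>k. \<mu> n (\<Union>i<k. A i)) \<longlonglongrightarrow> \<mu> n (\<Union>i. A i)"
        using signed_measure_sums[OF sm A] unfolding sums_def signed_measure_finite_UN[OF sm A] .
      from LIMSEQ_D[OF this e] obtain k0 where k0: "\<And>k. k \<ge> k0 \<Longrightarrow> \<bar>\<mu> n (\<Union>i<k. A i) - \<mu> n (\<Union>i. A i)\<bar> < \<epsilon> / 4"
        by auto
      have "\<bar>\<nu> (\<Union>i<k. A i) - \<nu> (\<Union>i. A i)\<bar> < \<epsilon>" if "k \<ge> k0" for k
      proof -
        have "(\<Union>i<k. A i) \<in> sets borel" "(\<Union>i. A i) \<in> sets borel" using A(1) by auto
        from n[OF this(1)] n[OF this(2)] k0[OF that] \<open>\<epsilon> > 0\<close> show ?thesis by linarith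
      qed
      then show "\<exists>k0. \<forall>k\<ge>k0. norm (\<nu> (\<Union>i<k. A i) - \<nu> (\<Union>i. A i)) < \<epsilon>" by auto
    qed
    then show ?thesis unfolding sums_def fin .
  qed
  moreover have "\<nu> {} = 0" using \<nu>[of "{}"] by (simp add: signed_measure_empty[OF sm] LIMSEQ_const_iff)
  ultimately have "signed_measure \<nu>" unfolding signed_measure_def using borel0 by blast
  moreover have "(\<lambda>n. tv (\<lambda>A. \<mu> n A - \<nu> A)) \<longlonglongrightarrow> 0"
  proof (rule LIMSEQ_I)
    fix \<epsilon> :: real assume "\<epsilon> > 0"
    then have "\<epsilon> / 2 > 0" by simp
    from Cauchy[OF this] obtain N where N: "\<forall>m\<ge>N. \<forall>n\<ge>N. tv (\<lambda>A. \<mu> m A - \<mu> n A) < \<epsilon> / 2" by blast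
    have "tv (\<lambda>A. \<mu> n A - \<nu> A) \<le> \<epsilon> / 2" if "n \<ge> N" for n
      by (rule tv_leI) (rule sums[OF N that])
    then show "\<exists>N. \<forall>n\<ge>N. norm (tv (\<lambda>A. \<mu> n A - \<nu> A) - 0) < \<epsilon>" using \<open>\<epsilon> > 0\<close> by force
  qed
  ultimately show ?thesis by blast
qed

text \<open>Elsewhere \<open>M_norm\<close> rests on an unspecified set function, so its laws are
  stated for these distributions.\<close>

definition is_measure_distr :: "distribution \<Rightarrow> bool" where
  "is_measure_distr u \<longleftrightarrow> (\<exists>\<mu>. signed_measure \<mu> \<and> u = measure_distr \<mu>)"

lemma M_norm_measure_distr: "signed_measure \<mu> \<Longrightarrow> M_norm (measure_distr \<mu>) = tv \<mu>"
  by (rule M_norm_eq) (rule represents_measure_distr)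

lemma M_norm_nonneg [simp]: "0 \<le> M_norm u"
  by (simp add: M_norm_def)

lemma M_norm_triangle:
  assumes "is_measure_distr u" "is_measure_distr v"
  shows "M_norm (u + v) \<le> M_norm u + M_norm v"
proof -
  from assms obtain \<mu> \<nu> where \<mu>: "signed_measure \<mu>" "u = measure_distr \<mu>" and \<nu>: "signed_measure \<nu>" "v = measure_distr \<nu>"
    by (auto simp: is_measure_distr_def)
  have sm: "signed_measure (\<lambda>A. \<mu> A + \<nu> A)" using signed_measure_lincomb[OF \<mu>(1) \<nu>(1), of 1 1] by simp
  have "u + v = measure_distr (\<lambda>A. \<mu> A + \<nu> A)" using measure_distr_lincomb[OF \<mu>(1) \<nu>(1), of 1 1] \<mu> \<nu> by simp
  then show ?thesis using tv_add[OF \<mu>(1) \<nu>(1)] \<mu> \<nu> sm by (simp add: M_norm_measure_distr)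
qed

lemma M_norm_scale:
  assumes "is_measure_distr u"
  shows "M_norm (c *\<^sub>R u) = \<bar>c\<bar> * M_norm u"
proof -
  from assms obtain \<mu> where \<mu>: "signed_measure \<mu>" "u = measure_distr \<mu>" by (auto simp: is_measure_distr_def)
  have sm: "signed_measure (\<lambda>A. c * \<mu> A)" using signed_measure_lincomb[OF \<mu>(1) \<mu>(1), of c 0] by simp
  have "c *\<^sub>R u = measure_distr (\<lambda>A. c * \<mu> A)" using measure_distr_lincomb[OF \<mu>(1) \<mu>(1), of c 0] \<mu> by simp
  then show ?thesis using tv_scale[of c \<mu>] \<mu> sm by (simp add: M_norm_measure_distr)
qed

lemma M_norm_eq_0_iff:
  assumes "is_measure_distr u"
  shows "M_norm u = 0 \<longleftrightarrow> u = 0"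
proof
  from assms obtain \<mu> where \<mu>: "signed_measure \<mu>" "u = measure_distr \<mu>" by (auto simp: is_measure_distr_def)
  assume "M_norm u = 0"
  then have "tv \<mu> = 0" using \<mu> by (simp add: M_norm_measure_distr)
  then have "\<mu> = (\<lambda>A. 0 * \<mu> A + 0 * \<mu> A)" using tv_eq_0D[OF \<mu>(1)] by auto
  then show "u = 0" using \<mu>(2) measure_distr_lincomb[OF \<mu>(1) \<mu>(1), of 0 0] by simp
next
  assume "u = 0"
  then show "M_norm u = 0" using M_norm_scale[OF assms, of 0] by simp
qed

section \<open>The vector space \<open>M_DD0\<close> and its norms\<close>

lemma distr_pd_add: "distr_pd e (u + v) = distr_pd e u + distr_pd e v"
  by (rule distribution_eqI) (simp add: dist_apply_distr_pd plus_distribution.rep_eq)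

lemma distr_pd_scale: "distr_pd e (c *\<^sub>R u) = c *\<^sub>R distr_pd e u"
  by (rule distribution_eqI) (simp add: dist_apply_distr_pd scaleR_distribution.rep_eq)

lemma DD_add: "DD (u + v) = DD u + DD v" and DD_scale: "DD (c *\<^sub>R u) = c *\<^sub>R DD u"
  by (simp_all add: DD_eq distr_pd_add distr_pd_scale)

lemma DD_diff: "DD (u - v) = DD u - DD v"
  by (simp add: DD_eq distr_pd_diff)

lemma DD_zero [simp]: "DD 0 = 0"
  using DD_scale[of 0 0] by simp

lemma subspace_M_DD0: "subspace M_DD0"
proof (rule subspaceI)
  have "measure_distr (\<lambda>_. 0) = 0"
    using measure_distr_lincomb[OF signed_measure_zero signed_measure_zero, of 0 0] by simp
  then show "0 \<in> M_DD0"
    unfolding M_DD0_iff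
    by (auto simp: vanishes_outside_square_def zero_distribution.rep_eq vanishes_off_def signed_measure_zero
        intro!: exI[of _ "\<lambda>_. 0"])
next
  fix f g assume "f \<in> M_DD0" "g \<in> M_DD0"
  then obtain \<mu> \<nu> where f: "vanishes_outside_square f" "signed_measure \<mu>" "vanishes_off unit_square \<mu>" "DD f = measure_distr \<mu>"
    and g: "vanishes_outside_square g" "signed_measure \<nu>" "vanishes_off unit_square \<nu>" "DD g = measure_distr \<nu>"
    by (auto simp: M_DD0_iff)
  have "DD (f + g) = measure_distr (\<lambda>A. 1 * \<mu> A + 1 * \<nu> A)"
    unfolding measure_distr_lincomb[OF f(2) g(2)] by (simp add: DD_add f g)
  moreover have "vanishes_off unit_square (\<lambda>A. 1 * \<mu> A + 1 * \<nu> A)"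
    using f g by (simp add: vanishes_off_def)
  moreover have "vanishes_outside_square (f + g)"
    using f g by (simp add: vanishes_outside_square_def plus_distribution.rep_eq)
  ultimately show "f + g \<in> M_DD0"
    unfolding M_DD0_iff using signed_measure_lincomb[OF f(2) g(2)] by blast
next
  fix c f assume "f \<in> M_DD0"
  then obtain \<mu> where f: "vanishes_outside_square f" "signed_measure \<mu>" "vanishes_off unit_square \<mu>" "DD f = measure_distr \<mu>"
    by (auto simp: M_DD0_iff)
  have "DD (c *\<^sub>R f) = measure_distr (\<lambda>A. c * \<mu> A + 0 * \<mu> A)"
    unfolding measure_distr_lincomb[OF f(2) f(2)] by (simp add: DD_scale f)
  moreover have "vanishes_off unit_square (\<lambda>A. c * \<mu> A + 0 * \<mu> A)"
    using f by (simp add: vanishes_off_def)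
  moreover have "vanishes_outside_square (c *\<^sub>R f)"
    using f by (simp add: vanishes_outside_square_def scaleR_distribution.rep_eq)
  ultimately show "c *\<^sub>R f \<in> M_DD0"
    unfolding M_DD0_iff using signed_measure_lincomb[OF f(2) f(2)] by blast
qed

lemma M_DD0_is_measure_distr:
  assumes "f \<in> M_DD0"
  shows "is_measure_distr (DD f)" "is_measure_distr (D1 f)" "is_measure_distr (D2 f)"
    and M_norm_D1_le: "M_norm (D1 f) \<le> M_norm (DD f)" and M_norm_D2_le: "M_norm (D2 f) \<le> M_norm (DD f)"
proof -
  obtain \<mu> where \<mu>: "balanced \<mu>" "DD f = measure_distr \<mu>" using M_DD0_balanced[OF assms] by blast
  then have sm: "signed_measure \<mu>" by (simp add: balanced_def)
  note g = M_DD0_gradient[OF assms \<mu>]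
  have b: "(1, 0) \<in> (Basis :: plane set)" "(0, 1) \<in> (Basis :: plane set)" by (auto simp: Basis_plane)
  show "is_measure_distr (DD f)" "is_measure_distr (D1 f)" "is_measure_distr (D2 f)"
    unfolding is_measure_distr_def g \<mu>(2) using sm signed_measure_sweep[OF sm] b by blast+
  show "M_norm (D1 f) \<le> M_norm (DD f)" "M_norm (D2 f) \<le> M_norm (DD f)"
    unfolding g \<mu>(2) by (simp_all add: M_norm_measure_distr sm signed_measure_sweep b tv_sweep_le)
qed

lemma is_measure_distr_well_defined: "is_measure_distr u \<Longrightarrow> M_norm_well_defined u"
  unfolding is_measure_distr_def using M_norm_well_definedI represents_measure_distr by blast

text \<open>The lower bound drops the gradient and is useful because \<open>\<theta>\<close> is
  positive; the upper bound replaces both gradient components by \<open>DD f\<close>, with total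
  weight \<open>\<theta> + 2 (1 - \<theta>)\<close>, at most 2.\<close>

lemma norm_theta_bounds:
  assumes "f \<in> M_DD0" "\<theta> \<in> {0<..1}"
  shows "\<theta> * M_norm (DD f) \<le> norm_theta \<theta> f" "norm_theta \<theta> f \<le> 2 * M_norm (DD f)"
proof -
  have "0 \<le> (1 - \<theta>) * grad_norm f" using assms(2) by (auto simp: grad_norm_def)
  then show "\<theta> * M_norm (DD f) \<le> norm_theta \<theta> f" by (simp add: norm_theta_def)
  have "(1 - \<theta>) * grad_norm f \<le> (1 - \<theta>) * (2 * M_norm (DD f))"
    using assms(2) M_norm_D1_le[OF assms(1)] M_norm_D2_le[OF assms(1)]
    by (intro mult_left_mono) (auto simp: grad_norm_def)
  then have "norm_theta \<theta> f \<le> (2 - \<theta>) * M_norm (DD f)" by (simp add: norm_theta_def algebra_simps)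
  also have "\<dots> \<le> 2 * M_norm (DD f)" using assms(2) by (intro mult_right_mono) auto
  finally show "norm_theta \<theta> f \<le> 2 * M_norm (DD f)" .
qed

lemma norm_theta_equivalent:
  assumes "\<theta>1 \<in> {0<..1}" "\<theta>2 \<in> {0<..1}"
  shows "\<exists>C>0. \<forall>f\<in>M_DD0. norm_theta \<theta>1 f \<le> C * norm_theta \<theta>2 f"
proof (intro exI[of _ "2 / \<theta>2"] conjI ballI)
  show "2 / \<theta>2 > 0" using assms by simp
  fix f assume f: "f \<in> M_DD0"
  have "M_norm (DD f) \<le> norm_theta \<theta>2 f / \<theta>2"
    using norm_theta_bounds(1)[OF f assms(2)] assms(2) by (simp add: field_simps)
  then show "norm_theta \<theta>1 f \<le> 2 / \<theta>2 * norm_theta \<theta>2 f"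
    using norm_theta_bounds(2)[OF f assms(1)] by simp
qed

lemma normed_space_subspace_with_norm:
  assumes "subspace V" and "\<And>x. x \<in> V \<Longrightarrow> 0 \<le> N x" "\<And>x. x \<in> V \<Longrightarrow> N x = 0 \<longleftrightarrow> x = 0"
    and "\<And>a x. x \<in> V \<Longrightarrow> N (a *\<^sub>R x) = \<bar>a\<bar> * N x"
    and "\<And>x y. x \<in> V \<Longrightarrow> y \<in> V \<Longrightarrow> N (x + y) \<le> N x + N y"
  shows "normed_space (subspace_with_norm V N)"
  using assms unfolding normed_space_def subspace_with_norm_def
  by (auto simp: subspace_0 subspace_add subspace_scale algebra_simps)

lemma normed_space_norm_theta:
  assumes \<theta>: "\<theta> \<in> {0<..1}"
  shows "normed_space (subspace_with_norm M_DD0 (norm_theta \<theta>))"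
proof (rule normed_space_subspace_with_norm[OF subspace_M_DD0])
  fix f assume f: "f \<in> M_DD0"
  note m = M_DD0_is_measure_distr[OF f]
  show nonneg: "0 \<le> norm_theta \<theta> f"
    using \<theta> by (auto simp: norm_theta_def grad_norm_def)
  show "norm_theta \<theta> f = 0 \<longleftrightarrow> f = 0"
  proof
    assume "norm_theta \<theta> f = 0"
    then have "\<theta> * M_norm (DD f) \<le> 0" using norm_theta_bounds(1)[OF f \<theta>] by simp
    then have "M_norm (DD f) = 0"
      using \<theta> M_norm_nonneg[of "DD f"] by (simp add: mult_le_0_iff)
    then show "f = 0"
      using M_norm_eq_0_iff[OF m(1)] DD_eq_0D f by (simp add: M_DD0_iff)
  next
    assume "f = 0"
    then have "M_norm (DD f) = 0" using M_norm_eq_0_iff[OF m(1)] by simp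
    then show "norm_theta \<theta> f = 0" using norm_theta_bounds(2)[OF f \<theta>] nonneg by simp
  qed
  show "norm_theta \<theta> (a *\<^sub>R f) = \<bar>a\<bar> * norm_theta \<theta> f" for a
    using m by (simp add: norm_theta_def grad_norm_def DD_scale D1_eq D2_eq distr_pd_scale M_norm_scale algebra_simps)
  fix g assume g: "g \<in> M_DD0"
  note k = M_DD0_is_measure_distr[OF g]
  have "\<theta> * M_norm (DD f + DD g) \<le> \<theta> * (M_norm (DD f) + M_norm (DD g))"
    using \<theta> by (intro mult_left_mono M_norm_triangle m k) auto
  moreover have "(1 - \<theta>) * grad_norm (f + g) \<le> (1 - \<theta>) * (grad_norm f + grad_norm g)"
    using \<theta> M_norm_triangle[OF m(2) k(2)] M_norm_triangle[OF m(3) k(3)]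
    by (intro mult_left_mono) (auto simp: grad_norm_def D1_eq D2_eq distr_pd_add)
  ultimately show "norm_theta \<theta> (f + g) \<le> norm_theta \<theta> f + norm_theta \<theta> g"
    by (simp add: norm_theta_def DD_add algebra_simps)
qed

text \<open>Integrals of a fixed bounded function, and values on a fixed set, depend continuously on
  the measure in total variation.\<close>

lemma balanced_limit:
  assumes bal: "\<And>n. balanced (\<mu> n)" and \<nu>: "signed_measure \<nu>"
    and lim: "(\<lambda>n. tv (\<lambda>A. \<mu> n A - \<nu> A)) \<longlonglongrightarrow> 0"
  shows "balanced \<nu>"
  unfolding balanced_def
proof (intro conjI ballI)
  have sm: "signed_measure (\<mu> n)" for n using bal by (simp add: balanced_def)
  note d = signed_measure_diff[OF sm \<nu>]
  show "signed_measure \<nu>" by (rule \<nu>)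
  show "vanishes_off unit_square \<nu>"
    unfolding vanishes_off_def
  proof (intro ballI impI)
    fix A :: "plane set" assume A: "A \<in> sets borel" "A \<inter> unit_square = {}"
    then have "\<mu> n A = 0" for n using bal[of n] by (simp add: balanced_def vanishes_off_def)
    then have "\<bar>\<nu> A\<bar> \<le> tv (\<lambda>A. \<mu> n A - \<nu> A)" for n using abs_le_tv[OF d, of n A] by simp
    then have "\<bar>\<nu> A\<bar> \<le> 0" by (intro LIMSEQ_le_const[OF lim]) auto
    then show "\<nu> A = 0" by simp
  qed
  fix e :: plane assume e: "e \<in> Basis"
  show "marginal_zero e \<nu>"
    unfolding marginal_zero_def
  proof (intro allI impI)
    fix g assume g: "bounded_borel g"
    let ?h = "\<lambda>z. g (proj e z)"
    have h: "bounded_borel ?h" using g measurable_proj by (rule bounded_borel_compose)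
    then obtain c where c: "\<And>z. \<bar>?h z\<bar> \<le> c" unfolding bounded_borel_def by blast
    have "\<bar>signed_integral \<nu> ?h\<bar> \<le> c * tv (\<lambda>A. \<mu> n A - \<nu> A)" for n
    proof -
      have "signed_integral (\<mu> n) ?h = 0"
        using bal[of n] e g unfolding balanced_def marginal_zero_def by blast
      then have "signed_integral (\<lambda>A. \<mu> n A - \<nu> A) ?h = - signed_integral \<nu> ?h"
        using signed_integral_lincomb[OF sm \<nu> h, of 1 n "-1"] by simp
      then show ?thesis
        using abs_signed_integral_le[OF d, of ?h c n] h c by (simp add: bounded_borel_def)
    qed
    moreover have "(\<lambda>n. c * tv (\<lambda>A. \<mu> n A - \<nu> A)) \<longlonglongrightarrow> 0"
      using tendsto_mult_right_zero[OF lim] .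
    ultimately have "\<bar>signed_integral \<nu> ?h\<bar> \<le> 0" by (intro LIMSEQ_le_const) auto
    then show "signed_integral \<nu> ?h = 0" by simp
  qed
qed

text \<open>The limit is sought among the measures \<open>DD (s n)\<close> and turned back into an
  element of \<open>M_DD0\<close>; the two bounds of \<open>norm_theta_bounds\<close> translate
  Cauchy property and convergence.\<close>

lemma banach_space_norm_theta:
  assumes \<theta>: "\<theta> \<in> {0<..1}"
  shows "banach_space (subspace_with_norm M_DD0 (norm_theta \<theta>))"
  unfolding banach_space_def
proof (intro conjI allI impI normed_space_norm_theta \<theta>)
  fix s :: "nat \<Rightarrow> distribution"
  assume "range s \<subseteq> carr (subspace_with_norm M_DD0 (norm_theta \<theta>))"
  then have s: "s n \<in> M_DD0" for n by (auto simp: subspace_with_norm_def)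
  have nd: "ndist (subspace_with_norm M_DD0 (norm_theta \<theta>)) x y = norm_theta \<theta> (x - y)" for x y
    by (simp add: ndist_def subspace_with_norm_def)
  assume "\<forall>e>0. \<exists>n0. \<forall>m\<ge>n0. \<forall>n\<ge>n0. ndist (subspace_with_norm M_DD0 (norm_theta \<theta>)) (s m) (s n) < e"
  then have C: "\<exists>n0. \<forall>m\<ge>n0. \<forall>n\<ge>n0. norm_theta \<theta> (s m - s n) < e" if "e > 0" for e
    using that by (simp add: nd)
  obtain \<mu> where \<mu>: "\<And>n. balanced (\<mu> n)" "\<And>n. DD (s n) = measure_distr (\<mu> n)"
    using M_DD0_balanced[OF s] by metis
  have sm: "signed_measure (\<mu> n)" for n using \<mu>(1) by (simp add: balanced_def)
  have "\<exists>N. \<forall>m\<ge>N. \<forall>n\<ge>N. tv (\<lambda>A. \<mu> m A - \<mu> n A) < \<epsilon>" if "\<epsilon> > 0" for \<epsilon>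
  proof -
    have "\<theta> * \<epsilon> > 0" using that \<theta> by simp
    from C[OF this] obtain N where N: "\<And>m n. m \<ge> N \<Longrightarrow> n \<ge> N \<Longrightarrow> norm_theta \<theta> (s m - s n) < \<theta> * \<epsilon>" by blast
    have "tv (\<lambda>A. \<mu> m A - \<mu> n A) < \<epsilon>" if "m \<ge> N" "n \<ge> N" for m n
    proof -
      have "s m - s n \<in> M_DD0" using s subspace_diff[OF subspace_M_DD0] by blast
      from norm_theta_bounds(1)[OF this \<theta>] N[OF that]
      have "\<theta> * M_norm (DD (s m - s n)) < \<theta> * \<epsilon>" by linarith
      then have "M_norm (DD (s m - s n)) < \<epsilon>" using \<theta> by simp
      then show ?thesis
        by (simp add: DD_diff \<mu>(2) measure_distr_diff[OF sm sm, symmetric] M_norm_measure_distr signed_measure_diff sm)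
    qed
    then show ?thesis by blast
  qed
  from tv_complete[OF sm this] obtain \<nu> where
    \<nu>: "signed_measure \<nu>" "(\<lambda>n. tv (\<lambda>A. \<mu> n A - \<nu> A)) \<longlonglongrightarrow> 0" by blast
  from balanced_M_DD0[OF balanced_limit[OF \<mu>(1) \<nu>]] obtain f where
    f: "f \<in> M_DD0" "DD f = measure_distr \<nu>" by blast
  have "(\<lambda>n. norm_theta \<theta> (s n - f)) \<longlonglongrightarrow> 0"
  proof (rule tendsto_sandwich)
    have d: "s n - f \<in> M_DD0" for n using s f subspace_diff[OF subspace_M_DD0] by blast
    show "\<forall>\<^sub>F n in sequentially. 0 \<le> norm_theta \<theta> (s n - f)"
      using \<theta> by (intro always_eventually allI) (auto simp: norm_theta_def grad_norm_def)
    have "M_norm (DD (s n - f)) = tv (\<lambda>A. \<mu> n A - \<nu> A)" for n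
      by (simp add: DD_diff \<mu>(2) f(2) measure_distr_diff[OF sm \<nu>(1), symmetric] M_norm_measure_distr signed_measure_diff sm \<nu>(1))
    then show "\<forall>\<^sub>F n in sequentially. norm_theta \<theta> (s n - f) \<le> 2 * tv (\<lambda>A. \<mu> n A - \<nu> A)"
      using norm_theta_bounds(2)[OF d \<theta>] by simp
    show "(\<lambda>n. 2 * tv (\<lambda>A. \<mu> n A - \<nu> A)) \<longlonglongrightarrow> 0" using tendsto_mult_right_zero[OF \<nu>(2)] .
  qed simp
  then show "\<exists>l\<in>carr (subspace_with_norm M_DD0 (norm_theta \<theta>)).
      (\<lambda>n. ndist (subspace_with_norm M_DD0 (norm_theta \<theta>)) (s n) l) \<longlonglongrightarrow> 0"
    unfolding nd using f(1) by (intro bexI[of _ f]) (auto simp: subspace_with_norm_def)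
qed

section \<open>The Riesz representation theorem on a compact set\<close>

definition bounded_continuous :: "('a::metric_space \<Rightarrow> real) \<Rightarrow> bool" where
  "bounded_continuous f \<longleftrightarrow> continuous_on UNIV f \<and> (\<exists>c. \<forall>x. \<bar>f x\<bar> \<le> c)"

text \<open>The domain of positive functionals: the positive part \<open>pos\<close> of a
  functional, a supremum over minorants, is shown additive on nonnegative functions.\<close>

definition cone :: "('a::metric_space \<Rightarrow> real) set" where
  "cone = {f. bounded_continuous f \<and> (\<forall>x. 0 \<le> f x)}"

lemma bounded_continuousD:
  assumes "bounded_continuous f"
  shows "continuous_on S f" "\<exists>c\<ge>0. \<forall>x. \<bar>f x\<bar> \<le> c"
proof -
  show "continuous_on S f" using assms continuous_on_subset[of UNIV f S] by (auto simp: bounded_continuous_def)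
  from assms obtain c where c: "\<And>x. \<bar>f x\<bar> \<le> c" by (auto simp: bounded_continuous_def)
  then have "\<forall>x. \<bar>f x\<bar> \<le> max 0 c" by (simp add: le_max_iff_disj)
  then show "\<exists>c\<ge>0. \<forall>x. \<bar>f x\<bar> \<le> c" by (intro exI[of _ "max 0 c"]) auto
qed

lemma bounded_continuousI:
  "continuous_on UNIV f \<Longrightarrow> (\<And>x. \<bar>f x\<bar> \<le> c) \<Longrightarrow> bounded_continuous f"
  unfolding bounded_continuous_def by blast

lemma bounded_continuous_const [simp]: "bounded_continuous (\<lambda>x. c)"
  by (rule bounded_continuousI[of _ "\<bar>c\<bar>"]) auto

lemma bounded_continuous_add:
  assumes "bounded_continuous f" "bounded_continuous g"
  shows "bounded_continuous (\<lambda>x. f x + g x)"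
proof -
  obtain c d where c: "\<And>x. \<bar>f x\<bar> \<le> c" and d: "\<And>x. \<bar>g x\<bar> \<le> d"
    using assms by (auto simp: bounded_continuous_def)
  have "\<bar>f x + g x\<bar> \<le> c + d" for x using c[of x] d[of x] by linarith
  then show ?thesis
    by (rule bounded_continuousI[OF continuous_on_add[OF assms[THEN bounded_continuousD(1)]]])
qed

lemma bounded_continuous_scale:
  assumes "bounded_continuous f"
  shows "bounded_continuous (\<lambda>x. a * f x)"
proof -
  obtain c where c: "\<And>x. \<bar>f x\<bar> \<le> c" using assms by (auto simp: bounded_continuous_def)
  have "\<bar>a * f x\<bar> \<le> \<bar>a\<bar> * c" for x using c[of x] by (simp add: abs_mult mult_left_mono)
  then show ?thesis
    by (rule bounded_continuousI[OF continuous_on_mult_left[OF bounded_continuousD(1)[OF assms]]])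
qed

lemma bounded_continuous_diff:
  "bounded_continuous f \<Longrightarrow> bounded_continuous g \<Longrightarrow> bounded_continuous (\<lambda>x. f x - g x)"
  using bounded_continuous_add[OF _ bounded_continuous_scale[of g "-1"]] by simp

lemma bounded_continuous_min:
  assumes "bounded_continuous f" "bounded_continuous g"
  shows "bounded_continuous (\<lambda>x. min (f x) (g x))"
proof -
  obtain c d where c: "\<And>x. \<bar>f x\<bar> \<le> c" and d: "\<And>x. \<bar>g x\<bar> \<le> d"
    using assms by (auto simp: bounded_continuous_def)
  have "\<bar>min (f x) (g x)\<bar> \<le> max c d" for x using c[of x] d[of x] by linarith
  then show ?thesis
    by (rule bounded_continuousI[OF continuous_on_min[OF assms[THEN bounded_continuousD(1)]]])
qed

lemma bounded_continuous_max:
  assumes "bounded_continuous f" "bounded_continuous g"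
  shows "bounded_continuous (\<lambda>x. max (f x) (g x))"
proof -
  obtain c d where c: "\<And>x. \<bar>f x\<bar> \<le> c" and d: "\<And>x. \<bar>g x\<bar> \<le> d"
    using assms by (auto simp: bounded_continuous_def)
  have "\<bar>max (f x) (g x)\<bar> \<le> max c d" for x using c[of x] d[of x] by linarith
  then show ?thesis
    by (rule bounded_continuousI[OF continuous_on_max[OF assms[THEN bounded_continuousD(1)]]])
qed

lemma bounded_continuous_sum:
  "(\<And>i. i \<in> S \<Longrightarrow> bounded_continuous (f i)) \<Longrightarrow> bounded_continuous (\<lambda>x. \<Sum>i\<in>S. f i x)"
  by (induction S rule: infinite_finite_induct) (auto intro: bounded_continuous_add)

lemmas bounded_continuous_intros = bounded_continuous_const bounded_continuous_add bounded_continuous_scale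
  bounded_continuous_diff bounded_continuous_min bounded_continuous_max bounded_continuous_sum

lemma coneI: "bounded_continuous f \<Longrightarrow> (\<And>x. 0 \<le> f x) \<Longrightarrow> f \<in> cone"
  and cone_bounded_continuous: "f \<in> cone \<Longrightarrow> bounded_continuous f"
  and cone_nonneg: "f \<in> cone \<Longrightarrow> 0 \<le> f x"
  by (auto simp: cone_def)

lemma open_bump:
  fixes U :: "'a::metric_space set"
  assumes "open U"
  shows "\<exists>d\<in>cone. (\<forall>x. d x > 0 \<longleftrightarrow> x \<in> U)"
\<comment> \<open>\<open>infdist\<close> to the empty set is 0, so the whole space is treated
  apart.\<close>
proof (cases "U = UNIV")
  case True
  then show ?thesis by (intro bexI[of _ "\<lambda>_. 1"]) (auto intro: coneI)
next
  case False
  then have ne: "- U \<noteq> {}" by blast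
  have "bounded_continuous (\<lambda>x. min 1 (infdist x (- U)))"
    by (rule bounded_continuousI[of _ 1])
      (auto simp: infdist_nonneg abs_of_nonneg intro!: continuous_intros)
  then have "(\<lambda>x. min 1 (infdist x (- U))) \<in> cone"
    by (rule coneI) (simp add: infdist_nonneg)
  moreover have "min 1 (infdist x (- U)) > 0 \<longleftrightarrow> x \<in> U" for x
    using in_closed_iff_infdist_zero[of "- U" x] assms ne infdist_nonneg[of x "- U"]
    by (auto simp: closed_Compl less_le)
  ultimately show ?thesis
    by (intro bexI[of _ "\<lambda>x. min 1 (infdist x (- U))"]) auto
qed

text \<open>Comparing functions on \<open>K\<close> only expresses positivity and concentration on
  \<open>K\<close> in a single axiom.\<close>

locale positive_functional =
  fixes I :: "('a::metric_space \<Rightarrow> real) \<Rightarrow> real" and K :: "'a set"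
  assumes K: "compact K"
    and add: "f \<in> cone \<Longrightarrow> g \<in> cone \<Longrightarrow> I (\<lambda>x. f x + g x) = I f + I g"
    and scale: "f \<in> cone \<Longrightarrow> 0 \<le> c \<Longrightarrow> I (\<lambda>x. c * f x) = c * I f"
    and mono: "f \<in> cone \<Longrightarrow> g \<in> cone \<Longrightarrow> (\<And>x. x \<in> K \<Longrightarrow> f x \<le> g x) \<Longrightarrow> I f \<le> I g"
begin

lemma zero: "I (\<lambda>x. 0) = 0"
  using scale[of "\<lambda>_. 0" 0] by (simp add: cone_def)

lemma nonneg: "f \<in> cone \<Longrightarrow> 0 \<le> I f"
  using mono[of "\<lambda>_. 0" f] zero by (simp add: cone_def)

lemma const: "0 \<le> c \<Longrightarrow> I (\<lambda>x. c) = c * I (\<lambda>x. 1)"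
  using scale[of "\<lambda>_. 1" c] by (simp add: cone_def)

lemma sum: "(\<And>i. i < n \<Longrightarrow> f i \<in> cone) \<Longrightarrow> I (\<lambda>x. \<Sum>i<n::nat. f i x) = (\<Sum>i<n. I (f i))"
proof (induction n)
  case (Suc n)
  have fi: "f i \<in> cone" if "i < n" for i using Suc.prems that by simp
  have "(\<lambda>x. \<Sum>i<n. f i x) \<in> cone"
    by (rule coneI[OF bounded_continuous_sum sum_nonneg]) (auto intro: cone_bounded_continuous cone_nonneg fi)
  then show ?case using Suc by (simp add: add)
qed (simp add: zero)

text \<open>Dini's argument: finitely many of the open sets where \<open>f - g n\<close> is below
  \<open>\<delta>\<close> cover the compact \<open>K\<close>, and by monotonicity the largest index
  serves on all of \<open>K\<close>.\<close>

lemma monotone_limit_le: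
  assumes f: "f \<in> cone" and g: "\<And>n::nat. g n \<in> cone" and inc: "\<And>n x. g n x \<le> g (Suc n) x"
    and lim: "\<And>x \<epsilon>. \<epsilon> > 0 \<Longrightarrow> \<exists>n. f x - g n x < \<epsilon>" and B: "\<And>n. I (g n) \<le> B"
  shows "I f \<le> B"
proof (rule field_le_epsilon)
  fix \<epsilon> :: real assume "\<epsilon> > 0"
  \<comment> \<open>Adding 1 guards against division by 0 for the zero functional.\<close>
  define \<delta> where "\<delta> = \<epsilon> / (I (\<lambda>_. 1) + 1)"
  have one: "(\<lambda>_. 1) \<in> cone" by (auto intro: coneI)
  have \<delta>: "\<delta> > 0" "\<delta> * I (\<lambda>_. 1) \<le> \<epsilon>"
    using \<open>\<epsilon> > 0\<close> nonneg[OF one] by (auto simp: \<delta>_def field_simps)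
  have mono_g: "g m x \<le> g n x" if "m \<le> n" for m n x
    using lift_Suc_mono_le[of "\<lambda>n. g n x", OF inc that] .
  have "K \<subseteq> (\<Union>n. {x. f x - g n x < \<delta>})" using lim[OF \<delta>(1)] by blast
  moreover have "open {x. f x - g n x < \<delta>}" for n
    by (intro open_Collect_less continuous_intros bounded_continuousD(1) cone_bounded_continuous f g)
  ultimately obtain T where T: "finite T" "K \<subseteq> (\<Union>n\<in>T. {x. f x - g n x < \<delta>})"
    using compactE_image[OF K, of UNIV "\<lambda>n. {x. f x - g n x < \<delta>}"] by auto
  obtain N where N: "\<And>n. n \<in> T \<Longrightarrow> n \<le> N" using T(1) by (meson finite_nat_set_iff_bounded_le)
  have "I f \<le> I (\<lambda>x. g N x + \<delta>)"
  proof (rule mono)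
    show "(\<lambda>x. g N x + \<delta>) \<in> cone"
      using g[of N] \<delta>(1) by (auto simp: cone_def intro!: bounded_continuous_intros add_nonneg_nonneg)
    fix x assume "x \<in> K"
    then obtain n where "n \<in> T" "f x - g n x < \<delta>" using T(2) by blast
    then show "f x \<le> g N x + \<delta>" using mono_g[OF N, of n x] by simp
  qed (rule f)
  also have "\<dots> = I (g N) + \<delta> * I (\<lambda>_. 1)"
    using \<delta>(1) by (subst add[OF g]) (auto simp: const[of \<delta>] intro: coneI)
  finally show "I f \<le> B + \<epsilon>" using B[of N] \<delta>(2) by linarith
qed

text \<open>Competitors vanish off \<open>U\<close>, but their supports may touch its boundary.
  Where room is wanted, as in \<open>outer_open_split\<close>, a small height is cut off
  instead.\<close>

definition below :: "'a set \<Rightarrow> ('a \<Rightarrow> real) set" where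
  "below U = {f\<in>cone. (\<forall>x. f x \<le> 1) \<and> (\<forall>x. x \<notin> U \<longrightarrow> f x = 0)}"

definition content :: "'a set \<Rightarrow> ennreal" where
  "content U = (SUP f\<in>below U. ennreal (I f))"

definition outer :: "'a set \<Rightarrow> ennreal" where
  "outer A = (INF U\<in>{U. open U \<and> A \<subseteq> U}. content U)"

lemma below_cone: "f \<in> below U \<Longrightarrow> f \<in> cone"
  by (simp add: below_def)

lemma zero_below: "(\<lambda>_. 0) \<in> below U"
  by (auto simp: below_def intro: coneI)

lemma content_upper: "f \<in> below U \<Longrightarrow> ennreal (I f) \<le> content U"
  unfolding content_def by (rule SUP_upper)

lemma content_mono: "U \<subseteq> V \<Longrightarrow> content U \<le> content V"
  unfolding content_def by (rule SUP_subset_mono) (auto simp: below_def)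

lemma content_UNIV: "content UNIV = ennreal (I (\<lambda>_. 1))"
proof (rule antisym)
  have one: "(\<lambda>_. 1) \<in> cone" by (auto intro: coneI)
  show "content UNIV \<le> ennreal (I (\<lambda>_. 1))"
    unfolding content_def by (intro SUP_least ennreal_leI mono one) (auto simp: below_def)
  show "ennreal (I (\<lambda>_. 1)) \<le> content UNIV"
    by (rule content_upper) (use one in \<open>auto simp: below_def\<close>)
qed

lemma outer_open: "open U \<Longrightarrow> outer U = content U"
  unfolding outer_def by (intro antisym INF_lower INF_greatest) (auto intro: content_mono)

lemma outer_le: "open U \<Longrightarrow> A \<subseteq> U \<Longrightarrow> outer A \<le> content U"
  unfolding outer_def by (intro INF_lower) auto

lemma outer_mono: "A \<subseteq> B \<Longrightarrow> outer A \<le> outer B"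
  unfolding outer_def by (intro INF_superset_mono) auto

lemma outer_finite: "outer A < \<infinity>"
  using outer_le[of UNIV A] by (auto simp: content_UNIV intro: le_less_trans)

lemma outer_empty: "outer {} = 0"
proof -
  have "I f = 0" if "f \<in> below {}" for f
  proof -
    have "f = (\<lambda>_. 0)" using that by (auto simp: below_def)
    then show ?thesis by (simp add: zero)
  qed
  then have "content {} \<le> 0"
    unfolding content_def by (intro SUP_least) simp
  then show ?thesis by (simp add: outer_open)
qed

lemma outer_approx:
  assumes "\<epsilon> > 0"
  shows "\<exists>U. open U \<and> A \<subseteq> U \<and> content U \<le> outer A + ennreal \<epsilon>"
proof (rule ccontr)
  assume "\<not> ?thesis"
  then have "outer A + ennreal \<epsilon> \<le> outer A"
    unfolding outer_def[of A] by (intro INF_greatest) (auto simp: not_le outer_def[symmetric] intro: less_imp_le)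
  then show False using outer_finite[of A] assms
    by (metis add.right_neutral ennreal_0 ennreal_add_left_cancel_le ennreal_eq_0_iff infinity_ennreal_def leD le_zero_eq less_irrefl not_le)
qed

text \<open>With bumps \<open>d k\<close> positive exactly on \<open>U k\<close>, the functions \<open>min f (n * (\<Sum>k<n. d k))\<close> increase
  to \<open>f\<close> and are dominated by \<open>\<Sum>k<n. min f (n * d k)\<close>; so no partition of unity is needed.\<close>

lemma content_UN_le:
  fixes U :: "nat \<Rightarrow> 'a set"
  assumes U: "\<And>n. open (U n)"
  shows "content (\<Union>n. U n) \<le> (\<Sum>n. content (U n))"
  unfolding content_def[of "\<Union>n. U n"]
proof (rule SUP_least)
  fix f assume f: "f \<in> below (\<Union>n. U n)"
  then have fc: "f \<in> cone" and f1: "\<And>x. f x \<le> 1" and f0: "\<And>x. x \<notin> (\<Union>n. U n) \<Longrightarrow> f x = 0"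
    by (auto simp: below_def)
  obtain d where d: "\<And>k. d k \<in> cone" "\<And>k x. d k x > 0 \<longleftrightarrow> x \<in> U k"
    using open_bump[OF U] by metis
  have d0: "0 \<le> d k x" for k x using cone_nonneg[OF d(1)] .
  let ?g = "\<lambda>n x. min (f x) (real n * (\<Sum>k<n. d k x))"
  let ?h = "\<lambda>n k x. min (f x) (real n * d k x)"
  have h: "?h n k \<in> below (U k)" for n k
  proof -
    have "?h n k x = 0" if "x \<notin> U k" for x
      using d(2)[of k x] d0[of k x] that cone_nonneg[OF fc, of x] by simp
    moreover have "?h n k \<in> cone"
      using fc d(1)[of k] by (auto simp: cone_def intro!: bounded_continuous_intros)
    ultimately show ?thesis using f1 by (auto simp: below_def min_le_iff_disj)
  qed
  have g: "?g n \<in> cone" for n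
    using fc d(1) by (auto simp: cone_def intro!: bounded_continuous_intros mult_nonneg_nonneg sum_nonneg)
  have subadd: "min a (\<Sum>k<n. b k) \<le> (\<Sum>k<n. min a (b k))" if "0 \<le> a" "\<And>k. 0 \<le> b k" for a n and b :: "nat \<Rightarrow> real"
  proof (induction n)
    case (Suc n)
    have "0 \<le> (\<Sum>k<n. min a (b k))" using that by (intro sum_nonneg) simp
    with Suc that(1) that(2)[of n] show ?case by simp
  qed (use that in simp)
  have Ig: "ennreal (I (?g n)) \<le> (\<Sum>n. content (U n))" for n
  proof -
    have "I (?g n) \<le> I (\<lambda>x. \<Sum>k<n. ?h n k x)"
    proof (rule mono[OF g])
      show "(\<lambda>x. \<Sum>k<n. ?h n k x) \<in> cone"
        by (rule coneI[OF bounded_continuous_sum sum_nonneg])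
          (rule cone_bounded_continuous[OF below_cone[OF h]], rule cone_nonneg[OF below_cone[OF h]])
      show "?g n x \<le> (\<Sum>k<n. ?h n k x)" for x
        unfolding sum_distrib_left by (rule subadd) (simp_all add: cone_nonneg[OF fc] d0)
    qed
    also have "\<dots> = (\<Sum>k<n. I (?h n k))" by (intro sum below_cone[OF h])
    finally have "ennreal (I (?g n)) \<le> ennreal (\<Sum>k<n. I (?h n k))" by (rule ennreal_leI)
    also have "\<dots> = (\<Sum>k<n. ennreal (I (?h n k)))"
      by (intro sum_ennreal[symmetric] nonneg below_cone[OF h])
    also have "\<dots> \<le> (\<Sum>k<n. content (U k))" by (intro sum_mono content_upper h)
    also have "\<dots> \<le> (\<Sum>n. content (U n))" by (intro sum_le_suminf) auto
    finally show ?thesis .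
  qed
  show "ennreal (I f) \<le> (\<Sum>n. content (U n))"
  proof (cases "(\<Sum>n. content (U n)) = \<infinity>")
    case False
    then obtain B where B: "(\<Sum>n. content (U n)) = ennreal B" "0 \<le> B"
      by (metis ennreal_cases infinity_ennreal_def)
    have "I f \<le> B"
    proof (rule monotone_limit_le[OF fc g])
      show "?g n x \<le> ?g (Suc n) x" for n x
      proof -
        have "real n * (\<Sum>k<n. d k x) \<le> real (Suc n) * (\<Sum>k<Suc n. d k x)"
          using d0 by (intro mult_mono) (auto intro: sum_nonneg)
        then show ?thesis by linarith
      qed
      show "I (?g n) \<le> B" for n using Ig[of n] B by (simp add: ennreal_le_iff)
      fix x and \<epsilon> :: real assume "\<epsilon> > 0"
      show "\<exists>n. f x - ?g n x < \<epsilon>"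
      proof (cases "x \<in> (\<Union>n. U n)")
        case True
        then obtain k where "0 < d k x" using d(2) by blast
        obtain m where m: "1 < real m * d k x" using reals_Archimedean3[OF \<open>0 < d k x\<close>] by blast
        \<comment> \<open>The index must exceed \<open>k\<close> for \<open>d k\<close> to occur in
          the sum, and reach \<open>m\<close> for the factor to lift that term above 1, hence above
          \<open>f x\<close>.\<close>
        define n where "n = max m (Suc k)"
        have "real m * d k x \<le> real n * (\<Sum>k<n. d k x)"
          using d0 by (intro mult_mono) (auto simp: n_def intro!: member_le_sum[of k])
        then have "?g n x = f x" using m f1[of x] by simp
        then show ?thesis using \<open>\<epsilon> > 0\<close> by (intro exI[of _ n]) simp
      next
        case False
        then show ?thesis using f0[of x] \<open>\<epsilon> > 0\<close> d0 by (intro exI[of _ 0]) simp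
      qed
    qed
    then show ?thesis using B by (simp add: ennreal_leI)
  qed simp
qed

lemma outer_countably_subadditive:
  fixes A :: "nat \<Rightarrow> 'a set"
  shows "outer (\<Union>n. A n) \<le> (\<Sum>n. outer (A n))"
proof (rule ennreal_le_epsilon)
  fix e :: real assume "e > 0"
  have "\<exists>U. open U \<and> A n \<subseteq> U \<and> content U \<le> outer (A n) + ennreal (e * (1/2) ^ Suc n)" for n
    using \<open>e > 0\<close> by (intro outer_approx) simp
  then obtain U where U: "\<And>n. open (U n)" "\<And>n. A n \<subseteq> U n"
    "\<And>n. content (U n) \<le> outer (A n) + ennreal (e * (1/2) ^ Suc n)" by metis
  have "outer (\<Union>n. A n) \<le> content (\<Union>n. U n)"
    using U by (intro outer_le) auto
  also have "\<dots> \<le> (\<Sum>n. content (U n))" by (rule content_UN_le[OF U(1)])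
  also have "\<dots> \<le> (\<Sum>n. outer (A n) + ennreal (e * (1/2) ^ Suc n))" by (intro suminf_le U(3)) auto
  also have "\<dots> = (\<Sum>n. outer (A n)) + (\<Sum>n. ennreal (e * (1/2) ^ Suc n))" by (intro suminf_add[symmetric]) auto
  also have "(\<Sum>n. ennreal (e * (1/2) ^ Suc n)) = ennreal e"
    using \<open>e > 0\<close> sums_mult[OF power_half_series, of e]
    by (intro suminf_ennreal_eq) auto
  finally show "outer (\<Union>n. A n) \<le> (\<Sum>n. outer (A n)) + ennreal e" .
qed

text \<open>Caratheodory's condition for open sets. Given a competitor \<open>f\<close> for
  \<open>V \<inter> U\<close>, the open set where \<open>f < \<delta>\<close> covers
  \<open>V - U\<close>. Once the height \<open>\<delta>\<close> is cut off \<open>f\<close>, it is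
  positive only where competitors for that open set vanish, so the sum competes for
  \<open>V\<close>; the loss is at most \<open>\<delta>\<close> times the total mass.\<close>

lemma outer_open_split:
  assumes U: "open U"
  shows "outer (A \<inter> U) + outer (A - U) \<le> outer A"
proof -
  have one: "(\<lambda>_. 1) \<in> cone" by (auto intro: coneI)
  have *: "ennreal (I f) + outer (V - U) \<le> content V" if V: "open V" and f: "f \<in> below (V \<inter> U)" for V f
  proof (rule ennreal_le_epsilon)
    fix e :: real assume "e > 0"
    define \<delta> where "\<delta> = min 1 (e / (I (\<lambda>_. 1) + 1))"
    have \<delta>: "\<delta> > 0" "\<delta> * I (\<lambda>_. 1) \<le> e"
    proof -
      have "\<delta> * I (\<lambda>_. 1) \<le> e / (I (\<lambda>_. 1) + 1) * I (\<lambda>_. 1)"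
        using nonneg[OF one] by (intro mult_right_mono) (auto simp: \<delta>_def)
      also have "\<dots> \<le> e" using \<open>e > 0\<close> nonneg[OF one] by (simp add: field_simps)
      finally show "\<delta> * I (\<lambda>_. 1) \<le> e" .
    qed (use \<open>e > 0\<close> nonneg[OF one] in \<open>auto simp: \<delta>_def\<close>)
    have fc: "f \<in> cone" using f by (rule below_cone)
    let ?f = "\<lambda>x. max 0 (f x - \<delta>)"
    have f': "?f \<in> cone" using fc by (auto simp: cone_def intro!: bounded_continuous_intros)
    let ?W = "V \<inter> {x. f x < \<delta>}"
    have W: "open ?W"
      by (intro open_Int V open_Collect_less continuous_on_const bounded_continuousD(1) cone_bounded_continuous fc)
    have sub: "V - U \<subseteq> ?W" using f \<delta>(1) by (auto simp: below_def)
    have "ennreal (I ?f) + ennreal (I g) \<le> content V" if g: "g \<in> below ?W" for g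
    proof -
      have gc: "g \<in> cone" using g by (rule below_cone)
      have "(\<lambda>x. ?f x + g x) \<in> below V"
      proof -
        have "?f x + g x \<le> 1" for x
        proof -
          have "f x \<le> 1" "g x \<le> 1" "f x < \<delta> \<or> g x = 0" using f g by (auto simp: below_def)
          then show ?thesis using \<delta>(1) by auto
        qed
        moreover have "?f x + g x = 0" if "x \<notin> V" for x
          using f g that \<delta>(1) by (auto simp: below_def)
        moreover have "(\<lambda>x. ?f x + g x) \<in> cone"
          using f' gc by (auto simp: cone_def intro!: bounded_continuous_intros)
        ultimately show ?thesis by (simp add: below_def)
      qed
      then have "ennreal (I (\<lambda>x. ?f x + g x)) \<le> content V" by (rule content_upper)
      then show ?thesis using nonneg[OF f'] nonneg[OF gc] by (simp add: add[OF f' gc])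
    qed
    then have "ennreal (I ?f) + content ?W \<le> content V"
      unfolding content_def[of ?W] using zero_below[of ?W]
      by (subst ennreal_SUP_add_right) (auto intro: SUP_least)
    moreover have "ennreal (I f) \<le> ennreal (I ?f) + ennreal e"
    proof -
      have d: "(\<lambda>_. \<delta>) \<in> cone" using \<delta>(1) by (auto intro: coneI)
      have "I f \<le> I (\<lambda>x. ?f x + \<delta>)"
        by (rule mono[OF fc]) (use f' d in \<open>auto simp: cone_def intro!: bounded_continuous_intros\<close>)
      also have "\<dots> = I ?f + \<delta> * I (\<lambda>_. 1)" using \<delta>(1) by (simp add: add[OF f' d] const[of \<delta>])
      also have "\<dots> \<le> I ?f + e" using \<delta>(2) by simp
      finally show ?thesis using nonneg[OF f'] \<open>e > 0\<close> by (simp add: ennreal_leI flip: ennreal_plus)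
    qed
    moreover have "outer (V - U) \<le> content ?W" by (rule outer_le[OF W sub])
    ultimately have "ennreal (I f) + outer (V - U) \<le> (ennreal (I ?f) + ennreal e) + content ?W"
      by (intro add_mono)
    also have "\<dots> = (ennreal (I ?f) + content ?W) + ennreal e" by (simp add: ac_simps)
    also have "\<dots> \<le> content V + ennreal e"
      using \<open>ennreal (I ?f) + content ?W \<le> content V\<close> by (rule add_right_mono)
    finally show "ennreal (I f) + outer (V - U) \<le> content V + ennreal e" .
  qed
  have "outer (A \<inter> U) + outer (A - U) \<le> content V" if V: "open V" "A \<subseteq> V" for V
  proof -
    have "outer (A \<inter> U) + outer (A - U) \<le> content (V \<inter> U) + outer (V - U)"
      using V U by (intro add_mono outer_le outer_mono) auto
    also have "\<dots> \<le> content V"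
      unfolding content_def[of "V \<inter> U"] using zero_below[of "V \<inter> U"] *[OF V(1)]
      by (subst ennreal_SUP_add_left[symmetric]) (auto intro: SUP_least)
    finally show ?thesis .
  qed
  then show ?thesis unfolding outer_def[of A] by (intro INF_greatest) auto
qed

lemma outer_Un_le: "outer (A \<union> B) \<le> outer A + outer B"
proof -
  have "outer (\<Union>n. binaryset A B n) \<le> (\<Sum>n. outer (binaryset A B n))" by (rule outer_countably_subadditive)
  also have "\<dots> = outer A + outer B"
    by (rule sums_unique[symmetric]) (rule binaryset_sums[of outer, OF outer_empty])
  finally show ?thesis by (simp add: UN_binaryset_eq)
qed

lemma outer_measure_space_outer: "outer_measure_space (Pow UNIV) outer"
  unfolding outer_measure_space_def
  by (auto simp: positive_def outer_empty increasing_def outer_mono countably_subadditive_def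
      outer_countably_subadditive)

definition riesz_measure :: "'a measure" where
  "riesz_measure = measure_of UNIV (sets borel) outer"

lemma sets_riesz_measure [simp]: "sets riesz_measure = sets borel"
  unfolding riesz_measure_def by (simp add: sets.sets_measure_of_eq[of borel, simplified])

lemma space_riesz_measure [simp]: "space riesz_measure = UNIV"
  using sets_eq_imp_space_eq[OF sets_riesz_measure] by simp

text \<open>By \<open>outer_open_split\<close> the Caratheodory sigma-algebra contains the open
  sets, hence all Borel sets, and \<open>outer\<close> is countably additive there.\<close>

lemma emeasure_riesz_measure:
  assumes "A \<in> sets borel"
  shows "emeasure riesz_measure A = outer A"
proof -
  interpret P: sigma_algebra UNIV "Pow (UNIV :: 'a set)" by (rule sigma_algebra_Pow)
  have ms: "measure_space UNIV (lambda_system UNIV (Pow UNIV) outer) outer"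
    by (rule P.caratheodory_lemma[OF outer_measure_space_outer])
  have "U \<in> lambda_system UNIV (Pow UNIV) outer" if "open U" for U
  proof -
    have "outer (x \<inter> U) + outer (x - U) = outer x" for x
      using outer_open_split[OF that, of x] outer_Un_le[of "x \<inter> U" "x - U"]
      by (intro antisym) (auto simp: Int_Diff_Un)
    then show ?thesis unfolding P.lambda_system_eq by simp
  qed
  moreover have "sigma_algebra UNIV (lambda_system UNIV (Pow UNIV) outer)"
    using ms unfolding measure_space_def by blast
  ultimately have "sigma_sets UNIV {S. open S} \<subseteq> lambda_system UNIV (Pow UNIV) outer"
    by (intro sigma_algebra.sigma_sets_subset) auto
  then have sub: "sets borel \<subseteq> lambda_system UNIV (Pow UNIV) outer"
    unfolding borel_def by simp
  show ?thesis
    unfolding riesz_measure_def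
  proof (rule emeasure_measure_of_sigma)
    show "sigma_algebra UNIV (sets (borel :: 'a measure))"
      using sets.sigma_algebra_axioms[of "borel :: 'a measure"] by simp
    show "positive (sets borel) outer" by (simp add: positive_def outer_empty)
    show "countably_additive (sets borel) outer"
      using ms sub unfolding measure_space_def countably_additive_def by blast
  qed (rule assms)
qed

lemma finite_measure_riesz: "finite_measure riesz_measure"
  using outer_finite[of UNIV] by (intro finite_measureI) (simp add: emeasure_riesz_measure)

lemma measure_riesz_open_ge:
  assumes "open U" "f \<in> below U"
  shows "I f \<le> measure riesz_measure U"
proof -
  interpret finite_measure riesz_measure by (rule finite_measure_riesz)
  have "ennreal (I f) \<le> emeasure riesz_measure U"
    using content_upper[OF assms(2)] assms(1) by (simp add: emeasure_riesz_measure outer_open)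
  then show ?thesis by (simp add: emeasure_eq_measure ennreal_le_iff)
qed

lemma measure_riesz_UNIV: "measure riesz_measure UNIV = I (\<lambda>_. 1)"
  using nonneg[of "\<lambda>_. 1"]
  by (simp add: measure_def emeasure_riesz_measure outer_open content_UNIV cone_def)

text \<open>A competitor for the complement of \<open>K\<close> is 0 on \<open>K\<close>, where
  alone monotonicity compares functions.\<close>

lemma measure_riesz_off: "measure riesz_measure (- K) = 0"
proof -
  have z: "(\<lambda>_. 0) \<in> cone" by (auto intro: coneI)
  have "I f \<le> 0" if "f \<in> below (- K)" for f
    using mono[OF below_cone[OF that] z] that by (auto simp: below_def zero)
  then have "content (- K) \<le> 0"
    unfolding content_def by (intro SUP_least) (simp add: ennreal_neg)
  then show ?thesis
    using compact_imp_closed[OF K] by (simp add: measure_def emeasure_riesz_measure outer_open open_Compl)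
qed

lemma integrable_riesz:
  assumes "bounded_continuous f"
  shows "integrable riesz_measure f"
proof -
  interpret finite_measure riesz_measure by (rule finite_measure_riesz)
  obtain c where "\<And>x. \<bar>f x\<bar> \<le> c" using assms by (auto simp: bounded_continuous_def)
  moreover have "f \<in> borel_measurable riesz_measure"
    using borel_measurable_continuous_onI[OF bounded_continuousD(1)[OF assms]]
    unfolding measurable_cong_sets[OF sets_riesz_measure refl] .
  ultimately show ?thesis by (intro integrable_const_bound[of _ c]) auto
qed

text \<open>Slice \<open>f\<close> into the layers between heights \<open>i/n\<close> and \<open>(i+1)/n\<close>. The mass of
  \<open>{x. f x > (i+1)/n}\<close> is at least \<open>n\<close> times the value of \<open>I\<close> on layer \<open>i+1\<close> and at most \<open>n\<close> times
  the integral of layer \<open>i\<close>.\<close>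

lemma le_integral_riesz_unit:
  assumes f: "f \<in> cone" and f1: "\<And>x. f x \<le> 1"
  shows "I f \<le> (\<integral>x. f x \<partial>riesz_measure)"
proof (rule field_le_epsilon)
  fix \<epsilon> :: real assume \<epsilon>: "\<epsilon> > 0"
  interpret finite_measure riesz_measure by (rule finite_measure_riesz)
  have one: "(\<lambda>_. 1) \<in> cone" by (auto intro: coneI)
  obtain k where "I (\<lambda>_. 1) / \<epsilon> < real k" using reals_Archimedean2 by blast
  then have k: "I (\<lambda>_. 1) / real (Suc k) \<le> \<epsilon>"
    using \<epsilon> nonneg[OF one] by (simp add: field_simps)
  define N where "N = real (Suc k)"
  have N: "N > 0" by (simp add: N_def)
  define h where "h i x = min (f x) (real (Suc i) / N) - min (f x) (real i / N)" for i x
  have h0: "0 \<le> h i x" and hN: "h i x \<le> 1 / N" for i x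
  proof -
    have "real i / N \<le> real (Suc i) / N" "real (Suc i) / N = real i / N + 1 / N"
      using N by (auto simp: field_simps)
    then show "0 \<le> h i x" "h i x \<le> 1 / N" unfolding h_def by linarith+
  qed
  have hc: "h i \<in> cone" for i
  proof (rule coneI[OF _ h0])
    show "bounded_continuous (h i)"
      unfolding h_def[abs_def]
      by (intro bounded_continuous_diff bounded_continuous_min bounded_continuous_const cone_bounded_continuous[OF f])
  qed
  have sum_h: "(\<Sum>i<Suc k. h i x) = f x" for x
  proof -
    have "(\<Sum>i<Suc k. h i x) = min (f x) (real (Suc k) / N) - min (f x) (real 0 / N)"
      unfolding h_def by (rule sum_lessThan_telescope)
    then show ?thesis using f1[of x] cone_nonneg[OF f, of x] by (simp add: N_def)
  qed
  have step: "I (h (Suc i)) \<le> (\<integral>x. h i x \<partial>riesz_measure)" for i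
  proof -
    let ?U = "{x. real (Suc i) / N < f x}"
    have U: "open ?U"
      by (intro open_Collect_less continuous_on_const bounded_continuousD(1) cone_bounded_continuous f)
    have "(\<lambda>x. N * h (Suc i) x) \<in> below ?U"
    proof -
      have "(\<lambda>x. N * h (Suc i) x) \<in> cone"
        using hc[of "Suc i"] N by (auto simp: cone_def intro!: bounded_continuous_intros)
      moreover have "N * h (Suc i) x \<le> 1" for x using hN[of "Suc i" x] N by (simp add: field_simps)
      moreover have "N * h (Suc i) x = 0" if "x \<notin> ?U" for x
      proof -
        have "f x \<le> real (Suc i) / N" using that by simp
        moreover have "real (Suc i) / N \<le> real (Suc (Suc i)) / N" using N by (auto simp: field_simps)
        ultimately show ?thesis by (simp add: h_def)
      qed
      ultimately show ?thesis by (simp add: below_def)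
    qed
    from measure_riesz_open_ge[OF U this] have "N * I (h (Suc i)) \<le> measure riesz_measure ?U"
      using scale[OF hc[of "Suc i"], of N] N by (simp only: less_imp_le)
    also have "measure riesz_measure ?U = (\<integral>x. indicator ?U x \<partial>riesz_measure)" by simp
    also have "\<dots> \<le> (\<integral>x. N * h i x \<partial>riesz_measure)"
    proof (rule integral_mono)
      show "integrable riesz_measure (indicator ?U :: 'a \<Rightarrow> real)"
        using U by (intro integrable_real_indicator) (auto simp: emeasure_eq_measure)
      show "integrable riesz_measure (\<lambda>x. N * h i x)"
        by (intro integrable_mult_right integrable_riesz cone_bounded_continuous hc)
      fix x
      have "N * h i x = 1" if "x \<in> ?U"
      proof -
        have "real i / N \<le> real (Suc i) / N" using N by (auto simp: field_simps)
        then have "h i x = real (Suc i) / N - real i / N" using that by (simp add: h_def)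
        then show ?thesis using N by (simp add: field_simps)
      qed
      then show "indicator ?U x \<le> N * h i x"
        using h0[of i x] N by (auto simp: indicator_def)
    qed
    finally show ?thesis using N by simp
  qed
  \<comment> \<open>The lowest layer has none beneath it to be compared with; its height
    \<open>1 / N\<close> makes it negligible by the choice of \<open>k\<close>.\<close>
  have "I (h 0) \<le> I (\<lambda>_. 1 / N)"
    using hN N by (intro mono hc coneI) auto
  also have "\<dots> = I (\<lambda>_. 1) / N" using const[of "1 / N"] N by simp
  also have "\<dots> \<le> \<epsilon>" using k by (simp add: N_def)
  finally have h0e: "I (h 0) \<le> \<epsilon>" .
  have "I f = I (\<lambda>x. \<Sum>i<Suc k. h i x)" by (simp only: sum_h)
  also have "\<dots> = (\<Sum>i<Suc k. I (h i))" by (rule sum[OF hc])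
  also have "\<dots> = I (h 0) + (\<Sum>i<k. I (h (Suc i)))" by (rule sum.lessThan_Suc_shift)
  also have "\<dots> \<le> \<epsilon> + (\<Sum>i<k. \<integral>x. h i x \<partial>riesz_measure)" by (intro add_mono h0e sum_mono step)
  also have "(\<Sum>i<k. \<integral>x. h i x \<partial>riesz_measure) = (\<integral>x. (\<Sum>i<k. h i x) \<partial>riesz_measure)"
    by (intro Bochner_Integration.integral_sum[symmetric] integrable_riesz cone_bounded_continuous hc)
  also have "\<dots> \<le> (\<integral>x. f x \<partial>riesz_measure)"
  proof (rule integral_mono)
    show "(\<Sum>i<k. h i x) \<le> f x" for x using sum_h[of x] h0[of k x] by simp
  qed (intro integrable_riesz bounded_continuous_sum cone_bounded_continuous hc f)+
  finally show "I f \<le> (\<integral>x. f x \<partial>riesz_measure) + \<epsilon>" by simp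
qed

text \<open>The inequality already proved, applied to \<open>c - f\<close>, gives the reverse one,
  because the functional and the measure have the same total mass. Scaling by
  \<open>1 / (c + 1)\<close> reduces to functions bounded by 1.\<close>

lemma eq_integral_riesz:
  assumes f: "f \<in> cone"
  shows "I f = (\<integral>x. f x \<partial>riesz_measure)"
proof -
  interpret finite_measure riesz_measure by (rule finite_measure_riesz)
  have le: "I f \<le> (\<integral>x. f x \<partial>riesz_measure)" if f: "f \<in> cone" for f
  proof -
    obtain c where c: "c \<ge> 0" "\<And>x. \<bar>f x\<bar> \<le> c" using bounded_continuousD(2)[OF cone_bounded_continuous[OF f]] by blast
    let ?f = "\<lambda>x. 1 / (c + 1) * f x"
    have "?f \<in> cone" using f c(1) by (auto simp: cone_def intro!: bounded_continuous_scale simp del: times_divide_eq_left)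
    moreover have "?f x \<le> 1" for x using c(1) c(2)[of x] by (simp add: field_simps)
    ultimately have "I ?f \<le> (\<integral>x. ?f x \<partial>riesz_measure)" by (rule le_integral_riesz_unit)
    then show ?thesis using c(1) scale[OF f, of "1 / (c + 1)"] by (simp add: field_simps)
  qed
  obtain c where c: "c \<ge> 0" "\<And>x. \<bar>f x\<bar> \<le> c" using bounded_continuousD(2)[OF cone_bounded_continuous[OF f]] by blast
  have g: "(\<lambda>x. c - f x) \<in> cone"
    by (rule coneI[OF bounded_continuous_diff[OF bounded_continuous_const cone_bounded_continuous[OF f]]])
      (use c(2) in \<open>simp add: abs_le_iff\<close>)
  have "c * I (\<lambda>_. 1) = I (\<lambda>x. (c - f x) + f x)" using const[OF c(1)] by simp
  also have "\<dots> = I (\<lambda>x. c - f x) + I f" by (rule add[OF g f])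
  also have "I (\<lambda>x. c - f x) \<le> (\<integral>x. c - f x \<partial>riesz_measure)" by (rule le[OF g])
  also have "\<dots> = c * I (\<lambda>_. 1) - (\<integral>x. f x \<partial>riesz_measure)"
    using integrable_riesz[OF cone_bounded_continuous[OF f]]
    by (simp add: measure_riesz_UNIV mult.commute)
  finally show ?thesis using le[OF f] by simp
qed

end

section \<open>Bounded functionals as differences of positive ones\<close>

locale bounded_functional =
  fixes L :: "('a::metric_space \<Rightarrow> real) \<Rightarrow> real" and K :: "'a set" and C :: real
  assumes K: "compact K"
    and add: "bounded_continuous f \<Longrightarrow> bounded_continuous g \<Longrightarrow> L (\<lambda>x. f x + g x) = L f + L g"
    and scale: "bounded_continuous f \<Longrightarrow> L (\<lambda>x. c * f x) = c * L f"
    and bound: "bounded_continuous f \<Longrightarrow> (\<And>x. \<bar>f x\<bar> \<le> c) \<Longrightarrow> L f \<le> C * c"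
    and local: "bounded_continuous f \<Longrightarrow> (\<And>x. x \<in> K \<Longrightarrow> f x = 0) \<Longrightarrow> L f = 0"
begin

lemma diff: "bounded_continuous f \<Longrightarrow> bounded_continuous g \<Longrightarrow> L (\<lambda>x. f x - g x) = L f - L g"
  using add[OF _ bounded_continuous_scale[of g "-1"], of f] scale[of g "-1"] by simp

lemma cong_on:
  "bounded_continuous f \<Longrightarrow> bounded_continuous g \<Longrightarrow> (\<And>x. x \<in> K \<Longrightarrow> f x = g x) \<Longrightarrow> L f = L g"
  using local[of "\<lambda>x. f x - g x"] diff[of f g] by (simp add: bounded_continuous_diff)

definition minorants :: "('a \<Rightarrow> real) \<Rightarrow> ('a \<Rightarrow> real) set" where
  "minorants f = {g\<in>cone. \<forall>x. g x \<le> f x}"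

definition pos :: "('a \<Rightarrow> real) \<Rightarrow> real" where
  "pos f = (SUP g\<in>minorants f. L g)"

definition neg :: "('a \<Rightarrow> real) \<Rightarrow> real" where
  "neg f = pos f - L f"

lemma zero: "L (\<lambda>_. 0) = 0"
  by (rule local) auto

lemma zero_minorant: "f \<in> cone \<Longrightarrow> (\<lambda>_. 0) \<in> minorants f"
  by (auto simp: minorants_def cone_def)

lemma bdd_minorants:
  assumes "f \<in> cone"
  shows "bdd_above (L ` minorants f)"
proof -
  obtain c where c: "\<And>x. \<bar>f x\<bar> \<le> c"
    using bounded_continuousD(2)[OF cone_bounded_continuous[OF assms]] by blast
  have "L g \<le> C * c" if g: "g \<in> minorants f" for g
  proof (rule bound)
    show "bounded_continuous g" using g by (auto simp: minorants_def cone_def)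
    show "\<bar>g x\<bar> \<le> c" for x
    proof -
      have "0 \<le> g x" "g x \<le> f x" using g by (auto simp: minorants_def cone_def)
      then show ?thesis using c[of x] by linarith
    qed
  qed
  then show ?thesis by (rule bdd_aboveI2)
qed

lemma pos_upper: "f \<in> cone \<Longrightarrow> g \<in> minorants f \<Longrightarrow> L g \<le> pos f"
  unfolding pos_def by (rule cSUP_upper[OF _ bdd_minorants])

lemma pos_least: "f \<in> cone \<Longrightarrow> (\<And>g. g \<in> minorants f \<Longrightarrow> L g \<le> b) \<Longrightarrow> pos f \<le> b"
  unfolding pos_def using zero_minorant by (intro cSUP_least) auto

text \<open>Riesz decomposition: a minorant \<open>h\<close> of \<open>f + g\<close> splits into
  \<open>min h f\<close>, a minorant of \<open>f\<close>, and the remainder, a minorant of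
  \<open>g\<close>.\<close>

lemma pos_add:
  assumes f: "f \<in> cone" and g: "g \<in> cone"
  shows "pos (\<lambda>x. f x + g x) = pos f + pos g"
proof (rule antisym)
  have fg: "(\<lambda>x. f x + g x) \<in> cone"
    using f g by (auto simp: cone_def intro!: bounded_continuous_add)
  show "pos (\<lambda>x. f x + g x) \<le> pos f + pos g"
  proof (rule pos_least[OF fg])
    fix h assume h: "h \<in> minorants (\<lambda>x. f x + g x)"
    then have hc: "h \<in> cone" and hle: "\<And>x. h x \<le> f x + g x" by (auto simp: minorants_def)
    have bc: "bounded_continuous f" "bounded_continuous g" "bounded_continuous h" using f g hc by (auto simp: cone_def)
    have 1: "(\<lambda>x. min (h x) (f x)) \<in> minorants f"
      using hc f bc by (auto simp: minorants_def cone_def intro!: bounded_continuous_min)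
    have 2: "(\<lambda>x. h x - min (h x) (f x)) \<in> minorants g"
    proof -
      have "h x - min (h x) (f x) \<le> g x" for x using hle[of x] cone_nonneg[OF g, of x] by linarith
      then show ?thesis using bc by (auto simp: minorants_def cone_def intro!: bounded_continuous_intros)
    qed
    have "L h = L (\<lambda>x. min (h x) (f x)) + L (\<lambda>x. h x - min (h x) (f x))"
      using bc by (simp add: diff bounded_continuous_min)
    then show "L h \<le> pos f + pos g"
      using pos_upper[OF f 1] pos_upper[OF g 2] by linarith
  qed
  have *: "L h \<le> pos (\<lambda>x. f x + g x) - L k" if "h \<in> minorants f" "k \<in> minorants g" for h k
  proof -
    have "(\<lambda>x. h x + k x) \<in> minorants (\<lambda>x. f x + g x)"
      using that by (auto simp: minorants_def cone_def intro!: bounded_continuous_add add_mono)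
    from pos_upper[OF fg this] show ?thesis
      using that by (simp add: add minorants_def cone_def)
  qed
  have "pos f \<le> pos (\<lambda>x. f x + g x) - L k" if "k \<in> minorants g" for k
    using * that by (intro pos_least f) auto
  then have "L k \<le> pos (\<lambda>x. f x + g x) - pos f" if "k \<in> minorants g" for k
    using that by force
  then have "pos g \<le> pos (\<lambda>x. f x + g x) - pos f"
    by (intro pos_least g) auto
  then show "pos f + pos g \<le> pos (\<lambda>x. f x + g x)" by simp
qed

lemma pos_scale:
  assumes f: "f \<in> cone" and c: "0 \<le> c"
  shows "pos (\<lambda>x. c * f x) = c * pos f"
proof -
  have le: "c * pos f \<le> pos (\<lambda>x. c * f x)" if f: "f \<in> cone" and c: "0 < c" for f c
  proof -
    have cf: "(\<lambda>x. c * f x) \<in> cone" using f c by (auto simp: cone_def intro!: bounded_continuous_scale)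
    have "pos f \<le> pos (\<lambda>x. c * f x) / c"
    proof (rule pos_least[OF f])
      fix g assume g: "g \<in> minorants f"
      then have "(\<lambda>x. c * g x) \<in> minorants (\<lambda>x. c * f x)"
        using c by (auto simp: minorants_def cone_def intro!: bounded_continuous_scale)
      from pos_upper[OF cf this] have "c * L g \<le> pos (\<lambda>x. c * f x)"
        using g by (simp add: scale minorants_def cone_def)
      then show "L g \<le> pos (\<lambda>x. c * f x) / c" using c by (simp add: field_simps)
    qed
    then show ?thesis using c by (simp add: field_simps)
  qed
  consider "c = 0" | "c > 0" using c by linarith
  then show ?thesis
  proof cases
    case 1
    have z: "(\<lambda>_. 0 :: real) \<in> cone" by (auto intro: coneI)
    have "L g = 0" if "g \<in> minorants (\<lambda>_. 0)" for g
    proof -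
      have "g = (\<lambda>_. 0)" using that by (auto simp: minorants_def cone_def intro!: ext antisym)
      then show ?thesis by (simp add: zero)
    qed
    then have "pos (\<lambda>_. 0) \<le> 0" by (intro pos_least z) simp
    moreover have "0 \<le> pos (\<lambda>_. 0)" using pos_upper[OF z zero_minorant[OF z]] by (simp add: zero)
    ultimately show ?thesis using 1 by simp
  next
    case 2
    have cf: "(\<lambda>x. c * f x) \<in> cone" using f c by (auto simp: cone_def intro!: bounded_continuous_scale)
    have "1 / c * pos (\<lambda>x. c * f x) \<le> pos (\<lambda>x. 1 / c * (c * f x))"
      using 2 by (intro le cf) simp
    then have "pos (\<lambda>x. c * f x) \<le> c * pos f" using 2 by (simp add: field_simps)
    with le[OF f 2] show ?thesis by simp
  qed
qed

text \<open>If \<open>h\<close> is a minorant of \<open>f\<close>, then \<open>min h g\<close> is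
  one of \<open>g\<close> and agrees with \<open>h\<close> on \<open>K\<close>, so \<open>L\<close>
  does not tell them apart.\<close>

lemma pos_mono:
  assumes f: "f \<in> cone" and g: "g \<in> cone" and le: "\<And>x. x \<in> K \<Longrightarrow> f x \<le> g x"
  shows "pos f \<le> pos g"
proof (rule pos_least[OF f])
  fix h assume h: "h \<in> minorants f"
  then have bc: "bounded_continuous h" and h0: "\<And>x. 0 \<le> h x" and hf: "\<And>x. h x \<le> f x"
    by (auto simp: minorants_def cone_def)
  have bg: "bounded_continuous g" using g by (rule cone_bounded_continuous)
  have "L h = L (\<lambda>x. min (h x) (g x))"
  proof (rule cong_on[OF bc bounded_continuous_min[OF bc bg]])
    show "h x = min (h x) (g x)" if "x \<in> K" for x using hf[of x] le[OF that] by linarith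
  qed
  also have "\<dots> \<le> pos g"
    using h0 cone_nonneg[OF g] by (intro pos_upper[OF g])
      (auto simp: minorants_def intro!: coneI bounded_continuous_min bc bg)
  finally show "L h \<le> pos g" .
qed

sublocale P: positive_functional pos K
  by unfold_locales (auto intro: K pos_add pos_scale pos_mono)

sublocale N: positive_functional neg K
proof
  show "compact K" by (rule K)
  fix f :: "'a \<Rightarrow> real" assume f: "f \<in> cone"
  show "neg (\<lambda>x. c * f x) = c * neg f" if "0 \<le> c" for c
    using f that by (simp add: neg_def pos_scale scale cone_bounded_continuous right_diff_distrib)
  fix g :: "'a \<Rightarrow> real" assume g: "g \<in> cone"
  show "neg (\<lambda>x. f x + g x) = neg f + neg g"
    using f g by (simp add: neg_def pos_add add cone_bounded_continuous)
  assume le: "\<And>x. x \<in> K \<Longrightarrow> f x \<le> g x"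
  \<comment> \<open>The inequality is assumed on \<open>K\<close> only. The maximum agrees with
    \<open>g\<close> there and exceeds \<open>f\<close> everywhere, so the difference lies in the
    cone and, being its own minorant, has nonnegative \<open>neg\<close>.\<close>
  let ?h = "\<lambda>x. max (f x) (g x)"
  have bc: "bounded_continuous f" "bounded_continuous g" using f g by (auto simp: cone_def)
  have h: "?h \<in> cone" using f bc by (auto simp: cone_def le_max_iff_disj intro!: bounded_continuous_max)
  have d: "(\<lambda>x. ?h x - f x) \<in> cone" using bc by (auto intro!: coneI bounded_continuous_intros)
  have eq: "?h x = g x" if "x \<in> K" for x using le[OF that] by simp
  have "neg g = neg ?h"
  proof -
    have "pos g = pos ?h" using pos_mono[OF g h] pos_mono[OF h g] eq by (simp add: antisym)
    moreover have "L g = L ?h" by (rule cong_on) (use bc eq in \<open>auto intro!: bounded_continuous_max\<close>)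
    ultimately show ?thesis by (simp add: neg_def)
  qed
  also have "\<dots> = neg f + neg (\<lambda>x. ?h x - f x)"
    using pos_add[OF f d] add[OF cone_bounded_continuous[OF f] cone_bounded_continuous[OF d]]
    by (simp add: neg_def)
  finally have "neg g = neg f + neg (\<lambda>x. ?h x - f x)" .
  moreover have "0 \<le> neg (\<lambda>x. ?h x - f x)"
    using pos_upper[OF d, of "\<lambda>x. ?h x - f x"] d by (auto simp: neg_def minorants_def)
  ultimately show "neg f \<le> neg g" by simp
qed

theorem riesz:
  assumes f: "bounded_continuous f"
  shows "L f = (\<integral>x. f x \<partial>P.riesz_measure) - (\<integral>x. f x \<partial>N.riesz_measure)"
proof -
  have *: "L f = (\<integral>x. f x \<partial>P.riesz_measure) - (\<integral>x. f x \<partial>N.riesz_measure)" if "f \<in> cone" for f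
    using P.eq_integral_riesz[OF that] N.eq_integral_riesz[OF that] by (simp add: neg_def)
  let ?p = "\<lambda>x. max 0 (f x)" and ?n = "\<lambda>x. max 0 (- f x)"
  have "bounded_continuous (\<lambda>x. - f x)" using bounded_continuous_scale[OF f, of "-1"] by simp
  then have bc: "bounded_continuous ?p" "bounded_continuous ?n" using f by (auto intro!: bounded_continuous_max)
  have pn: "?p \<in> cone" "?n \<in> cone" using bc by (auto intro!: coneI)
  have eq: "f = (\<lambda>x. ?p x - ?n x)" by auto
  have "L f = L ?p - L ?n" by (subst eq) (rule diff[OF bc])
  also have "\<dots> = ((\<integral>x. ?p x \<partial>P.riesz_measure) - (\<integral>x. ?n x \<partial>P.riesz_measure)) -
      ((\<integral>x. ?p x \<partial>N.riesz_measure) - (\<integral>x. ?n x \<partial>N.riesz_measure))"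
    by (simp add: *[OF pn(1)] *[OF pn(2)])
  also have "(\<integral>x. ?p x \<partial>P.riesz_measure) - (\<integral>x. ?n x \<partial>P.riesz_measure) = (\<integral>x. ?p x - ?n x \<partial>P.riesz_measure)"
    by (intro Bochner_Integration.integral_diff[symmetric] P.integrable_riesz bc)
  also have "(\<integral>x. ?p x \<partial>N.riesz_measure) - (\<integral>x. ?n x \<partial>N.riesz_measure) = (\<integral>x. ?p x - ?n x \<partial>N.riesz_measure)"
    by (intro Bochner_Integration.integral_diff[symmetric] N.integrable_riesz bc)
  finally show ?thesis by (simp only: eq[symmetric])
qed

end

lemma bounded_continuous_bounded_borel:
  "bounded_continuous (f :: plane \<Rightarrow> real) \<Longrightarrow> bounded_borel f"
  unfolding bounded_borel_def bounded_continuous_def by (auto intro: borel_measurable_continuous_onI)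

lemma riesz_signed_measure:
  fixes L :: "(plane \<Rightarrow> real) \<Rightarrow> real"
  assumes "bounded_functional L K C"
  shows "\<exists>\<mu>. signed_measure \<mu> \<and> vanishes_off K \<mu> \<and> (\<forall>f. bounded_continuous f \<longrightarrow> signed_integral \<mu> f = L f)"
proof -
  interpret bounded_functional L K C by fact
  let ?M = "P.riesz_measure" and ?N = "N.riesz_measure"
  let ?\<mu> = "measure_diff ?M ?N"
  have sm: "signed_measure ?\<mu>"
    by (intro signed_measure_measure_diff P.finite_measure_riesz N.finite_measure_riesz P.sets_riesz_measure N.sets_riesz_measure)
  moreover have "vanishes_off K ?\<mu>"
    unfolding vanishes_off_def
  proof (intro ballI impI)
    fix A :: "plane set" assume A: "A \<in> sets borel" "A \<inter> K = {}"
    then have sub: "A \<subseteq> - K" by blast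
    have "- K \<in> sets borel" using compact_imp_closed[OF K] by auto
    then have "measure ?M A \<le> measure ?M (- K)" "measure ?N A \<le> measure ?N (- K)"
      using sub A by (auto intro!: finite_measure.finite_measure_mono P.finite_measure_riesz N.finite_measure_riesz)
    then show "?\<mu> A = 0"
      using A(1) measure_nonneg[of ?M A] measure_nonneg[of ?N A]
      by (simp add: measure_diff_def P.measure_riesz_off N.measure_riesz_off)
  qed
  moreover have "signed_integral ?\<mu> f = L f" if "bounded_continuous f" for f
    unfolding riesz[OF that]
    by (intro signed_integral_eq sm P.finite_measure_riesz N.finite_measure_riesz P.sets_riesz_measure
        N.sets_riesz_measure bounded_continuous_bounded_borel that) (simp add: measure_diff_def)
  ultimately show ?thesis by blast
qed

section \<open>Duality\<close>

lemma subspace_with_norm_simps [simp]: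
  "carr (subspace_with_norm V N) = V" "nzero (subspace_with_norm V N) = 0"
  "nadd (subspace_with_norm V N) = (+)" "nscale (subspace_with_norm V N) = (*\<^sub>R)"
  "nnorm (subspace_with_norm V N) = N"
  by (simp_all add: subspace_with_norm_def)

text \<open>The axiom \<open>closed\<close> says that \<open>M\<close> is closed in
  \<open>V\<close>, written with distances to \<open>M\<close>; it turns the quotient seminorm into
  a norm.\<close>

locale normed_quotient =
  fixes V :: "'a::real_vector set" and N :: "'a \<Rightarrow> real" and M :: "'a set"
  assumes V: "subspace V" and M: "subspace M" and MV: "M \<subseteq> V"
    and nonneg: "x \<in> V \<Longrightarrow> 0 \<le> N x" and N0: "N 0 = 0"
    and scale: "x \<in> V \<Longrightarrow> N (a *\<^sub>R x) = \<bar>a\<bar> * N x"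
    and triangle: "x \<in> V \<Longrightarrow> y \<in> V \<Longrightarrow> N (x + y) \<le> N x + N y"
    and closed: "x \<in> V \<Longrightarrow> (\<And>\<epsilon>. \<epsilon> > 0 \<Longrightarrow> \<exists>m\<in>M. N (x + m) < \<epsilon>) \<Longrightarrow> x \<in> M"
begin

abbreviation Q :: "'a set nspace" where
  "Q \<equiv> quotient_nspace (subspace_with_norm V N) M"

definition cls :: "'a \<Rightarrow> 'a set" where
  "cls v = (+) v ` M"

lemma coset_eq: "coset (subspace_with_norm V N) M v = cls v"
  by (simp add: coset_def cls_def)

lemma mem_cls: "w \<in> cls v \<longleftrightarrow> w - v \<in> M"
  unfolding cls_def by (auto intro!: image_eqI[of _ _ "w - v"])

lemma carr_Q: "carr Q = cls ` V"
  by (simp add: quotient_nspace_def coset_eq[abs_def])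

lemma cls_eq: "cls u = cls v \<longleftrightarrow> u - v \<in> M"
proof
  assume "cls u = cls v"
  moreover have "u \<in> cls u" using subspace_0[OF M] by (simp add: mem_cls)
  ultimately show "u - v \<in> M" by (simp add: mem_cls)
next
  assume uv: "u - v \<in> M"
  have "w - u \<in> M \<longleftrightarrow> w - v \<in> M" for w
    using subspace_add[OF M uv, of "w - u"] subspace_diff[OF M _ uv, of "w - v"] by auto
  then show "cls u = cls v" by (auto simp: mem_cls)
qed

lemma cls_0: "cls 0 = M"
  by (auto simp: mem_cls)

lemma nzero_Q: "nzero Q = cls 0"
  by (simp add: quotient_nspace_def cls_0)

lemma nadd_Q: "nadd Q (cls u) (cls v) = cls (u + v)"
proof -
  have "w - (u + v) \<in> M \<longleftrightarrow> (\<exists>a b. w = a + b \<and> a - u \<in> M \<and> b - v \<in> M)" for w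
  proof
    assume *: "w - (u + v) \<in> M"
    show "\<exists>a b. w = a + b \<and> a - u \<in> M \<and> b - v \<in> M"
      by (rule exI[of _ u], rule exI[of _ "w - u"]) (use * subspace_0[OF M] in \<open>simp add: diff_diff_eq\<close>)
  next
    assume "\<exists>a b. w = a + b \<and> a - u \<in> M \<and> b - v \<in> M"
    then obtain a b where "w = a + b" "a - u \<in> M" "b - v \<in> M" by blast
    then show "w - (u + v) \<in> M" using subspace_add[OF M, of "a - u" "b - v"] by (simp add: algebra_simps)
  qed
  then show ?thesis by (intro set_eqI) (simp only: mem_cls, simp add: quotient_nspace_def mem_cls)
qed

lemma nscale_Q: "nscale Q c (cls u) = cls (c *\<^sub>R u)"
proof -
  have "w - c *\<^sub>R u \<in> M \<longleftrightarrow> (\<exists>a m. w = c *\<^sub>R a + m \<and> a - u \<in> M \<and> m \<in> M)" for w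
  proof
    assume *: "w - c *\<^sub>R u \<in> M"
    show "\<exists>a m. w = c *\<^sub>R a + m \<and> a - u \<in> M \<and> m \<in> M"
      by (rule exI[of _ u], rule exI[of _ "w - c *\<^sub>R u"]) (use * subspace_0[OF M] in simp)
  next
    assume "\<exists>a m. w = c *\<^sub>R a + m \<and> a - u \<in> M \<and> m \<in> M"
    then obtain a m where "w = c *\<^sub>R a + m" "a - u \<in> M" "m \<in> M" by blast
    then show "w - c *\<^sub>R u \<in> M"
      using subspace_add[OF M subspace_scale[OF M, of "a - u" c], of m] by (simp add: algebra_simps)
  qed
  then show ?thesis by (intro set_eqI) (simp only: mem_cls, simp add: quotient_nspace_def mem_cls)
qed

text \<open>The quotient norm read on representatives, where its laws follow by choosing elements of
  \<open>M\<close>.\<close>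

definition qnorm :: "'a \<Rightarrow> real" where
  "qnorm v = nnorm Q (cls v)"

lemma qnorm_eq: "qnorm v = (INF m\<in>M. N (v + m))"
  by (simp add: qnorm_def quotient_nspace_def cls_def image_image)

lemma shifted_V: "v \<in> V \<Longrightarrow> m \<in> M \<Longrightarrow> v + m \<in> V"
  using subspace_add[OF V] MV by blast

lemma bdd_below_shifted: "v \<in> V \<Longrightarrow> bdd_below ((\<lambda>m. N (v + m)) ` M)"
  using nonneg[OF shifted_V] by (auto intro!: bdd_belowI[of _ 0])

lemma qnorm_le: "v \<in> V \<Longrightarrow> m \<in> M \<Longrightarrow> qnorm v \<le> N (v + m)"
  unfolding qnorm_eq by (rule cINF_lower[OF bdd_below_shifted])

lemma qnorm_le_norm: "v \<in> V \<Longrightarrow> qnorm v \<le> N v"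
  using qnorm_le[of v 0] subspace_0[OF M] by simp

lemma qnorm_nonneg: "v \<in> V \<Longrightarrow> 0 \<le> qnorm v"
  unfolding qnorm_eq using subspace_0[OF M] nonneg[OF shifted_V] by (intro cINF_greatest) auto

lemma qnorm_approx:
  assumes "v \<in> V" "\<epsilon> > 0"
  shows "\<exists>m\<in>M. N (v + m) < qnorm v + \<epsilon>"
proof (rule ccontr)
  assume "\<not> ?thesis"
  then have "qnorm v + \<epsilon> \<le> qnorm v"
    unfolding qnorm_eq[of v] using subspace_0[OF M] by (intro cINF_greatest) (auto simp: not_less)
  then show False using assms(2) by simp
qed

lemma qnorm_scale_le:
  assumes "v \<in> V" "a \<noteq> 0"
  shows "qnorm (a *\<^sub>R v) \<le> \<bar>a\<bar> * qnorm v"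
proof (rule field_le_epsilon)
  fix \<epsilon> :: real assume "\<epsilon> > 0"
  then obtain m where m: "m \<in> M" "N (v + m) < qnorm v + \<epsilon> / \<bar>a\<bar>"
    using qnorm_approx[OF assms(1), of "\<epsilon> / \<bar>a\<bar>"] assms(2) by auto
  have "qnorm (a *\<^sub>R v) \<le> N (a *\<^sub>R v + a *\<^sub>R m)"
    using assms(1) m(1) by (intro qnorm_le subspace_scale[OF V] subspace_scale[OF M])
  also have "\<dots> = \<bar>a\<bar> * N (v + m)" using scale[OF shifted_V[OF assms(1) m(1)], of a] by (simp add: scaleR_add_right)
  also have "\<dots> \<le> \<bar>a\<bar> * (qnorm v + \<epsilon> / \<bar>a\<bar>)" using m(2) by (intro mult_left_mono) auto
  also have "\<dots> = \<bar>a\<bar> * qnorm v + \<epsilon>" using assms(2) by (simp add: distrib_left)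
  finally show "qnorm (a *\<^sub>R v) \<le> \<bar>a\<bar> * qnorm v + \<epsilon>" .
qed

lemma qnorm_0: "qnorm 0 = 0"
  using qnorm_le_norm[OF subspace_0[OF V]] qnorm_nonneg[OF subspace_0[OF V]] N0 by simp

lemma qnorm_scale:
  assumes "v \<in> V"
  shows "qnorm (a *\<^sub>R v) = \<bar>a\<bar> * qnorm v"
proof (cases "a = 0")
  case False
  have "qnorm (inverse a *\<^sub>R (a *\<^sub>R v)) \<le> \<bar>inverse a\<bar> * qnorm (a *\<^sub>R v)"
    using False assms by (intro qnorm_scale_le subspace_scale[OF V]) auto
  then have "\<bar>a\<bar> * qnorm v \<le> qnorm (a *\<^sub>R v)" using False by (simp add: abs_inverse field_simps)
  with qnorm_scale_le[OF assms False] show ?thesis by simp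
qed (simp add: qnorm_0)

lemma qnorm_triangle:
  assumes "u \<in> V" "v \<in> V"
  shows "qnorm (u + v) \<le> qnorm u + qnorm v"
proof (rule field_le_epsilon)
  fix \<epsilon> :: real assume "\<epsilon> > 0"
  then have "\<epsilon> / 2 > 0" by simp
  with assms obtain m n where m: "m \<in> M" "N (u + m) < qnorm u + \<epsilon> / 2" and n: "n \<in> M" "N (v + n) < qnorm v + \<epsilon> / 2"
    using qnorm_approx by meson
  have "qnorm (u + v) \<le> N ((u + v) + (m + n))"
    using assms m n by (intro qnorm_le subspace_add[OF V] subspace_add[OF M])
  also have "\<dots> = N ((u + m) + (v + n))" by (simp add: algebra_simps)
  also have "\<dots> \<le> N (u + m) + N (v + n)" using assms m n by (intro triangle shifted_V)
  finally show "qnorm (u + v) \<le> qnorm u + qnorm v + \<epsilon>" using m n by simp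
qed

lemma qnorm_eq_0_iff: "v \<in> V \<Longrightarrow> qnorm v = 0 \<longleftrightarrow> cls v = cls 0"
proof
  assume v: "v \<in> V" and "qnorm v = 0"
  then have "v \<in> M" using qnorm_approx[OF v] by (intro closed) auto
  then show "cls v = cls 0" by (simp add: cls_eq)
next
  assume "cls v = cls 0"
  then show "qnorm v = 0" using qnorm_0 by (simp add: qnorm_def)
qed

lemma normed_space_Q: "normed_space Q"
  unfolding normed_space_def carr_Q nzero_Q
  using subspace_0[OF V] subspace_add[OF V] subspace_scale[OF V]
  by (auto simp: nadd_Q nscale_Q qnorm_def[symmetric] qnorm_nonneg qnorm_eq_0_iff qnorm_scale qnorm_triangle
      ac_simps scaleR_add_left scaleR_add_right)

end

section \<open>The space \<open>DD_C0\<close>, its pairing with \<open>M_DD0\<close> and the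
  quotient by \<open>M0\<close>\<close>

lemma distr_of_add: "distr_of (g + h) = distr_of g + distr_of h"
  by (rule distribution_eqI)
    (simp add: plus_distribution.rep_eq dist_apply_distr_of plus_bcontfun.rep_eq distrib_right integrable_bcontfun_test)

lemma distr_of_scale: "distr_of (c *\<^sub>R g) = c *\<^sub>R distr_of g"
  by (rule distribution_eqI)
    (simp add: scaleR_distribution.rep_eq dist_apply_distr_of scaleR_bcontfun.rep_eq mult.assoc)

lemma subspace_C0: "subspace C0"
  by (rule subspaceI)
    (auto simp: C0_def plus_bcontfun.rep_eq scaleR_bcontfun.rep_eq zero_bcontfun.rep_eq
      intro: tendsto_add[of _ 0 _ _ 0, simplified] tendsto_mult_right_zero)

definition DD_of :: "(plane \<Rightarrow>\<^sub>C real) \<Rightarrow> distribution" where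
  "DD_of g = DD (distr_of g)"

lemma DD_of_add: "DD_of (g + h) = DD_of g + DD_of h"
  and DD_of_scale: "DD_of (c *\<^sub>R g) = c *\<^sub>R DD_of g"
  and DD_of_diff: "DD_of (g - h) = DD_of g - DD_of h"
  by (simp_all add: DD_of_def distr_of_add distr_of_scale distr_of_diff DD_add DD_scale DD_diff)

lemma inj_on_DD_of: "inj_on DD_of C0"
proof (rule inj_onI)
  fix g h assume gh: "g \<in> C0" "h \<in> C0" "DD_of g = DD_of h"
  then have "DD (distr_of (g - h)) = 0" using DD_of_diff[of g h] by (simp add: DD_of_def)
  then have "g - h = 0" using gh subspace_diff[OF subspace_C0] by (intro DD_distr_of_eq_0D)
  then show "g = h" by simp
qed

lemma DD_C0_eq: "DD_C0 = DD_of ` C0"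
  by (simp add: DD_C0_def DD_of_def)

lemma C0_primitive_DD_of: "g \<in> C0 \<Longrightarrow> C0_primitive (DD_of g) = g"
  using the_inv_into_f_f[OF inj_on_DD_of] by (simp add: C0_primitive_def DD_of_def[abs_def])

lemma DD_C0_norm_DD_of: "g \<in> C0 \<Longrightarrow> DD_C0_norm (DD_of g) = norm g"
  by (simp add: DD_C0_norm_def C0_primitive_DD_of)

lemma subspace_DD_C0: "subspace DD_C0"
proof (rule subspaceI)
  have "DD_of 0 = 0" using DD_of_scale[of 0 0] by simp
  then show "0 \<in> DD_C0" unfolding DD_C0_eq using subspace_0[OF subspace_C0] by (metis imageI)
  show "u + v \<in> DD_C0" if "u \<in> DD_C0" "v \<in> DD_C0" for u v
    using that subspace_add[OF subspace_C0] unfolding DD_C0_eq by (auto simp: DD_of_add[symmetric])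
  show "c *\<^sub>R u \<in> DD_C0" if "u \<in> DD_C0" for c u
    using that subspace_scale[OF subspace_C0] unfolding DD_C0_eq by (auto simp: DD_of_scale[symmetric])
qed

lemma DD_C0_norm_laws:
  assumes "u \<in> DD_C0"
  shows "0 \<le> DD_C0_norm u" "DD_C0_norm u = 0 \<longleftrightarrow> u = 0" "DD_C0_norm (a *\<^sub>R u) = \<bar>a\<bar> * DD_C0_norm u"
    and "v \<in> DD_C0 \<Longrightarrow> DD_C0_norm (u + v) \<le> DD_C0_norm u + DD_C0_norm v"
proof -
  obtain g where g: "g \<in> C0" "u = DD_of g" using assms by (auto simp: DD_C0_eq)
  show "0 \<le> DD_C0_norm u" using g by (simp add: DD_C0_norm_DD_of)
  have "DD_of 0 = 0" using DD_of_scale[of 0 0] by simp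
  then show "DD_C0_norm u = 0 \<longleftrightarrow> u = 0"
    using g inj_onD[OF inj_on_DD_of, of g 0] subspace_0[OF subspace_C0] by (auto simp: DD_C0_norm_DD_of)
  show "DD_C0_norm (a *\<^sub>R u) = \<bar>a\<bar> * DD_C0_norm u"
    using g subspace_scale[OF subspace_C0, of g a] by (simp add: DD_C0_norm_DD_of DD_of_scale[symmetric])
  assume "v \<in> DD_C0"
  then obtain h where h: "h \<in> C0" "v = DD_of h" by (auto simp: DD_C0_eq)
  show "DD_C0_norm (u + v) \<le> DD_C0_norm u + DD_C0_norm v"
    using g h subspace_add[OF subspace_C0, of g h]
    by (simp add: DD_C0_norm_DD_of DD_of_add[symmetric] norm_triangle_ineq)
qed

lemma normed_space_DD_C0: "normed_space (subspace_with_norm DD_C0 DD_C0_norm)"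
  by (rule normed_space_subspace_with_norm[OF subspace_DD_C0]) (auto intro: DD_C0_norm_laws simp: DD_C0_norm_laws(2,3))

lemma bounded_continuous_bcontfun: "bounded_continuous (apply_bcontfun g)"
  using norm_bounded[of g] by (intro bounded_continuousI[of _ "norm g"]) (auto simp del: split_paired_All)

lemmas bounded_borel_bcontfun = bounded_continuous_bounded_borel[OF bounded_continuous_bcontfun]

text \<open>Resolves the two descriptions hidden in \<open>pairing\<close>: the measure of
  \<open>DD f\<close> and the primitive of an element of \<open>DD_C0\<close>.\<close>

lemma pairing_DD_of:
  assumes "g \<in> C0" "signed_measure \<mu>" "DD f = measure_distr \<mu>"
  shows "pairing f (DD_of g) = signed_integral \<mu> (apply_bcontfun g)"
proof -
  have "measure_of_distr (DD f) = \<mu>"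
    unfolding assms(3) using represents_measure_distr[OF assms(2)] by (rule measure_of_distr_eqI)
  then show ?thesis by (simp add: pairing_def C0_primitive_DD_of[OF assms(1)])
qed

lemma M_DD0_measure:
  assumes "f \<in> M_DD0"
  obtains \<mu> where "signed_measure \<mu>" "vanishes_off unit_square \<mu>" "DD f = measure_distr \<mu>"
    "\<And>e. e \<in> Basis \<Longrightarrow> marginal_zero e \<mu>"
  using M_DD0_balanced[OF assms] unfolding balanced_def by blast

lemma pairing_laws:
  assumes f: "f \<in> M_DD0" and u: "u \<in> DD_C0"
  shows pairing_add: "v \<in> DD_C0 \<Longrightarrow> pairing f (u + v) = pairing f u + pairing f v"
    and pairing_scale: "pairing f (c *\<^sub>R u) = c * pairing f u"
    and abs_pairing_le: "\<bar>pairing f u\<bar> \<le> M_norm (DD f) * DD_C0_norm u"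
proof -
  obtain \<mu> where \<mu>: "signed_measure \<mu>" "vanishes_off unit_square \<mu>" "DD f = measure_distr \<mu>"
    using M_DD0_measure[OF f] by metis
  obtain g where g: "g \<in> C0" "u = DD_of g" using u by (auto simp: DD_C0_eq)
  show "pairing f (u + v) = pairing f u + pairing f v" if v: "v \<in> DD_C0"
  proof -
    obtain h where h: "h \<in> C0" "v = DD_of h" using v by (auto simp: DD_C0_eq)
    show ?thesis
      using g h subspace_add[OF subspace_C0, of g h]
      by (simp add: DD_of_add[symmetric] pairing_DD_of[OF _ \<mu>(1,3)] plus_bcontfun.rep_eq[abs_def]
          signed_integral_add[OF \<mu>(1) bounded_borel_bcontfun bounded_borel_bcontfun])
  qed
  show "pairing f (c *\<^sub>R u) = c * pairing f u"
    using g subspace_scale[OF subspace_C0, of g c]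
    by (simp add: DD_of_scale[symmetric] pairing_DD_of[OF _ \<mu>(1,3)] scaleR_bcontfun.rep_eq[abs_def] signed_integral_scale)
  have "\<bar>signed_integral \<mu> (apply_bcontfun g)\<bar> \<le> norm g * tv \<mu>"
    using bounded_borel_bcontfun[of g] norm_bounded[of g]
    by (intro abs_signed_integral_le[OF \<mu>(1)]) (auto simp: bounded_borel_def simp del: split_paired_All)
  then show "\<bar>pairing f u\<bar> \<le> M_norm (DD f) * DD_C0_norm u"
    using g by (simp add: pairing_DD_of[OF _ \<mu>(1,3)] \<mu>(3) M_norm_measure_distr \<mu>(1) DD_C0_norm_DD_of mult.commute)
qed

lemma pairing_lincomb_left:
  assumes f: "f \<in> M_DD0" and h: "h \<in> M_DD0" and u: "u \<in> DD_C0"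
  shows "pairing (f + c *\<^sub>R h) u = pairing f u + c * pairing h u"
proof -
  obtain \<mu> where \<mu>: "signed_measure \<mu>" "DD f = measure_distr \<mu>" using M_DD0_measure[OF f] by metis
  obtain \<nu> where \<nu>: "signed_measure \<nu>" "DD h = measure_distr \<nu>" using M_DD0_measure[OF h] by metis
  obtain g where g: "g \<in> C0" "u = DD_of g" using u by (auto simp: DD_C0_eq)
  have "DD (f + c *\<^sub>R h) = measure_distr (\<lambda>A. 1 * \<mu> A + c * \<nu> A)"
    unfolding measure_distr_lincomb[OF \<mu>(1) \<nu>(1)] by (simp add: DD_add DD_scale \<mu> \<nu>)
  from pairing_DD_of[OF g(1) signed_measure_lincomb[OF \<mu>(1) \<nu>(1)] this]
  show ?thesis
    by (simp add: g(2) signed_integral_lincomb[OF \<mu>(1) \<nu>(1) bounded_borel_bcontfun, of 1 c g, simplified]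
        pairing_DD_of[OF g(1) \<mu>] pairing_DD_of[OF g(1) \<nu>])
qed

lemma mem_M0: "v \<in> M0 \<longleftrightarrow> v \<in> DD_C0 \<and> (\<forall>f\<in>M_DD0. pairing f v = 0)"
  by (simp add: M0_def)

lemma subspace_M0: "subspace M0"
proof (rule subspaceI)
  have "pairing f 0 = 0" if "f \<in> M_DD0" for f
    using pairing_scale[OF that subspace_0[OF subspace_DD_C0], of 0] by simp
  then show "0 \<in> M0" using subspace_0[OF subspace_DD_C0] by (simp add: mem_M0)
  show "u + v \<in> M0" if "u \<in> M0" "v \<in> M0" for u v
    using that subspace_add[OF subspace_DD_C0] by (auto simp: mem_M0 pairing_add)
  show "c *\<^sub>R u \<in> M0" if "u \<in> M0" for c u
    using that subspace_scale[OF subspace_DD_C0] by (auto simp: mem_M0 pairing_scale)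
qed

interpretation pq: normed_quotient DD_C0 DD_C0_norm M0
proof
  show "subspace DD_C0" "subspace M0" "M0 \<subseteq> DD_C0"
    using subspace_DD_C0 subspace_M0 by (auto simp: mem_M0)
  show "DD_C0_norm 0 = 0" using DD_C0_norm_laws(2)[OF subspace_0[OF subspace_DD_C0]] by simp
  \<comment> \<open>\<open>M0\<close> is closed as an intersection of kernels of functionals bounded
    for \<open>DD_C0_norm\<close>.\<close>
  fix x assume x: "x \<in> DD_C0" and ap: "\<And>\<epsilon>. \<epsilon> > 0 \<Longrightarrow> \<exists>m\<in>M0. DD_C0_norm (x + m) < \<epsilon>"
  have "pairing f x = 0" if f: "f \<in> M_DD0" for f
  proof -
    have "\<bar>pairing f x\<bar> \<le> 0"
    proof (rule field_le_epsilon)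
      fix \<epsilon> :: real assume "\<epsilon> > 0"
      \<comment> \<open>The added 1 keeps the divisor positive when \<open>DD f\<close> is
        0.\<close>
      have T: "M_norm (DD f) + 1 > 0" using M_norm_nonneg[of "DD f"] by linarith
      then have "\<epsilon> / (M_norm (DD f) + 1) > 0" using \<open>\<epsilon> > 0\<close> by simp
      from ap[OF this] obtain m where m: "m \<in> M0" "DD_C0_norm (x + m) < \<epsilon> / (M_norm (DD f) + 1)" by blast
      have mD: "m \<in> DD_C0" "pairing f m = 0" using m(1) f by (auto simp: mem_M0)
      have xm: "x + m \<in> DD_C0" using x mD subspace_add[OF subspace_DD_C0] by blast
      have "\<bar>pairing f x\<bar> = \<bar>pairing f (x + m)\<bar>" using mD by (simp add: pairing_add[OF f x])
      also have "\<dots> \<le> M_norm (DD f) * DD_C0_norm (x + m)" by (rule abs_pairing_le[OF f xm])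
      also have "\<dots> \<le> (M_norm (DD f) + 1) * DD_C0_norm (x + m)"
        using DD_C0_norm_laws(1)[OF xm] by (intro mult_right_mono) auto
      also have "\<dots> \<le> \<epsilon>" using m(2) T by (simp add: field_simps)
      finally show "\<bar>pairing f x\<bar> \<le> 0 + \<epsilon>" by simp
    qed
    then show ?thesis by simp
  qed
  then show "x \<in> M0" using x by (simp add: mem_M0)
qed (auto intro: DD_C0_norm_laws)

lemma predual_eq: "predual = pq.Q"
  by (simp add: predual_def)

lemma pairing_cls:
  assumes f: "f \<in> M_DD0" and v: "v \<in> DD_C0" and w: "w \<in> pq.cls v"
  shows "pairing f w = pairing f v"
proof -
  have "w - v \<in> M0" using w by (simp add: pq.mem_cls)
  then have "w - v \<in> DD_C0" "pairing f (w - v) = 0" using f by (auto simp: mem_M0)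
  then show ?thesis using pairing_add[OF f v, of "w - v"] by simp
qed

text \<open>The pairing is the same for all representatives, by \<open>pairing_cls\<close>;
  \<open>restrict\<close> matches the extensional functionals of \<open>dual_nspace\<close>.\<close>

definition duality :: "distribution \<Rightarrow> distribution set \<Rightarrow> real" where
  "duality f = restrict (\<lambda>A. pairing f (SOME v. v \<in> A)) (carr predual)"

lemma duality_cls:
  assumes "f \<in> M_DD0" "v \<in> DD_C0"
  shows "duality f (pq.cls v) = pairing f v"
proof -
  have "v \<in> pq.cls v" using subspace_0[OF subspace_M0] by (simp add: pq.mem_cls)
  then have "(SOME w. w \<in> pq.cls v) \<in> pq.cls v" by (rule someI)
  from pairing_cls[OF assms this] show ?thesis
    using assms(2) by (simp add: duality_def predual_eq pq.carr_Q)
qed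

lemma abs_pairing_le_qnorm:
  assumes f: "f \<in> M_DD0" and v: "v \<in> DD_C0"
  shows "\<bar>pairing f v\<bar> \<le> M_norm (DD f) * pq.qnorm v"
proof (rule field_le_epsilon)
  fix \<epsilon> :: real assume "\<epsilon> > 0"
  have T: "M_norm (DD f) + 1 > 0" using M_norm_nonneg[of "DD f"] by linarith
  then have "\<epsilon> / (M_norm (DD f) + 1) > 0" using \<open>\<epsilon> > 0\<close> by simp
  from pq.qnorm_approx[OF v this] obtain m where
    m: "m \<in> M0" "DD_C0_norm (v + m) < pq.qnorm v + \<epsilon> / (M_norm (DD f) + 1)" by blast
  have "\<bar>pairing f v\<bar> = \<bar>pairing f (v + m)\<bar>"
    using m(1) f by (simp add: pairing_cls[OF f v, of "v + m"] pq.mem_cls)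
  also have "\<dots> \<le> M_norm (DD f) * DD_C0_norm (v + m)"
    by (rule abs_pairing_le[OF f pq.shifted_V[OF v m(1)]])
  also have "\<dots> \<le> M_norm (DD f) * (pq.qnorm v + \<epsilon> / (M_norm (DD f) + 1))"
    using m(2) by (intro mult_left_mono) auto
  also have "\<dots> = M_norm (DD f) * pq.qnorm v + M_norm (DD f) / (M_norm (DD f) + 1) * \<epsilon>"
    by (simp add: algebra_simps)
  also have "M_norm (DD f) / (M_norm (DD f) + 1) * \<epsilon> \<le> 1 * \<epsilon>"
    using T \<open>\<epsilon> > 0\<close> by (intro mult_right_mono) auto
  finally show "\<bar>pairing f v\<bar> \<le> M_norm (DD f) * pq.qnorm v + \<epsilon>" by simp
qed

section \<open>Cutting off bounded continuous functions\<close>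

lemma compact_unit_square: "compact unit_square"
  unfolding unit_square_def by (intro compact_Times compact_Icc)

definition cutoff :: "plane \<Rightarrow> real" where
  "cutoff z = max 0 (1 - infdist z unit_square)"

lemma cutoff_bounds: "0 \<le> cutoff z" "cutoff z \<le> 1"
  unfolding cutoff_def by (auto simp: infdist_nonneg)

lemma cutoff_unit_square: "z \<in> unit_square \<Longrightarrow> cutoff z = 1"
  unfolding cutoff_def by simp

lemma cutoff_far:
  assumes "norm z \<ge> 3"
  shows "cutoff z = 0"
proof -
  have "(0, 0) \<in> unit_square" by (simp add: unit_square_def)
  then have ne: "unit_square \<noteq> {}" by blast
  obtain w where w: "w \<in> unit_square" "infdist z unit_square = dist z w"
    using infdist_attains_inf[OF compact_imp_closed[OF compact_unit_square] ne, of z] by metis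
  \<comment> \<open>The square has norm at most 2 by this crude bound, so points of norm at least 3
    have distance at least 1 from it, where the cutoff is 0.\<close>
  have "norm w \<le> \<bar>fst w\<bar> + \<bar>snd w\<bar>" using norm_Pair_le[of "fst w" "snd w"] by simp
  also have "\<dots> \<le> 2" using w(1) by (auto simp: mem_unit_square)
  finally have "dist z w \<ge> 1" using assms norm_triangle_sub[of z w] by (simp add: dist_norm)
  then show ?thesis using w(2) by (simp add: cutoff_def)
qed

text \<open>Brings constants and functions of one variable into \<open>C0\<close> without changing
  them on the square or enlarging their bound.\<close>

definition localize :: "(plane \<Rightarrow> real) \<Rightarrow> (plane \<Rightarrow>\<^sub>C real)" where
  "localize g = Bcontfun (\<lambda>z. cutoff z * g z)"

lemma abs_cutoff_mult_le: "\<bar>cutoff z * t\<bar> \<le> \<bar>t\<bar>"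
  using mult_right_mono[OF cutoff_bounds(2), of "\<bar>t\<bar>" z] cutoff_bounds(1)[of z] by (simp add: abs_mult)

lemma localize_apply:
  assumes g: "bounded_continuous g"
  shows "apply_bcontfun (localize g) = (\<lambda>z. cutoff z * g z)"
proof -
  obtain c where c: "\<And>x. \<bar>g x\<bar> \<le> c" using g by (auto simp: bounded_continuous_def)
  have "continuous_on UNIV (\<lambda>z. cutoff z * g z)"
    unfolding cutoff_def by (intro continuous_intros bounded_continuousD(1) g)
  moreover have "norm (cutoff z * g z) \<le> c" for z
    using abs_cutoff_mult_le[of z "g z"] c[of z] by simp
  ultimately have "(\<lambda>z. cutoff z * g z) \<in> bcontfun" by (rule bcontfun_normI)
  then show ?thesis unfolding localize_def by (rule Bcontfun_inverse)
qed

lemma localize_C0: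
  assumes g: "bounded_continuous g"
  shows "localize g \<in> C0"
  unfolding C0_def mem_Collect_eq localize_apply[OF g]
proof (rule tendsto_eventually)
  show "\<forall>\<^sub>F z in at_infinity. cutoff z * g z = 0"
    unfolding eventually_at_infinity by (auto intro!: exI[of _ 3] simp: cutoff_far simp del: split_paired_All)
qed

lemma norm_localize_le:
  assumes g: "bounded_continuous g" and c: "\<And>z. \<bar>g z\<bar> \<le> c"
  shows "norm (localize g) \<le> c"
proof (rule norm_bound)
  show "norm (apply_bcontfun (localize g) z) \<le> c" for z
    unfolding localize_apply[OF g] using abs_cutoff_mult_le[of z "g z"] c[of z] by simp
qed

text \<open>Turns membership in \<open>M0\<close> into a condition on the primitive alone, since
  each \<open>DD f\<close> is one of the measures quantified over here.\<close>

lemma M0_I: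
  assumes g: "g \<in> C0" and zero: "\<And>\<mu>. signed_measure \<mu> \<Longrightarrow> vanishes_off unit_square \<mu> \<Longrightarrow>
    (\<And>e. e \<in> Basis \<Longrightarrow> marginal_zero e \<mu>) \<Longrightarrow> signed_integral \<mu> (apply_bcontfun g) = 0"
  shows "DD_of g \<in> M0"
proof -
  have "pairing f (DD_of g) = 0" if "f \<in> M_DD0" for f
    using M_DD0_measure[OF that] zero pairing_DD_of[OF g] by metis
  then show ?thesis using g by (auto simp: mem_M0 DD_C0_eq)
qed

lemma M0_I_unit_square:
  assumes g: "g \<in> C0" and zero: "\<And>z. z \<in> unit_square \<Longrightarrow> apply_bcontfun g z = 0"
  shows "DD_of g \<in> M0"
proof (rule M0_I[OF g])
  fix \<mu> assume \<mu>: "signed_measure \<mu>" "vanishes_off unit_square \<mu>"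
  have "signed_integral \<mu> (apply_bcontfun g) = signed_integral \<mu> (\<lambda>_. 0)"
    using bounded_borel_bcontfun[of g] zero
    by (intro signed_integral_cong_on[OF \<mu> sets_unit_square]) (auto simp: bounded_borel_def)
  then show "signed_integral \<mu> (apply_bcontfun g) = 0" by (simp add: signed_integral_def)
qed

lemma signed_integral_localize:
  assumes \<mu>: "signed_measure \<mu>" "vanishes_off unit_square \<mu>" and g: "bounded_continuous g"
  shows "signed_integral \<mu> (apply_bcontfun (localize g)) = signed_integral \<mu> g"
  using bounded_borel_bcontfun[of "localize g"] bounded_continuous_bounded_borel[OF g]
  by (intro signed_integral_cong_on[OF \<mu> sets_unit_square])
    (auto simp: bounded_borel_def localize_apply[OF g] cutoff_unit_square)

text \<open>Inner regularity applied to an almost positive and an almost negative set.\<close>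

lemma tv_approx:
  assumes \<mu>: "signed_measure \<mu>" and "\<epsilon> > 0"
  shows "\<exists>g. bounded_continuous g \<and> (\<forall>z. \<bar>g z\<bar> \<le> 1) \<and> tv \<mu> - \<epsilon> \<le> signed_integral \<mu> g"
proof -
  note \<mu>' = signed_measure_uminus[OF \<mu>]
  let ?P = "positive_part \<mu>" and ?N = "negative_part \<mu>"
  interpret P: finite_measure ?P using \<mu> by (rule finite_measure_positive_part)
  interpret N: finite_measure ?N using \<mu>' by (rule finite_measure_positive_part)
  \<comment> \<open>Each Jordan part loses up to \<open>4 * \<delta>\<close>: mass at most
    \<open>\<delta>\<close> on the wrong side of \<open>B\<close> and at most
    \<open>\<delta>\<close> missed by the compact set, both counted twice because \<open>g\<close>
    may take the opposite value there.\<close>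
  define \<delta> where "\<delta> = \<epsilon> / 8"
  have \<delta>: "\<delta> > 0" using assms(2) by (simp add: \<delta>_def)
  from measure_positive_part_approx[OF \<mu> _ \<delta>, of UNIV] obtain B where
    B: "B \<in> sets borel" "measure ?P UNIV - \<delta> < \<mu> B" by auto
  have split: "measure M UNIV = measure M B + measure M (- B)"
    if "finite_measure M" "sets M = sets borel" for M :: "plane measure"
    using finite_measure.finite_measure_Union[OF that(1), of B "- B"] B(1) that(2) by (auto simp: Compl_partition)
  have PN: "measure ?P (- B) \<le> \<delta>" "measure ?N B \<le> \<delta>"
  proof -
    have "\<mu> B = measure ?P B - measure ?N B" by (rule jordan_decomposition[OF \<mu> B(1)])
    moreover have "measure ?P UNIV = measure ?P B + measure ?P (- B)"
      using \<mu> by (intro split finite_measure_positive_part sets_positive_part)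
    ultimately show "measure ?P (- B) \<le> \<delta>" "measure ?N B \<le> \<delta>"
      using B(2) measure_nonneg[of ?P "- B"] measure_nonneg[of ?N B] by linarith+
  qed
  have inner: "\<exists>C. compact C \<and> C \<subseteq> A \<and> measure M A - \<delta> \<le> measure M C"
    if M: "finite_measure M" "sets M = sets borel" and A: "A \<in> sets borel" for M :: "plane measure" and A
  proof (rule ccontr)
    assume no: "\<not> ?thesis"
    interpret finite_measure M by fact
    have "emeasure M A = (SUP K\<in>{K. K \<subseteq> A \<and> compact K}. emeasure M K)"
      using M A emeasure_finite by (intro inner_regular) auto
    also have "\<dots> \<le> ennreal (measure M A - \<delta>)"
      using no by (intro SUP_least) (auto simp: emeasure_eq_measure not_le intro!: ennreal_leI)
    finally have "ennreal (measure M A) \<le> ennreal (measure M A - \<delta>)" by (simp add: emeasure_eq_measure)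
    moreover have "0 \<le> measure M A - \<delta>"
    proof (rule ccontr)
      assume "\<not> 0 \<le> measure M A - \<delta>"
      then have "measure M A - \<delta> \<le> measure M {}" by simp
      with no show False by (metis compact_empty empty_subsetI)
    qed
    ultimately show False using \<delta> by (simp add: ennreal_le_iff)
  qed
  obtain C where C: "compact C" "C \<subseteq> B" "measure ?P B - \<delta> \<le> measure ?P C"
    using inner[OF finite_measure_positive_part[OF \<mu>] sets_positive_part[OF \<mu>] B(1)] by blast
  have "- B \<in> sets borel" using B(1) by simp
  then obtain D where D: "compact D" "D \<subseteq> - B" "measure ?N (- B) - \<delta> \<le> measure ?N D"
    using inner[OF finite_measure_positive_part[OF \<mu>'] sets_positive_part[OF \<mu>']] by blast
  have CD: "C \<inter> D = {}" using C D by blast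
  obtain g :: "plane \<Rightarrow> real" where g: "continuous_on UNIV g" "\<And>x. g x \<in> closed_segment 1 (- 1)"
    "\<And>x. x \<in> C \<Longrightarrow> g x = 1" "\<And>x. x \<in> D \<Longrightarrow> g x = - 1"
    using Urysohn[OF compact_imp_closed[OF C(1)] compact_imp_closed[OF D(1)] CD, of 1 "-1"] by metis
  have g1: "\<bar>g x\<bar> \<le> 1" for x
    using g(2)[of x] by (auto simp: closed_segment_eq_real_ivl split: if_splits)
  have bc: "bounded_continuous g" using g(1) g1 by (rule bounded_continuousI)
  \<comment> \<open>Off \<open>S\<close> the function may drop to -1, so twice the indicator minus 1
    bounds it from below.\<close>
  have low: "2 * measure M S - measure M UNIV \<le> (\<integral>x. h x \<partial>M)"
    if M: "finite_measure M" "sets M = sets borel" and S: "compact S" and h: "bounded_continuous h"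
      "\<And>x. x \<in> S \<Longrightarrow> h x = 1" "\<And>x. - 1 \<le> h x" for M :: "plane measure" and S h
  proof -
    interpret finite_measure M by fact
    have S': "S \<in> sets M" using S M(2) by (simp add: borel_compact)
    have "(\<integral>x. 2 * indicator S x - 1 \<partial>M) \<le> (\<integral>x. h x \<partial>M)"
    proof (rule integral_mono)
      show "integrable M (\<lambda>x. 2 * indicator S x - 1 :: real)"
        using S' by (intro Bochner_Integration.integrable_diff integrable_mult_right integrable_real_indicator)
          (auto simp: emeasure_eq_measure)
      show "integrable M h"
        using M h(1) by (intro integrable_bounded_borel bounded_continuous_bounded_borel)
      show "2 * indicator S x - 1 \<le> h x" for x using h(2,3)[of x] by (auto simp: indicator_def)
    qed
    moreover have "(\<integral>x. 2 * indicator S x - 1 \<partial>M) = 2 * measure M S - measure M UNIV"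
      using S' sets_eq_imp_space_eq[OF M(2)]
      by (subst Bochner_Integration.integral_diff) (auto simp: emeasure_eq_measure)
    ultimately show ?thesis by simp
  qed
  have "2 * measure ?P C - measure ?P UNIV \<le> (\<integral>x. g x \<partial>?P)"
    using g1 by (intro low finite_measure_positive_part sets_positive_part \<mu> C(1) bc g(3)) (auto simp: abs_le_iff minus_le_iff)
  moreover have "2 * measure ?N D - measure ?N UNIV \<le> (\<integral>x. - g x \<partial>?N)"
    using g1 g(4) bounded_continuous_scale[OF bc, of "-1"]
    by (intro low finite_measure_positive_part sets_positive_part \<mu>' D(1)) (auto simp: abs_le_iff)
  moreover have "measure ?P UNIV = measure ?P B + measure ?P (- B)" "measure ?N UNIV = measure ?N B + measure ?N (- B)"
    by (rule split[OF finite_measure_positive_part[OF \<mu>] sets_positive_part[OF \<mu>]],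
      rule split[OF finite_measure_positive_part[OF \<mu>'] sets_positive_part[OF \<mu>']])
  ultimately have "tv \<mu> - \<epsilon> \<le> signed_integral \<mu> g"
    using PN C(3) D(3) unfolding tv_eq[OF \<mu>] signed_integral_def \<delta>_def by (simp add: field_simps)
  then show ?thesis using bc g1 by blast
qed

section \<open>The isometry onto the dual of the quotient\<close>

lemma dual_carr:
  "l \<in> carr (dual_nspace predual) \<longleftrightarrow> l \<in> extensional (pq.cls ` DD_C0) \<and>
    (\<forall>u\<in>DD_C0. \<forall>v\<in>DD_C0. l (pq.cls (u + v)) = l (pq.cls u) + l (pq.cls v)) \<and>
    (\<forall>c. \<forall>u\<in>DD_C0. l (pq.cls (c *\<^sub>R u)) = c * l (pq.cls u)) \<and>
    (\<exists>C. \<forall>u\<in>DD_C0. \<bar>l (pq.cls u)\<bar> \<le> C * pq.qnorm u)"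
  by (simp add: dual_nspace_def predual_eq pq.carr_Q pq.nadd_Q pq.nscale_Q pq.qnorm_def)

lemma duality_carr:
  assumes f: "f \<in> M_DD0"
  shows "duality f \<in> carr (dual_nspace predual)"
  unfolding dual_carr
proof (intro conjI ballI allI)
  show "duality f \<in> extensional (pq.cls ` DD_C0)"
    by (simp add: duality_def predual_eq pq.carr_Q)
  fix u assume u: "u \<in> DD_C0"
  show "duality f (pq.cls (u + v)) = duality f (pq.cls u) + duality f (pq.cls v)" if v: "v \<in> DD_C0" for v
    using u v subspace_add[OF subspace_DD_C0] by (simp add: duality_cls f pairing_add)
  show "duality f (pq.cls (c *\<^sub>R u)) = c * duality f (pq.cls u)" for c
    using u subspace_scale[OF subspace_DD_C0] by (simp add: duality_cls f pairing_scale)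
next
  show "\<exists>C. \<forall>u\<in>DD_C0. \<bar>duality f (pq.cls u)\<bar> \<le> C * pq.qnorm u"
    using abs_pairing_le_qnorm[OF f] by (auto simp: duality_cls f)
qed

lemma dual_norm:
  "nnorm (dual_nspace predual) l = (SUP u\<in>{u\<in>DD_C0. pq.qnorm u \<le> 1}. \<bar>l (pq.cls u)\<bar>)"
proof -
  have "{x \<in> pq.cls ` DD_C0. nnorm pq.Q x \<le> 1} = pq.cls ` {u\<in>DD_C0. pq.qnorm u \<le> 1}"
    by (auto simp: pq.qnorm_def)
  then show ?thesis
    by (simp add: dual_nspace_def predual_eq pq.carr_Q image_image)
qed

text \<open>For the lower bound, the nearly norming function of \<open>tv_approx\<close> is cut off:
  it stays in the unit ball, and the measure sees only the square.\<close>

lemma dual_norm_duality: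
  assumes f: "f \<in> M_DD0"
  shows "nnorm (dual_nspace predual) (duality f) = M_norm (DD f)"
proof -
  let ?U = "{u\<in>DD_C0. pq.qnorm u \<le> 1}"
  obtain \<mu> where \<mu>: "signed_measure \<mu>" "vanishes_off unit_square \<mu>" "DD f = measure_distr \<mu>"
    using M_DD0_measure[OF f] by metis
  have norm: "M_norm (DD f) = tv \<mu>" by (simp add: \<mu>(3) M_norm_measure_distr \<mu>(1))
  have le: "\<bar>duality f (pq.cls u)\<bar> \<le> M_norm (DD f)" if "u \<in> ?U" for u
  proof -
    have "\<bar>duality f (pq.cls u)\<bar> \<le> M_norm (DD f) * pq.qnorm u"
      using that abs_pairing_le_qnorm[OF f] by (simp add: duality_cls f)
    also have "\<dots> \<le> M_norm (DD f) * 1" using that by (intro mult_left_mono) auto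
    finally show ?thesis by simp
  qed
  have "0 \<in> ?U" using subspace_0[OF subspace_DD_C0] by (simp add: pq.qnorm_0)
  then have ne: "?U \<noteq> {}" by blast
  show ?thesis
    unfolding dual_norm
  proof (rule antisym)
    show "(SUP u\<in>?U. \<bar>duality f (pq.cls u)\<bar>) \<le> M_norm (DD f)" by (rule cSUP_least[OF ne le])
    show "M_norm (DD f) \<le> (SUP u\<in>?U. \<bar>duality f (pq.cls u)\<bar>)"
    proof (rule field_le_epsilon)
      fix \<epsilon> :: real assume "\<epsilon> > 0"
      from tv_approx[OF \<mu>(1) this] obtain g where
        g: "bounded_continuous g" "\<And>z. \<bar>g z\<bar> \<le> 1" "tv \<mu> - \<epsilon> \<le> signed_integral \<mu> g" by blast
      let ?u = "DD_of (localize g)"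
      note lC0 = localize_C0[OF g(1)]
      have u: "?u \<in> DD_C0" using lC0 by (simp add: DD_C0_eq)
      have "pq.qnorm ?u \<le> 1"
        using pq.qnorm_le_norm[OF u] norm_localize_le[OF g(1,2)] by (simp add: DD_C0_norm_DD_of[OF lC0])
      then have "\<bar>duality f (pq.cls ?u)\<bar> \<le> (SUP u\<in>?U. \<bar>duality f (pq.cls u)\<bar>)"
        using u le by (intro cSUP_upper) (auto intro!: bdd_aboveI2)
      moreover have "duality f (pq.cls ?u) = signed_integral \<mu> g"
        by (simp add: duality_cls f u pairing_DD_of[OF lC0 \<mu>(1,3)] signed_integral_localize[OF \<mu>(1,2) g(1)])
      ultimately show "M_norm (DD f) \<le> (SUP u\<in>?U. \<bar>duality f (pq.cls u)\<bar>) + \<epsilon>"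
        using g(3) norm by linarith
    qed
  qed
qed

text \<open>One identity for three uses: \<open>c = 1\<close> gives sums, \<open>c = -1\<close>
  differences, and \<open>c - 1\<close> with both elements equal gives multiples.\<close>

lemma duality_lincomb:
  assumes f: "f \<in> M_DD0" and g: "g \<in> M_DD0"
  shows "duality (f + c *\<^sub>R g) = restrict (\<lambda>A. duality f A + c * duality g A) (carr predual)"
proof (rule extensionalityI[of _ "pq.cls ` DD_C0"])
  have fg: "f + c *\<^sub>R g \<in> M_DD0"
    using f g by (intro subspace_add[OF subspace_M_DD0] subspace_scale[OF subspace_M_DD0])
  show "duality (f + c *\<^sub>R g) \<in> extensional (pq.cls ` DD_C0)"
    "restrict (\<lambda>A. duality f A + c * duality g A) (carr predual) \<in> extensional (pq.cls ` DD_C0)"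
    by (simp_all add: duality_def predual_eq pq.carr_Q)
  fix A assume "A \<in> pq.cls ` DD_C0"
  then obtain u where u: "u \<in> DD_C0" "A = pq.cls u" by blast
  then show "duality (f + c *\<^sub>R g) A = restrict (\<lambda>A. duality f A + c * duality g A) (carr predual) A"
    by (simp add: predual_eq pq.carr_Q duality_cls f g fg pairing_lincomb_left)
qed

text \<open>By the isometry, \<open>DD\<close> of the difference has norm 0, and
  \<open>DD_eq_0D\<close> applies.\<close>

lemma duality_inj: "inj_on duality M_DD0"
proof (rule inj_onI)
  fix f g assume f: "f \<in> M_DD0" and g: "g \<in> M_DD0" and eq: "duality f = duality g"
  have d: "f + (-1) *\<^sub>R g \<in> M_DD0"
    using f g by (intro subspace_add[OF subspace_M_DD0] subspace_scale[OF subspace_M_DD0])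
  have "duality (f + (-1) *\<^sub>R g) = restrict (\<lambda>A. 0) (carr predual)"
    unfolding duality_lincomb[OF f g] eq by simp
  then have "M_norm (DD (f + (-1) *\<^sub>R g)) = (SUP u\<in>{u\<in>DD_C0. pq.qnorm u \<le> 1}. 0)"
    using dual_norm_duality[OF d] unfolding dual_norm
    by (simp add: predual_eq pq.carr_Q cong: SUP_cong_simp)
  also have "\<dots> = 0"
    using subspace_0[OF subspace_DD_C0] pq.qnorm_0 by (subst cSUP_const) auto
  finally have "DD (f + (-1) *\<^sub>R g) = 0"
    using M_norm_eq_0_iff[OF M_DD0_is_measure_distr(1)[OF d]] by simp
  moreover have "vanishes_outside_square (f + (-1) *\<^sub>R g)" using d unfolding M_DD0_iff by blast
  ultimately have "f + (-1) *\<^sub>R g = 0" by (rule DD_eq_0D)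
  then show "f = g" by simp
qed

lemma duality_surj:
  assumes l: "l \<in> carr (dual_nspace predual)"
  shows "\<exists>f\<in>M_DD0. duality f = l"
proof -
  from l obtain C where
    ext: "l \<in> extensional (pq.cls ` DD_C0)" and
    add: "\<And>u v. u \<in> DD_C0 \<Longrightarrow> v \<in> DD_C0 \<Longrightarrow> l (pq.cls (u + v)) = l (pq.cls u) + l (pq.cls v)" and
    scale: "\<And>c u. u \<in> DD_C0 \<Longrightarrow> l (pq.cls (c *\<^sub>R u)) = c * l (pq.cls u)" and
    bound: "\<And>u. u \<in> DD_C0 \<Longrightarrow> \<bar>l (pq.cls u)\<bar> \<le> C * pq.qnorm u"
    unfolding dual_carr by blast
  \<comment> \<open>Extends \<open>l\<close> to all bounded continuous functions, as Riesz' theorem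
    is stated for these and the test for marginals uses functions outside \<open>C0\<close>.\<close>
  define L where "L g = l (pq.cls (DD_of (localize g)))" for g
  have D: "DD_of (localize g) \<in> DD_C0" if "bounded_continuous g" for g
    using localize_C0[OF that] by (simp add: DD_C0_eq)
  have M0: "l (pq.cls u) = 0" if "u \<in> M0" for u
  proof -
    have "pq.cls u = pq.cls (0 *\<^sub>R 0)" using that by (simp add: pq.cls_eq)
    then show ?thesis using scale[OF subspace_0[OF subspace_DD_C0], of 0] by simp
  qed
  have "bounded_functional L unit_square \<bar>C\<bar>"
  proof
    show "compact unit_square" by (rule compact_unit_square)
    fix f :: "plane \<Rightarrow> real" assume f: "bounded_continuous f"
    show "L (\<lambda>x. f x + g x) = L f + L g" if g: "bounded_continuous g" for g
    proof -
      have "localize (\<lambda>x. f x + g x) = localize f + localize g"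
        by (rule bcontfun_eqI)
          (simp add: localize_apply[OF f] localize_apply[OF g] localize_apply[OF bounded_continuous_add[OF f g]]
            plus_bcontfun.rep_eq distrib_left)
      then show ?thesis by (simp add: L_def DD_of_add add D f g)
    qed
    show "L (\<lambda>x. c * f x) = c * L f" for c
    proof -
      have "localize (\<lambda>x. c * f x) = c *\<^sub>R localize f"
        by (rule bcontfun_eqI)
          (simp add: localize_apply[OF f] localize_apply[OF bounded_continuous_scale[OF f]] scaleR_bcontfun.rep_eq)
      then show ?thesis by (simp add: L_def DD_of_scale scale D f)
    qed
    show "L f \<le> \<bar>C\<bar> * c" if c: "\<And>x. \<bar>f x\<bar> \<le> c" for c
    proof -
      have "L f \<le> C * pq.qnorm (DD_of (localize f))" using bound[OF D[OF f]] by (simp add: L_def)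
      also have "\<dots> \<le> \<bar>C\<bar> * pq.qnorm (DD_of (localize f))"
        using pq.qnorm_nonneg[OF D[OF f]] by (intro mult_right_mono) auto
      also have "\<dots> \<le> \<bar>C\<bar> * c"
        using pq.qnorm_le_norm[OF D[OF f]] norm_localize_le[OF f c]
        by (intro mult_left_mono) (auto simp: DD_C0_norm_DD_of[OF localize_C0[OF f]])
      finally show ?thesis .
    qed
    show "L f = 0" if "\<And>x. x \<in> unit_square \<Longrightarrow> f x = 0"
      unfolding L_def using that
      by (intro M0 M0_I_unit_square localize_C0 f) (simp add: localize_apply[OF f])
  qed
  from riesz_signed_measure[OF this] obtain \<mu> where
    \<mu>: "signed_measure \<mu>" "vanishes_off unit_square \<mu>" "\<And>g. bounded_continuous g \<Longrightarrow> signed_integral \<mu> g = L g" by blast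
  have "marginal_zero e \<mu>" if e: "e \<in> Basis" for e
  proof (rule marginal_zeroI[OF \<mu>(1)])
    fix n p q
    let ?h = "\<lambda>z. box_bump n p q (proj e z)"
    have "continuous_on UNIV (box_bump n p q)"
      using continuous_test[of UNIV "box_test n p q"] by (simp add: box_test.rep_eq)
    moreover have "continuous_on UNIV (proj e)" unfolding proj_def by (intro continuous_intros)
    ultimately have "continuous_on UNIV ?h" by (rule continuous_on_compose2) auto
    then have h: "bounded_continuous ?h"
      using box_bump_nonneg box_bump_le_1 by (intro bounded_continuousI[of _ 1]) (auto simp: abs_of_nonneg)
    have "DD_of (localize ?h) \<in> M0"
    proof (rule M0_I[OF localize_C0[OF h]])
      fix \<nu> assume \<nu>: "signed_measure \<nu>" "vanishes_off unit_square \<nu>" "\<And>e. e \<in> Basis \<Longrightarrow> marginal_zero e \<nu>"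
      show "signed_integral \<nu> (apply_bcontfun (localize ?h)) = 0"
        unfolding signed_integral_localize[OF \<nu>(1,2) h]
        using \<nu>(3)[OF e] bounded_borel_box_bump unfolding marginal_zero_def by blast
    qed
    then show "signed_integral \<mu> ?h = 0" unfolding \<mu>(3)[OF h] L_def by (rule M0)
  qed
  then have "balanced \<mu>" using \<mu> by (simp add: balanced_def)
  from balanced_M_DD0[OF this] obtain f where f: "f \<in> M_DD0" "DD f = measure_distr \<mu>" by blast
  have "duality f = l"
  proof (rule extensionalityI[OF _ ext])
    show "duality f \<in> extensional (pq.cls ` DD_C0)" by (simp add: duality_def predual_eq pq.carr_Q)
    fix A assume "A \<in> pq.cls ` DD_C0"
    then obtain g where g: "g \<in> C0" "A = pq.cls (DD_of g)" by (auto simp: DD_C0_eq)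
    have bc: "bounded_continuous (apply_bcontfun g)" by (rule bounded_continuous_bcontfun)
    have u: "DD_of g \<in> DD_C0" using g by (simp add: DD_C0_eq)
    \<comment> \<open>A function of \<open>C0\<close> and its cut-off version agree on the square,
      so they define the same class and \<open>L\<close> recovers \<open>l\<close>.\<close>
    let ?d = "localize (apply_bcontfun g) - g"
    have "DD_of ?d \<in> M0"
      using g(1) localize_C0[OF bc] subspace_diff[OF subspace_C0]
      by (intro M0_I_unit_square) (auto simp: minus_bcontfun.rep_eq localize_apply[OF bc] cutoff_unit_square)
    then have cls: "pq.cls (DD_of (localize (apply_bcontfun g))) = pq.cls (DD_of g)"
      by (simp add: pq.cls_eq DD_of_diff)
    have "duality f A = signed_integral \<mu> (apply_bcontfun g)"
      by (simp add: g(2) duality_cls f u pairing_DD_of[OF g(1) \<mu>(1) f(2)])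
    also have "\<dots> = l A" unfolding \<mu>(3)[OF bc] L_def cls g(2) ..
    finally show "duality f A = l A" .
  qed
  with f(1) show ?thesis by blast
qed

lemma isometric_isomorphism_duality:
  "isometric_isomorphism duality (subspace_with_norm M_DD0 (\<lambda>f. M_norm (DD f))) (dual_nspace predual)"
  unfolding isometric_isomorphism_def subspace_with_norm_simps
proof (intro conjI ballI allI)
  show "bij_betw duality M_DD0 (carr (dual_nspace predual))"
    unfolding bij_betw_def using duality_inj duality_carr duality_surj by blast
  fix f assume f: "f \<in> M_DD0"
  show "nnorm (dual_nspace predual) (duality f) = M_norm (DD f)" by (rule dual_norm_duality[OF f])
  show "duality (f + g) = nadd (dual_nspace predual) (duality f) (duality g)" if g: "g \<in> M_DD0" for g
    using duality_lincomb[OF f g, of 1] by (simp add: dual_nspace_def)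
  show "duality (c *\<^sub>R f) = nscale (dual_nspace predual) c (duality f)" for c
  proof -
    have "duality (f + (c - 1) *\<^sub>R f) = restrict (\<lambda>A. duality f A + (c - 1) * duality f A) (carr predual)"
      by (rule duality_lincomb[OF f f])
    moreover have "f + (c - 1) *\<^sub>R f = c *\<^sub>R f" by (simp add: scaleR_diff_left)
    ultimately show ?thesis by (simp add: dual_nspace_def algebra_simps)
  qed
qed

theorem theorem1:
  fixes \<theta> :: real
  assumes "\<theta> \<in> {0<..1}"
  shows
    "(subspace M_DD0 \<and>
      (\<forall>f\<in>M_DD0. M_norm_well_defined (DD f) \<and> M_norm_well_defined (D1 f) \<and>
        M_norm_well_defined (D2 f)) \<and>
      (\<forall>\<theta>1\<in>{0<..1}. normed_space (subspace_with_norm M_DD0 (norm_theta \<theta>1))) \<and>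
      (\<forall>\<theta>1\<in>{0<..1}. \<forall>\<theta>2\<in>{0<..1}. \<exists>C>0. \<forall>f\<in>M_DD0.
        norm_theta \<theta>1 f \<le> C * norm_theta \<theta>2 f)) \<and>
     banach_space (subspace_with_norm M_DD0 (norm_theta \<theta>)) \<and>
     (inj_on (\<lambda>\<phi>. DD (distr_of \<phi>)) C0 \<and>
      normed_space (subspace_with_norm DD_C0 DD_C0_norm) \<and>
      normed_space predual \<and>
      (\<exists>J. isometric_isomorphism J (subspace_with_norm M_DD0 (\<lambda>f. M_norm (DD f)))
             (dual_nspace predual) \<and>
           (\<forall>f\<in>M_DD0. \<forall>v\<in>DD_C0.
             J f (coset (subspace_with_norm DD_C0 DD_C0_norm) M0 v) = pairing f v)))"
proof (intro conjI ballI)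
  show "subspace M_DD0" by (rule subspace_M_DD0)
  show "M_norm_well_defined (DD f)" "M_norm_well_defined (D1 f)" "M_norm_well_defined (D2 f)" if "f \<in> M_DD0" for f
    using M_DD0_is_measure_distr[OF that] by (auto intro: is_measure_distr_well_defined)
  show "normed_space (subspace_with_norm M_DD0 (norm_theta \<theta>1))" if "\<theta>1 \<in> {0<..1}" for \<theta>1
    using that by (rule normed_space_norm_theta)
  show "\<exists>C>0. \<forall>f\<in>M_DD0. norm_theta \<theta>1 f \<le> C * norm_theta \<theta>2 f" if "\<theta>1 \<in> {0<..1}" "\<theta>2 \<in> {0<..1}" for \<theta>1 \<theta>2
    using that by (rule norm_theta_equivalent)
  show "banach_space (subspace_with_norm M_DD0 (norm_theta \<theta>))" by (rule banach_space_norm_theta[OF assms])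
  show "inj_on (\<lambda>\<phi>. DD (distr_of \<phi>)) C0" using inj_on_DD_of by (simp add: DD_of_def[abs_def])
  show "normed_space (subspace_with_norm DD_C0 DD_C0_norm)" by (rule normed_space_DD_C0)
  show "normed_space predual" unfolding predual_eq by (rule pq.normed_space_Q)
  show "\<exists>J. isometric_isomorphism J (subspace_with_norm M_DD0 (\<lambda>f. M_norm (DD f))) (dual_nspace predual) \<and>
      (\<forall>f\<in>M_DD0. \<forall>v\<in>DD_C0. J f (coset (subspace_with_norm DD_C0 DD_C0_norm) M0 v) = pairing f v)"
    using isometric_isomorphism_duality by (auto simp: pq.coset_eq duality_cls intro!: exI[of _ duality])
qed

end
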